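(* (i) There exists a spectral sequence $(E_r^{p,q},d_r)$ derived from the filtration $\{K_p\}_{p\geq 0}$ of $(\Omega^*(M),D)$, where $E_1^{p,q}=H_D^{p+q}(K_p/K_{p+1})$ and $d_1=j_1k_1$, and $E_2^{p,q}=H_{d_1}(E_1^{p,q})$ and $d_2=j_2k_2$. The bidegree of $d_r$ is $(r,1-r)$. (ii) The spectral sequence $\{E_r^{p,q},d_r\}$ converges to the twisted de Rham cohomology: $$\bigoplus_{p+q=1}E_\infty^{p,q}\cong H^o(M,H)\quad\text{and}\quad \bigoplus_{p+q=0}E_\infty^{p,q}\cong H^e(M,H).$$
   Context: $M$ is a smooth compact closed manifold of dimension $n$; $\Omega^{*}(M)$ is the space of real smooth differential forms, $d$ the exterior derivative; $H=\sum_{i=1}^{[\frac{n-1}{2}]}H_{2i+1}$ with $H_{2i+1}$ a closed $(2i+1)$-form, $[\cdot]$ being the integer part. Put $D=d+H$, where $H$ acts by $w\mapsto H\wedge w$; then $D^2=0$. Let $\Omega^o(M)$, $\Omega^e(M)$ be the sums of the $\Omega^i(M)$ with $i$ odd, respectively even; $D$ interchanges them. The twisted de Rham cohomology groups are $H^o(M,H)=\ker[D:\Omega^o\to\Omega^e]/\mathrm{im}[D:\Omega^e\to\Omega^o]$ and $H^e(M,H)=\ker[D:\Omega^e\to\Omega^o]/\mathrm{im}[D:\Omega^o\to\Omega^e]$. The filtration is $K_p=\bigoplus_{i\geq p}\Omega^i(M)$ (so $K_p=\Omega^*(M)$ for $p\le 0$ and $K_{n+1}=0$); $D(K_p)\subset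 K_p$. Each of $K_p$, $K_p/K_{p+1}$ splits into an even-degree and an odd-degree part interchanged by $D$; $H_D^i(\cdot)$ denotes the $D$-cohomology at the even part if $i$ is even and at the odd part if $i$ is odd. The exact couple is $D_1^{p,q}=H_D^{p+q}(K_p)$, $E_1^{p,q}=H_D^{p+q}(K_p/K_{p+1})$ with $i_1=i^*$ (bidegree $(-1,1)$), $j_1=j^*$ (bidegree $(0,0)$), $k_1=\delta$ (bidegree $(1,0)$) the maps of the long exact sequence of $0\to K_{p+1}\to K_p\to K_p/K_{p+1}\to 0$. Derived couples: $D_{r+1}=i_r(D_r)$, $E_{r+1}=H_{d_r}(E_r)$ with $d_r=j_rk_r$, $i_{r+1}=i_r|_{D_{r+1}}$, $j_{r+1}(i_ra)=[j_ra]$, $k_{r+1}[b]=k_rb$. *)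

theory Defs
  imports "HOL-Analysis.Analysis" "HOL-Algebra.Algebraic_Closure_Type"
begin

section \<open>Smooth manifolds\<close>

primrec times_cont_diff_on ::
  "nat \<Rightarrow> 'b::real_normed_vector set \<Rightarrow> ('b \<Rightarrow> 'c::real_normed_vector) \<Rightarrow> bool" where
  "times_cont_diff_on 0 S f \<longleftrightarrow> continuous_on S f"
| "times_cont_diff_on (Suc k) S f \<longleftrightarrow> (\<forall>x\<in>S. f differentiable at x) \<and>
     (\<forall>v. times_cont_diff_on k S (\<lambda>x. frechet_derivative f (at x) v))"

text \<open>Only used for open subsets of a Euclidean space.\<close>

definition smooth_on :: "'b::real_normed_vector set \<Rightarrow> ('b \<Rightarrow> 'c::real_normed_vector) \<Rightarrow> bool" where
  "smooth_on S f \<longleftrightarrow> (\<forall>k. times_cont_diff_on k S f)"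

text \<open>A chart is a domain together with a coordinate map. The values of the coordinate map outside
  the domain are irrelevant.\<close>

type_synonym ('a, 'b) chart = "'a set \<times> ('a \<Rightarrow> 'b)"

abbreviation chart_dom :: "('a, 'b) chart \<Rightarrow> 'a set" where
  "chart_dom \<equiv> fst"

abbreviation chart_map :: "('a, 'b) chart \<Rightarrow> 'a \<Rightarrow> 'b" where
  "chart_map \<equiv> snd"

definition chart_img :: "('a, 'b) chart \<Rightarrow> 'b set" where
  "chart_img c = chart_map c ` chart_dom c"

definition transition :: "('a, 'b) chart \<Rightarrow> ('a, 'b) chart \<Rightarrow> 'b \<Rightarrow> 'b" where
  "transition c c' x = chart_map c' (inv_into (chart_dom c) (chart_map c) x)"

text \<open>Charts have open image in the full Euclidean space, so there is no boundary. The dimension is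
  \<open>DIM('b)\<close>.\<close>

definition smooth_manifold :: "'a topology \<Rightarrow> ('a, 'b::euclidean_space) chart set \<Rightarrow> bool" where
  "smooth_manifold T A \<longleftrightarrow>
     Hausdorff_space T \<and> second_countable T \<and>
     (\<Union>c\<in>A. chart_dom c) = topspace T \<and>
     (\<forall>c\<in>A. openin T (chart_dom c) \<and> open (chart_img c) \<and>
        homeomorphic_map (subtopology T (chart_dom c)) (top_of_set (chart_img c)) (chart_map c)) \<and>
     (\<forall>c\<in>A. \<forall>c'\<in>A.
        smooth_on (chart_map c ` (chart_dom c \<inter> chart_dom c')) (transition c c'))"

section \<open>Differential forms\<close>

text \<open>A function on lists of vectors whose restriction to lists of each length \<open>k\<close> is an alternating
  \<open>k\<close>-linear form encodes an inhomogeneous alternating form. Its degree \<open>k\<close> component is that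
  restriction. The components of degree above \<open>DIM('b)\<close> vanish automatically, so this is the direct
  sum of the exterior powers of the dual space.\<close>

definition alternating_form :: "('b::real_vector list \<Rightarrow> real) \<Rightarrow> bool" where
  "alternating_form \<alpha> \<longleftrightarrow>
     (\<forall>us ws. linear (\<lambda>v. \<alpha> (us @ v # ws))) \<and>
     (\<forall>us vs ws v. \<alpha> (us @ v # vs @ v # ws) = 0)"

text \<open>A form on the manifold is given by its coordinate representations in all charts of the atlas,
  which must agree under pull-back along the transition maps. Off the charts the representation
  is normalised to zero. The set \<open>forms A I\<close> is the direct sum of the \<open>\<Omega>\<^sup>k\<close> over \<open>k \<in> I\<close>.\<close>

type_synonym ('a, 'b) dform = "('a, 'b) chart \<Rightarrow> 'b \<Rightarrow> 'b list \<Rightarrow> real"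

definition forms :: "('a, 'b::euclidean_space) chart set \<Rightarrow> nat set \<Rightarrow> ('a, 'b) dform set" where
  "forms A I = {\<omega>.
     (\<forall>c x. \<not> (c \<in> A \<and> x \<in> chart_img c) \<longrightarrow> \<omega> c x = (\<lambda>_. 0)) \<and>
     (\<forall>c\<in>A. \<forall>x\<in>chart_img c. alternating_form (\<omega> c x)) \<and>
     (\<forall>c\<in>A. \<forall>vs. smooth_on (chart_img c) (\<lambda>x. \<omega> c x vs)) \<and>
     (\<forall>c\<in>A. \<forall>c'\<in>A. \<forall>m\<in>chart_dom c \<inter> chart_dom c'. \<forall>vs.
        \<omega> c (chart_map c m) vs =
        \<omega> c' (chart_map c' m)
          (map (frechet_derivative (transition c c') (at (chart_map c m))) vs)) \<and>
     (\<forall>c x vs. length vs \<notin> I \<longrightarrow> \<omega> c x vs = 0)}"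

text \<open>The sum runs over all ways of distributing the arguments to the two factors, with the sign of
  the corresponding shuffle.\<close>

definition wedge_alt :: "('b list \<Rightarrow> real) \<Rightarrow> ('b list \<Rightarrow> real) \<Rightarrow> 'b list \<Rightarrow> real" where
  "wedge_alt \<alpha> \<beta> vs =
     (\<Sum>S\<in>Pow {..<length vs}.
        (-1) ^ card {(i, j). i < j \<and> j < length vs \<and> i \<notin> S \<and> j \<in> S} *
        \<alpha> (nths vs S) * \<beta> (nths vs (- S)))"

definition wedge :: "('a, 'b) dform \<Rightarrow> ('a, 'b) dform \<Rightarrow> ('a, 'b) dform" where
  "wedge \<omega> \<eta> = (\<lambda>c x. wedge_alt (\<omega> c x) (\<eta> c x))"

text \<open>In coordinates, \<open>d\<omega> (v\<^sub>0, \<dots>, v\<^sub>k)\<close> is the alternating sum of the directional derivatives along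
  \<open>v\<^sub>i\<close> of \<open>\<omega>\<close> applied to the remaining vectors.\<close>

definition ext_deriv :: "('a, 'b::euclidean_space) chart set \<Rightarrow> ('a, 'b) dform \<Rightarrow> ('a, 'b) dform" where
  "ext_deriv A \<omega> = (\<lambda>c x vs.
     if c \<in> A \<and> x \<in> chart_img c then
       (\<Sum>i<length vs. (-1) ^ i *
          frechet_derivative (\<lambda>y. \<omega> c y (take i vs @ drop (Suc i) vs)) (at x) (vs ! i))
     else 0)"

definition twisted_deriv ::
  "('a, 'b::euclidean_space) chart set \<Rightarrow> ('a, 'b) dform \<Rightarrow> ('a, 'b) dform \<Rightarrow> ('a, 'b) dform" where
  "twisted_deriv A H \<omega> = (\<lambda>c x vs. ext_deriv A \<omega> c x vs + wedge H \<omega> c x vs)"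

section \<open>Real vector spaces as modules\<close>

abbreviation real_ring :: "real ring" where
  "real_ring \<equiv> ring_of_type_algebra"

text \<open>The fields \<open>mult\<close> and \<open>one\<close>, which a module record inherits from the ring record, carry no
  meaning for modules and are left unspecified.\<close>

definition form_space ::
  "('a, 'b::euclidean_space) chart set \<Rightarrow> nat set \<Rightarrow> (real, ('a, 'b) dform) module" where
  "form_space A I =
     \<lparr>carrier = forms A I, mult = undefined, one = undefined,
      zero = (\<lambda>_ _ _. 0),
      add = (\<lambda>\<omega> \<eta> c x vs. \<omega> c x vs + \<eta> c x vs),
      smult = (\<lambda>a \<omega> c x vs. a * \<omega> c x vs)\<rparr>"

definition quot_mod :: "(real, 'x) module \<Rightarrow> 'x set \<Rightarrow> (real, 'x set) module" where
  "quot_mod M N =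
     \<lparr>carrier = a_rcosets\<^bsub>M\<^esub> N, mult = undefined, one = undefined,
      zero = N,
      add = (\<lambda>S T. S <+>\<^bsub>M\<^esub> T),
      smult = (\<lambda>a S. N <+>\<^bsub>M\<^esub> ((\<lambda>x. a \<odot>\<^bsub>M\<^esub> x) ` S))\<rparr>"

text \<open>The map into the quotient of \<open>M'\<close> by \<open>N'\<close> induced by \<open>f\<close>.\<close>

definition quot_map :: "(real, 'y) module \<Rightarrow> 'y set \<Rightarrow> ('x \<Rightarrow> 'y) \<Rightarrow> 'x set \<Rightarrow> 'y set" where
  "quot_map M' N' f S = N' <+>\<^bsub>M'\<^esub> (f ` S)"

definition lin_maps :: "(real, 'x) module \<Rightarrow> (real, 'y) module \<Rightarrow> ('x \<Rightarrow> 'y) set" where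
  "lin_maps M N = {f \<in> carrier M \<rightarrow> carrier N.
     (\<forall>x\<in>carrier M. \<forall>y\<in>carrier M. f (x \<oplus>\<^bsub>M\<^esub> y) = f x \<oplus>\<^bsub>N\<^esub> f y) \<and>
     (\<forall>a. \<forall>x\<in>carrier M. f (a \<odot>\<^bsub>M\<^esub> x) = a \<odot>\<^bsub>N\<^esub> f x)}"

definition lin_isos :: "(real, 'x) module \<Rightarrow> (real, 'y) module \<Rightarrow> ('x \<Rightarrow> 'y) set" where
  "lin_isos M N = {f \<in> lin_maps M N. bij_betw f (carrier M) (carrier N)}"

definition lin_isomorphic :: "(real, 'x) module \<Rightarrow> (real, 'y) module \<Rightarrow> bool" where
  "lin_isomorphic M N \<longleftrightarrow> lin_isos M N \<noteq> {}"

definition direct_sum :: "'i set \<Rightarrow> ('i \<Rightarrow> (real, 'x) module) \<Rightarrow> (real, 'i \<Rightarrow> 'x) module" where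
  "direct_sum I M =
     \<lparr>carrier = {f \<in> \<Pi>\<^sub>E i\<in>I. carrier (M i). finite {i \<in> I. f i \<noteq> \<zero>\<^bsub>M i\<^esub>}},
      mult = undefined, one = undefined,
      zero = (\<lambda>i\<in>I. \<zero>\<^bsub>M i\<^esub>),
      add = (\<lambda>f g. \<lambda>i\<in>I. f i \<oplus>\<^bsub>M i\<^esub> g i),
      smult = (\<lambda>a f. \<lambda>i\<in>I. a \<odot>\<^bsub>M i\<^esub> f i)\<rparr>"

section \<open>Cohomology\<close>

text \<open>A \<open>\<int>/2\<close>-graded complex is treated as a 2-periodic complex indexed by the integers; \<open>d i\<close> maps
  \<open>M i\<close> to \<open>M (i + 1)\<close>.\<close>

definition cocycles ::
  "(int \<Rightarrow> (real, 'x) module) \<Rightarrow> (int \<Rightarrow> 'x \<Rightarrow> 'x) \<Rightarrow> int \<Rightarrow> (real, 'x) module" where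
  "cocycles M d i = (M i)\<lparr>carrier := {x \<in> carrier (M i). d i x = \<zero>\<^bsub>M (i + 1)\<^esub>}\<rparr>"

definition coboundaries ::
  "(int \<Rightarrow> (real, 'x) module) \<Rightarrow> (int \<Rightarrow> 'x \<Rightarrow> 'x) \<Rightarrow> int \<Rightarrow> 'x set" where
  "coboundaries M d i = d (i - 1) ` carrier (M (i - 1))"

definition cohomology ::
  "(int \<Rightarrow> (real, 'x) module) \<Rightarrow> (int \<Rightarrow> 'x \<Rightarrow> 'x) \<Rightarrow> int \<Rightarrow> (real, 'x set) module" where
  "cohomology M d i = quot_mod (cocycles M d i) (coboundaries M d i)"

definition coh_class ::
  "(int \<Rightarrow> (real, 'x) module) \<Rightarrow> (int \<Rightarrow> 'x \<Rightarrow> 'x) \<Rightarrow> int \<Rightarrow> 'x \<Rightarrow> 'x set" where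
  "coh_class M d i x = coboundaries M d i +>\<^bsub>M i\<^esub> x"

text \<open>The even or odd part of \<open>\<Omega>\<^sup>*\<close>, according to the parity of \<open>i\<close>.\<close>

definition Omega_par ::
  "('a, 'b::euclidean_space) chart set \<Rightarrow> int \<Rightarrow> (real, ('a, 'b) dform) module" where
  "Omega_par A i = form_space A {k. even k \<longleftrightarrow> even i}"

text \<open>For \<open>i = 1\<close> this is \<open>H\<^sup>o(M, H)\<close>, for \<open>i = 0\<close> it is \<open>H\<^sup>e(M, H)\<close>.\<close>

definition twisted_cohomology ::
  "('a, 'b::euclidean_space) chart set \<Rightarrow> ('a, 'b) dform \<Rightarrow> int \<Rightarrow>
    (real, ('a, 'b) dform set) module" where
  "twisted_cohomology A H = cohomology (Omega_par A) (\<lambda>_. twisted_deriv A H)"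

section \<open>The filtration and its exact couple\<close>

definition K ::
  "('a, 'b::euclidean_space) chart set \<Rightarrow> int \<Rightarrow> int \<Rightarrow> (real, ('a, 'b) dform) module" where
  "K A p i = form_space A {k. p \<le> int k \<and> (even k \<longleftrightarrow> even i)}"

definition K_cohomology ::
  "('a, 'b::euclidean_space) chart set \<Rightarrow> ('a, 'b) dform \<Rightarrow> int \<Rightarrow> int \<Rightarrow>
    (real, ('a, 'b) dform set) module" where
  "K_cohomology A H p = cohomology (K A p) (\<lambda>_. twisted_deriv A H)"

definition gr ::
  "('a, 'b::euclidean_space) chart set \<Rightarrow> int \<Rightarrow> int \<Rightarrow> (real, ('a, 'b) dform set) module" where
  "gr A p i = quot_mod (K A p i) (carrier (K A (p + 1) i))"

definition gr_proj ::
  "('a, 'b::euclidean_space) chart set \<Rightarrow> int \<Rightarrow> int \<Rightarrow> ('a, 'b) dform \<Rightarrow> ('a, 'b) dform set" where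
  "gr_proj A p i x = carrier (K A (p + 1) i) +>\<^bsub>K A p i\<^esub> x"

definition gr_deriv ::
  "('a, 'b::euclidean_space) chart set \<Rightarrow> ('a, 'b) dform \<Rightarrow> int \<Rightarrow> int \<Rightarrow>
    ('a, 'b) dform set \<Rightarrow> ('a, 'b) dform set" where
  "gr_deriv A H p i =
     quot_map (K A p (i + 1)) (carrier (K A (p + 1) (i + 1))) (twisted_deriv A H)"

definition gr_cohomology ::
  "('a, 'b::euclidean_space) chart set \<Rightarrow> ('a, 'b) dform \<Rightarrow> int \<Rightarrow> int \<Rightarrow>
    (real, ('a, 'b) dform set set) module" where
  "gr_cohomology A H p = cohomology (gr A p) (gr_deriv A H p)"

text \<open>The connecting map \<open>H\<^sup>i(K\<^sub>p/K\<^sub>p\<^sub>+\<^sub>1) \<rightarrow> H\<^sup>i\<^sup>+\<^sup>1(K\<^sub>p\<^sub>+\<^sub>1)\<close>.\<close>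

definition connecting ::
  "('a, 'b::euclidean_space) chart set \<Rightarrow> ('a, 'b) dform \<Rightarrow> int \<Rightarrow> int \<Rightarrow>
    ('a, 'b) dform set set \<Rightarrow> ('a, 'b) dform set" where
  "connecting A H p i \<xi> = (THE \<eta>. \<exists>x\<in>carrier (K A p i).
     twisted_deriv A H x \<in> carrier (K A (p + 1) (i + 1)) \<and>
     \<xi> = coh_class (gr A p) (gr_deriv A H p) i (gr_proj A p i x) \<and>
     \<eta> = coh_class (K A (p + 1)) (\<lambda>_. twisted_deriv A H) (i + 1) (twisted_deriv A H x))"

text \<open>A bigraded couple. With a parameter \<open>r\<close> supplied separately, the maps have source and target
  \<open>imap p q : D\<^sup>p\<^sup>,\<^sup>q \<rightarrow> D\<^bsup>p-1,q+1\<^esup>\<close>, \<open>jmap p q : D\<^sup>p\<^sup>,\<^sup>q \<rightarrow> E\<^bsup>p+r-1,q-r+1\<^esup>\<close>,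
  \<open>kmap p q : E\<^sup>p\<^sup>,\<^sup>q \<rightarrow> D\<^bsup>p+1,q\<^esup>\<close>; for \<open>r = 1\<close> the map \<open>jmap\<close> has bidegree \<open>(0, 0)\<close>.\<close>

record ('d, 'e) couple =
  dobj :: "int \<Rightarrow> int \<Rightarrow> (real, 'd) module"
  eobj :: "int \<Rightarrow> int \<Rightarrow> (real, 'e) module"
  imap :: "int \<Rightarrow> int \<Rightarrow> 'd \<Rightarrow> 'd"
  jmap :: "int \<Rightarrow> int \<Rightarrow> 'd \<Rightarrow> 'e"
  kmap :: "int \<Rightarrow> int \<Rightarrow> 'e \<Rightarrow> 'd"

definition filtration_couple ::
  "('a, 'b::euclidean_space) chart set \<Rightarrow> ('a, 'b) dform \<Rightarrow>
    (('a, 'b) dform set, ('a, 'b) dform set set) couple" where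
  "filtration_couple A H =
     \<lparr>dobj = (\<lambda>p q. K_cohomology A H p (p + q)),
      eobj = (\<lambda>p q. gr_cohomology A H p (p + q)),
      imap = (\<lambda>p q. quot_map (K A (p - 1) (p + q))
        (coboundaries (K A (p - 1)) (\<lambda>_. twisted_deriv A H) (p + q)) (\<lambda>x. x)),
      jmap = (\<lambda>p q. quot_map (gr A p (p + q))
        (coboundaries (gr A p) (gr_deriv A H p) (p + q)) (gr_proj A p (p + q))),
      kmap = (\<lambda>p q. connecting A H p (p + q))\<rparr>"

definition exact_couple :: "nat \<Rightarrow> ('d, 'e) couple \<Rightarrow> bool" where
  "exact_couple r C \<longleftrightarrow> (\<forall>p q.
     module real_ring (dobj C p q) \<and> module real_ring (eobj C p q) \<and>
     imap C p q \<in> lin_maps (dobj C p q) (dobj C (p - 1) (q + 1)) \<and>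
     jmap C p q \<in> lin_maps (dobj C p q) (eobj C (p + int r - 1) (q - int r + 1)) \<and>
     kmap C p q \<in> lin_maps (eobj C p q) (dobj C (p + 1) q) \<and>
     imap C (p + 1) (q - 1) ` carrier (dobj C (p + 1) (q - 1)) =
       {x \<in> carrier (dobj C p q). jmap C p q x = \<zero>\<^bsub>eobj C (p + int r - 1) (q - int r + 1)\<^esub>} \<and>
     jmap C (p - int r + 1) (q + int r - 1) ` carrier (dobj C (p - int r + 1) (q + int r - 1)) =
       {x \<in> carrier (eobj C p q). kmap C p q x = \<zero>\<^bsub>dobj C (p + 1) q\<^esub>} \<and>
     kmap C (p - 1) q ` carrier (eobj C (p - 1) q) =
       {x \<in> carrier (dobj C p q). imap C p q x = \<zero>\<^bsub>dobj C (p - 1) (q + 1)\<^esub>})"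

definition couple_diff :: "('d, 'e) couple \<Rightarrow> int \<Rightarrow> int \<Rightarrow> 'e \<Rightarrow> 'e" where
  "couple_diff C p q x = jmap C (p + 1) q (kmap C p q x)"

text \<open>Kernel, image and homology at \<open>(p, q)\<close> of a differential of bidegree \<open>(r, 1 - r)\<close>.\<close>

definition page_boundaries ::
  "nat \<Rightarrow> (int \<Rightarrow> int \<Rightarrow> (real, 'e) module) \<Rightarrow> (int \<Rightarrow> int \<Rightarrow> 'e \<Rightarrow> 'e) \<Rightarrow> int \<Rightarrow> int \<Rightarrow> 'e set" where
  "page_boundaries r E d p q =
     d (p - int r) (q + int r - 1) ` carrier (E (p - int r) (q + int r - 1))"

definition page_cycles ::
  "nat \<Rightarrow> (int \<Rightarrow> int \<Rightarrow> (real, 'e) module) \<Rightarrow> (int \<Rightarrow> int \<Rightarrow> 'e \<Rightarrow> 'e) \<Rightarrow> int \<Rightarrow> int \<Rightarrow>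
    (real, 'e) module" where
  "page_cycles r E d p q = (E p q)
     \<lparr>carrier := {x \<in> carrier (E p q). d p q x = \<zero>\<^bsub>E (p + int r) (q - int r + 1)\<^esub>}\<rparr>"

definition page_homology ::
  "nat \<Rightarrow> (int \<Rightarrow> int \<Rightarrow> (real, 'e) module) \<Rightarrow> (int \<Rightarrow> int \<Rightarrow> 'e \<Rightarrow> 'e) \<Rightarrow> int \<Rightarrow> int \<Rightarrow>
    (real, 'e set) module" where
  "page_homology r E d p q = quot_mod (page_cycles r E d p q) (page_boundaries r E d p q)"

definition derived_couple :: "nat \<Rightarrow> ('d, 'e) couple \<Rightarrow> ('d, 'e set) couple" where
  "derived_couple r C =
     \<lparr>dobj = (\<lambda>p q. (dobj C p q)
        \<lparr>carrier := imap C (p + 1) (q - 1) ` carrier (dobj C (p + 1) (q - 1))\<rparr>),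
      eobj = page_homology r (eobj C) (couple_diff C),
      imap = imap C,
      jmap = (\<lambda>p q x. THE \<eta>. \<exists>a\<in>carrier (dobj C (p + 1) (q - 1)).
        x = imap C (p + 1) (q - 1) a \<and>
        \<eta> = page_boundaries r (eobj C) (couple_diff C) (p + int r) (q - int r)
              +>\<^bsub>eobj C (p + int r) (q - int r)\<^esub> jmap C (p + 1) (q - 1) a),
      kmap = (\<lambda>p q \<xi>. THE y. \<exists>b\<in>\<xi>. y = kmap C p q b)\<rparr>"

text \<open>Elements of the homology of \<open>E\<^sub>r\<close> are sets of elements of \<open>E\<^sub>r\<close> and hence have a different type
  at each stage. To form a sequence of couples of one type, each couple of the sequence is required
  to be the derived couple of its predecessor up to an isomorphism of the \<open>E\<close> terms that
  is compatible with all structure maps; the \<open>D\<close> terms agree on the nose.\<close>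

definition is_derived_couple :: "nat \<Rightarrow> ('d, 'e) couple \<Rightarrow> ('d, 'e) couple \<Rightarrow> bool" where
  "is_derived_couple r C C' \<longleftrightarrow>
     dobj C' = dobj (derived_couple r C) \<and>
     (\<forall>p q. \<forall>x\<in>carrier (dobj C' p q). imap C' p q x = imap (derived_couple r C) p q x) \<and>
     (\<exists>\<phi>. \<forall>p q.
        \<phi> p q \<in> lin_isos (eobj (derived_couple r C) p q) (eobj C' p q) \<and>
        (\<forall>x\<in>carrier (dobj C' p q).
           jmap C' p q x =
           \<phi> (p + int r) (q - int r) (jmap (derived_couple r C) p q x)) \<and>
        (\<forall>\<xi>\<in>carrier (eobj (derived_couple r C) p q).
           kmap C' p q (\<phi> p q \<xi>) = kmap (derived_couple r C) p q \<xi>))"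

definition derived_couples :: "('d, 'e) couple \<Rightarrow> (nat \<Rightarrow> ('d, 'e) couple) \<Rightarrow> bool" where
  "derived_couples C\<^sub>1 C \<longleftrightarrow> C 1 = C\<^sub>1 \<and>
     (\<forall>r\<ge>1. exact_couple r (C r) \<and> is_derived_couple r (C r) (C (Suc r)))"

section \<open>Spectral sequences\<close>

definition spectral_sequence ::
  "(nat \<Rightarrow> int \<Rightarrow> int \<Rightarrow> (real, 'e) module) \<Rightarrow> (nat \<Rightarrow> int \<Rightarrow> int \<Rightarrow> 'e \<Rightarrow> 'e) \<Rightarrow> bool" where
  "spectral_sequence E d \<longleftrightarrow> (\<forall>r\<ge>1. \<forall>p q.
     module real_ring (E r p q) \<and>
     d r p q \<in> lin_maps (E r p q) (E r (p + int r) (q + 1 - int r)) \<and>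
     (\<forall>x\<in>carrier (E r p q). d r (p + int r) (q + 1 - int r) (d r p q x) =
        \<zero>\<^bsub>E r (p + 2 * int r) (q + 2 - 2 * int r)\<^esub>) \<and>
     lin_isomorphic (page_homology r (E r) (d r) p q) (E (Suc r) p q))"

text \<open>From page \<open>r\<close> on, all differentials out of and into position \<open>(p, q)\<close> vanish.\<close>

definition stable_from ::
  "(nat \<Rightarrow> int \<Rightarrow> int \<Rightarrow> (real, 'e) module) \<Rightarrow> (nat \<Rightarrow> int \<Rightarrow> int \<Rightarrow> 'e \<Rightarrow> 'e) \<Rightarrow>
    nat \<Rightarrow> int \<Rightarrow> int \<Rightarrow> bool" where
  "stable_from E d r p q \<longleftrightarrow> (\<forall>s\<ge>r.
     (\<forall>x\<in>carrier (E s p q). d s p q x = \<zero>\<^bsub>E s (p + int s) (q - int s + 1)\<^esub>) \<and>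
     page_boundaries s (E s) (d s) p q = {\<zero>\<^bsub>E s p q\<^esub>})"

text \<open>The common value of all sufficiently late pages. It is meaningful only if the pages stabilise
  at \<open>(p, q)\<close>.\<close>

definition E_infinity ::
  "(nat \<Rightarrow> int \<Rightarrow> int \<Rightarrow> (real, 'e) module) \<Rightarrow> (nat \<Rightarrow> int \<Rightarrow> int \<Rightarrow> 'e \<Rightarrow> 'e) \<Rightarrow>
    int \<Rightarrow> int \<Rightarrow> (real, 'e) module" where
  "E_infinity E d p q = E (LEAST r. 1 \<le> r \<and> stable_from E d r p q) p q"

text \<open>The image of \<open>H\<^sup>i(K\<^sub>p)\<close> in the twisted cohomology.\<close>

definition cohomology_filtration ::
  "('a, 'b::euclidean_space) chart set \<Rightarrow> ('a, 'b) dform \<Rightarrow> int \<Rightarrow> int \<Rightarrow>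
    (real, ('a, 'b) dform set) module" where
  "cohomology_filtration A H p i = (twisted_cohomology A H i)
     \<lparr>carrier := quot_map (Omega_par A i)
        (coboundaries (Omega_par A) (\<lambda>_. twisted_deriv A H) i) (\<lambda>x. x)
        ` carrier (K_cohomology A H p i)\<rparr>"

definition converges_to_twisted_cohomology ::
  "('a, 'b::euclidean_space) chart set \<Rightarrow> ('a, 'b) dform \<Rightarrow>
    (nat \<Rightarrow> int \<Rightarrow> int \<Rightarrow> (real, 'e) module) \<Rightarrow> (nat \<Rightarrow> int \<Rightarrow> int \<Rightarrow> 'e \<Rightarrow> 'e) \<Rightarrow> bool" where
  "converges_to_twisted_cohomology A H E d \<longleftrightarrow> (\<forall>p q.
     (\<exists>r\<ge>1. stable_from E d r p q) \<and>
     lin_isomorphic (E_infinity E d p q)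
       (quot_mod (cohomology_filtration A H p (p + q))
         (carrier (cohomology_filtration A H (p + 1) (p + q)))))"

end

theory Submission
  imports Defs
begin

text \<open>The operator \<open>D\<close> raises the filtration degree, so once it is known to act on forms with \<open>D\<^sup>2 = 0\<close>,
  the theorem is a statement about a bounded filtered complex of real vector spaces.

  The contraction \<open>\<iota>\<^sub>v\<close> with a vector is an antiderivation of the wedge product, and the alternation
  \<open>Alt\<close> that turns the derivative of a form into its exterior derivative satisfies
  \<open>\<iota>\<^sub>v (Alt F) = F v - Alt (\<iota>\<^sub>v F)\<close>. All identities of the exterior calculus therefore follow by induction on
  the list of arguments, among them the Leibniz rule and \<open>H \<and> (H \<and> \<omega>) = 0\<close> for \<open>H\<close> odd. The second derivatives
  occurring in \<open>d\<^sup>2\<close> and in a coordinate change are symmetric, so their alternation vanishes.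

  In the couple, \<open>D\<^sub>r\<^sup>p\<^sup>,\<^sup>q\<close> is the image of \<open>D\<^sub>1\<^bsup>p+r-1,q-r+1\<^esup>\<close>
  under \<open>i\<^bsup>r-1\<^esup>\<close>. It vanishes when \<open>p + r - 1\<close> exceeds the dimension, and for \<open>p \<le> 0\<close> it is the part of
  the twisted cohomology coming from \<open>K\<^bsub>p+r-1\<^esub>\<close>, with \<open>i\<close> the identity. Hence for large \<open>r\<close> the map
  \<open>k\<^sub>r\<close> is zero on \<open>E\<^sub>r\<^sup>p\<^sup>,\<^sup>q\<close>, and \<open>j\<^sub>r\<close> identifies this term with the graded piece
  \<open>F\<^sub>p / F\<^sub>p\<^sub>+\<^sub>1\<close> of the twisted cohomology. A finite filtration of a vector space splits, which gives the direct sums.\<close>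

section \<open>Real modules, quotients and linear maps\<close>

text \<open>Convergence is claimed for every sequence of derived couples, and such a sequence
  determines its \<open>E\<close> terms only up to isomorphism. The information is therefore kept in
  the \<open>D\<close> terms, which agree on the nose, and an \<open>E\<close> term is recovered
  from the neighbouring \<open>D\<close> terms by exactness.

  \<open>E_infinity\<close> is the page at the first stable index. Differentials may happen to
  vanish early, so this page can come before those that the \<open>D\<close> terms compute. The
  computation is made on a later page and carried back along the isomorphisms between stable pages.

  The filtration degree rises under \<open>D\<close> because \<open>d\<close> raises degrees by one
  and \<open>H\<close> has only odd, hence positive, degrees. So \<open>D\<close> is zero on each
  quotient of consecutive filtration steps: the first page is the graded space itself, and every
  form in a filtration step represents a class on it. This is what makes exactness of the first
  couple a matter of choosing representatives.\<close>

lemma real_ring_simps [simp]: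
  "carrier real_ring = UNIV" "\<zero>\<^bsub>real_ring\<^esub> = 0" "\<one>\<^bsub>real_ring\<^esub> = 1"
  "a \<oplus>\<^bsub>real_ring\<^esub> b = a + b" "a \<otimes>\<^bsub>real_ring\<^esub> b = a * b"
  by (simp_all add: ring_of_type_algebra_def)

lemma real_ring_minus [simp]: "\<ominus>\<^bsub>real_ring\<^esub> a = - a"
proof -
  interpret cring real_ring by (rule cring_from_type_algebra)
  have "(\<ominus>\<^bsub>real_ring\<^esub> a) \<oplus>\<^bsub>real_ring\<^esub> a = \<zero>\<^bsub>real_ring\<^esub>"
    by (rule l_neg) simp
  then show ?thesis by simp
qed

text \<open>Additive inverses need not be supplied: by distributivity and \<open>null\<close>,
  scaling by \<open>-1\<close> produces one.\<close>

lemma real_moduleI: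
  assumes "\<And>x y. \<lbrakk>x \<in> carrier M; y \<in> carrier M\<rbrakk> \<Longrightarrow> x \<oplus>\<^bsub>M\<^esub> y \<in> carrier M"
    and "\<zero>\<^bsub>M\<^esub> \<in> carrier M"
    and "\<And>x y z. \<lbrakk>x \<in> carrier M; y \<in> carrier M; z \<in> carrier M\<rbrakk> \<Longrightarrow>
      (x \<oplus>\<^bsub>M\<^esub> y) \<oplus>\<^bsub>M\<^esub> z = x \<oplus>\<^bsub>M\<^esub> (y \<oplus>\<^bsub>M\<^esub> z)"
    and "\<And>x y. \<lbrakk>x \<in> carrier M; y \<in> carrier M\<rbrakk> \<Longrightarrow> x \<oplus>\<^bsub>M\<^esub> y = y \<oplus>\<^bsub>M\<^esub> x"
    and "\<And>x. x \<in> carrier M \<Longrightarrow> \<zero>\<^bsub>M\<^esub> \<oplus>\<^bsub>M\<^esub> x = x"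
    and smult: "\<And>a x. x \<in> carrier M \<Longrightarrow> a \<odot>\<^bsub>M\<^esub> x \<in> carrier M"
    and "\<And>a b x. x \<in> carrier M \<Longrightarrow> (a + b) \<odot>\<^bsub>M\<^esub> x = a \<odot>\<^bsub>M\<^esub> x \<oplus>\<^bsub>M\<^esub> b \<odot>\<^bsub>M\<^esub> x"
    and "\<And>a x y. \<lbrakk>x \<in> carrier M; y \<in> carrier M\<rbrakk> \<Longrightarrow>
      a \<odot>\<^bsub>M\<^esub> (x \<oplus>\<^bsub>M\<^esub> y) = a \<odot>\<^bsub>M\<^esub> x \<oplus>\<^bsub>M\<^esub> a \<odot>\<^bsub>M\<^esub> y"
    and "\<And>a b x. x \<in> carrier M \<Longrightarrow> (a * b) \<odot>\<^bsub>M\<^esub> x = a \<odot>\<^bsub>M\<^esub> (b \<odot>\<^bsub>M\<^esub> x)"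
    and one: "\<And>x. x \<in> carrier M \<Longrightarrow> 1 \<odot>\<^bsub>M\<^esub> x = x"
    and null: "\<And>x. x \<in> carrier M \<Longrightarrow> 0 \<odot>\<^bsub>M\<^esub> x = \<zero>\<^bsub>M\<^esub>"
  shows "module real_ring (M :: (real, 'x) module)"
proof (rule moduleI)
  show "abelian_group M"
  proof (rule abelian_groupI)
    fix x assume x: "x \<in> carrier M"
    have "(-1) \<odot>\<^bsub>M\<^esub> x \<oplus>\<^bsub>M\<^esub> x = (-1) \<odot>\<^bsub>M\<^esub> x \<oplus>\<^bsub>M\<^esub> 1 \<odot>\<^bsub>M\<^esub> x"
      by (simp add: one x)
    also have "\<dots> = (-1 + 1) \<odot>\<^bsub>M\<^esub> x" by (simp only: assms(7)[OF x])
    finally have "(-1) \<odot>\<^bsub>M\<^esub> x \<oplus>\<^bsub>M\<^esub> x = \<zero>\<^bsub>M\<^esub>" by (simp add: null x)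
    then show "\<exists>y\<in>carrier M. y \<oplus>\<^bsub>M\<^esub> x = \<zero>\<^bsub>M\<^esub>" using smult[OF x] by blast
  qed (use assms in auto)
qed (use assms cring_from_type_algebra in auto)

lemma submodule_realI:
  assumes "module real_ring M" and "N \<subseteq> carrier M" and "\<zero>\<^bsub>M\<^esub> \<in> N"
    and "\<And>x y. \<lbrakk>x \<in> N; y \<in> N\<rbrakk> \<Longrightarrow> x \<oplus>\<^bsub>M\<^esub> y \<in> N"
    and "\<And>a x. x \<in> N \<Longrightarrow> a \<odot>\<^bsub>M\<^esub> x \<in> N"
  shows "submodule N real_ring M"
proof -
  interpret module real_ring M by fact
  show ?thesis
  proof (rule submoduleI)
    fix x assume x: "x \<in> N"
    then have "\<ominus>\<^bsub>M\<^esub> x = (- 1) \<odot>\<^bsub>M\<^esub> x"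
      using smult_l_minus[of 1 x] assms(2) smult_one[of x] by auto
    then show "\<ominus>\<^bsub>M\<^esub> x \<in> N" using assms(5) x by simp
  qed (use assms in auto)
qed

lemma module_closed:
  assumes "module real_ring M"
  shows "\<zero>\<^bsub>M\<^esub> \<in> carrier M"
    and "\<lbrakk>x \<in> carrier M; y \<in> carrier M\<rbrakk> \<Longrightarrow> x \<oplus>\<^bsub>M\<^esub> y \<in> carrier M"
    and "x \<in> carrier M \<Longrightarrow> a \<odot>\<^bsub>M\<^esub> x \<in> carrier M"
    and "x \<in> carrier M \<Longrightarrow> \<ominus>\<^bsub>M\<^esub> x \<in> carrier M"
    and "x \<in> carrier M \<Longrightarrow> \<zero>\<^bsub>M\<^esub> \<oplus>\<^bsub>M\<^esub> x = x"
    and "x \<in> carrier M \<Longrightarrow> x \<oplus>\<^bsub>M\<^esub> \<zero>\<^bsub>M\<^esub> = x"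
    and "a \<odot>\<^bsub>M\<^esub> \<zero>\<^bsub>M\<^esub> = \<zero>\<^bsub>M\<^esub>"
proof -
  interpret module real_ring M by fact
  show "\<zero>\<^bsub>M\<^esub> \<in> carrier M"
    and "\<lbrakk>x \<in> carrier M; y \<in> carrier M\<rbrakk> \<Longrightarrow> x \<oplus>\<^bsub>M\<^esub> y \<in> carrier M"
    and "x \<in> carrier M \<Longrightarrow> a \<odot>\<^bsub>M\<^esub> x \<in> carrier M"
    and "x \<in> carrier M \<Longrightarrow> \<ominus>\<^bsub>M\<^esub> x \<in> carrier M"
    and "x \<in> carrier M \<Longrightarrow> \<zero>\<^bsub>M\<^esub> \<oplus>\<^bsub>M\<^esub> x = x"
    and "x \<in> carrier M \<Longrightarrow> x \<oplus>\<^bsub>M\<^esub> \<zero>\<^bsub>M\<^esub> = x"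
    and "a \<odot>\<^bsub>M\<^esub> \<zero>\<^bsub>M\<^esub> = \<zero>\<^bsub>M\<^esub>"
    by auto
qed

lemma submodule_real:
  assumes "submodule N real_ring M"
  shows "N \<subseteq> carrier M" "\<zero>\<^bsub>M\<^esub> \<in> N"
    and "\<lbrakk>x \<in> N; y \<in> N\<rbrakk> \<Longrightarrow> x \<oplus>\<^bsub>M\<^esub> y \<in> N"
    and "x \<in> N \<Longrightarrow> a \<odot>\<^bsub>M\<^esub> x \<in> N"
    and "x \<in> N \<Longrightarrow> \<ominus>\<^bsub>M\<^esub> x \<in> N"
proof -
  interpret submodule N real_ring M by fact
  show "N \<subseteq> carrier M" "\<zero>\<^bsub>M\<^esub> \<in> N"
    and "\<lbrakk>x \<in> N; y \<in> N\<rbrakk> \<Longrightarrow> x \<oplus>\<^bsub>M\<^esub> y \<in> N"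
    and "x \<in> N \<Longrightarrow> a \<odot>\<^bsub>M\<^esub> x \<in> N"
    and "x \<in> N \<Longrightarrow> \<ominus>\<^bsub>M\<^esub> x \<in> N"
    using subset one_closed m_closed smult_closed m_inv_closed by (auto simp: a_inv_def)
qed

lemma submodule_module:
  "\<lbrakk>module real_ring M; submodule N real_ring M\<rbrakk> \<Longrightarrow> module real_ring (M\<lparr>carrier := N\<rparr>)"
  by (rule submodule.submodule_is_module)

text \<open>Cosets see only the addition. Cocycles and filtration steps, which are carrier updates,
  therefore have the same cosets as the ambient module.\<close>

lemma coset_carrier_update [simp]:
  "N +>\<^bsub>M\<lparr>carrier := S\<rparr>\<^esub> x = N +>\<^bsub>M\<^esub> x" "N <+>\<^bsub>M\<lparr>carrier := S\<rparr>\<^esub> P = N <+>\<^bsub>M\<^esub> P"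
  by (simp_all add: a_r_coset_def' set_add_def')

lemma coset_self:
  assumes "module real_ring M" "submodule N real_ring M" "x \<in> carrier M"
  shows "x \<in> N +>\<^bsub>M\<^esub> x"
  using submodule_real(2)[OF assms(2)] module_closed(5)[OF assms(1,3)]
  by (force simp: a_r_coset_def')

lemma coset_eq_iff:
  assumes M: "module real_ring M" and N: "submodule N real_ring M"
    and x: "x \<in> carrier M" and y: "y \<in> carrier M"
  shows "N +>\<^bsub>M\<^esub> x = N +>\<^bsub>M\<^esub> y \<longleftrightarrow> (\<exists>n\<in>N. x = n \<oplus>\<^bsub>M\<^esub> y)"
proof -
  interpret module real_ring M by fact
  note sub = submodule_real[OF N]
  show ?thesis
  proof
    assume "N +>\<^bsub>M\<^esub> x = N +>\<^bsub>M\<^esub> y"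
    then have "x \<in> N +>\<^bsub>M\<^esub> y" using coset_self[OF M N x] by simp
    then show "\<exists>n\<in>N. x = n \<oplus>\<^bsub>M\<^esub> y" by (auto simp: a_r_coset_def')
  next
    assume "\<exists>n\<in>N. x = n \<oplus>\<^bsub>M\<^esub> y"
    then obtain n where n: "n \<in> N" and xn: "x = n \<oplus>\<^bsub>M\<^esub> y" by blast
    have nM: "n \<in> carrier M" using n sub(1) by auto
    \<comment> \<open>Applied to \<open>n\<close> and to its negative, this gives the two
      inclusions.\<close>
    have sub_coset: "N +>\<^bsub>M\<^esub> (k \<oplus>\<^bsub>M\<^esub> z) \<subseteq> N +>\<^bsub>M\<^esub> z" if k: "k \<in> N" and z: "z \<in> carrier M" for k z
    proof
      fix u assume "u \<in> N +>\<^bsub>M\<^esub> (k \<oplus>\<^bsub>M\<^esub> z)"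
      then obtain h where h: "h \<in> N" "u = h \<oplus>\<^bsub>M\<^esub> (k \<oplus>\<^bsub>M\<^esub> z)" by (auto simp: a_r_coset_def')
      then have "u = (h \<oplus>\<^bsub>M\<^esub> k) \<oplus>\<^bsub>M\<^esub> z" using subsetD[OF sub(1) k] subsetD[OF sub(1) h(1)] z by (simp add: M.a_assoc)
      then show "u \<in> N +>\<^bsub>M\<^esub> z" using sub(3)[OF h(1) k] by (auto simp: a_r_coset_def')
    qed
    have "\<ominus>\<^bsub>M\<^esub> n \<oplus>\<^bsub>M\<^esub> x = y" using nM y unfolding xn by (simp add: M.r_neg1)
    then show "N +>\<^bsub>M\<^esub> x = N +>\<^bsub>M\<^esub> y"
      using sub_coset[OF n y] sub_coset[OF sub(5)[OF n] x] xn by auto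
  qed
qed

lemma lin_mapsD:
  assumes "f \<in> lin_maps M N"
  shows "x \<in> carrier M \<Longrightarrow> f x \<in> carrier N"
    and "\<lbrakk>x \<in> carrier M; y \<in> carrier M\<rbrakk> \<Longrightarrow> f (x \<oplus>\<^bsub>M\<^esub> y) = f x \<oplus>\<^bsub>N\<^esub> f y"
    and "x \<in> carrier M \<Longrightarrow> f (a \<odot>\<^bsub>M\<^esub> x) = a \<odot>\<^bsub>N\<^esub> f x"
  using assms by (auto simp: lin_maps_def)

lemma lin_mapsI:
  assumes "\<And>x. x \<in> carrier M \<Longrightarrow> f x \<in> carrier N"
    and "\<And>x y. \<lbrakk>x \<in> carrier M; y \<in> carrier M\<rbrakk> \<Longrightarrow> f (x \<oplus>\<^bsub>M\<^esub> y) = f x \<oplus>\<^bsub>N\<^esub> f y"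
    and "\<And>a x. x \<in> carrier M \<Longrightarrow> f (a \<odot>\<^bsub>M\<^esub> x) = a \<odot>\<^bsub>N\<^esub> f x"
  shows "f \<in> lin_maps M N"
  using assms by (auto simp: lin_maps_def)

lemma module_smult_zero:
  "\<lbrakk>module real_ring M; x \<in> carrier M\<rbrakk> \<Longrightarrow> 0 \<odot>\<^bsub>M\<^esub> x = \<zero>\<^bsub>M\<^esub>"
  using module.smult_l_null[of real_ring M x] by simp

lemma lin_map_zero:
  assumes "module real_ring M" "module real_ring N" "f \<in> lin_maps M N"
  shows "f \<zero>\<^bsub>M\<^esub> = \<zero>\<^bsub>N\<^esub>"
  using lin_mapsD[OF assms(3), of "\<zero>\<^bsub>M\<^esub>"] module_closed[OF assms(1)] assms
  by (metis module_smult_zero)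

lemma module_minus_eq:
  assumes "module real_ring M" "x \<in> carrier M"
  shows "\<ominus>\<^bsub>M\<^esub> x = (- 1) \<odot>\<^bsub>M\<^esub> x"
proof -
  interpret module real_ring M by fact
  show ?thesis using smult_l_minus[of 1 x] smult_one[OF assms(2)] assms(2) by simp
qed

lemma lin_map_minus:
  assumes "module real_ring M" "module real_ring N" "f \<in> lin_maps M N" "x \<in> carrier M"
  shows "f (\<ominus>\<^bsub>M\<^esub> x) = \<ominus>\<^bsub>N\<^esub> f x"
  using assms by (simp add: module_minus_eq lin_mapsD)

text \<open>The form in which exactness is applied: it speaks of kernels only, so equal values have
  to be turned into a kernel element.\<close>

lemma lin_map_eq_iff:
  assumes M: "module real_ring M" and N: "module real_ring N" and f: "f \<in> lin_maps M N"
    and x: "x \<in> carrier M" and y: "y \<in> carrier M"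
  shows "f x = f y \<longleftrightarrow> (\<exists>n\<in>carrier M. f n = \<zero>\<^bsub>N\<^esub> \<and> x = n \<oplus>\<^bsub>M\<^esub> y)"
proof -
  interpret M: module real_ring M by fact
  interpret N: module real_ring N by fact
  note l = lin_mapsD[OF f]
  show ?thesis
  proof
    assume eq: "f x = f y"
    have "f (x \<oplus>\<^bsub>M\<^esub> \<ominus>\<^bsub>M\<^esub> y) = \<zero>\<^bsub>N\<^esub>"
      using x y l eq by (simp add: lin_map_minus[OF M N f] N.M.r_neg)
    moreover have "x = (x \<oplus>\<^bsub>M\<^esub> \<ominus>\<^bsub>M\<^esub> y) \<oplus>\<^bsub>M\<^esub> y"
      using x y by (simp add: M.M.a_assoc M.M.l_neg)
    ultimately show "\<exists>n\<in>carrier M. f n = \<zero>\<^bsub>N\<^esub> \<and> x = n \<oplus>\<^bsub>M\<^esub> y"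
      using x y by (intro bexI[of _ "x \<oplus>\<^bsub>M\<^esub> \<ominus>\<^bsub>M\<^esub> y"]) auto
  qed (use l y in auto)
qed

lemma lin_map_comp:
  "\<lbrakk>f \<in> lin_maps M N; g \<in> lin_maps N P\<rbrakk> \<Longrightarrow> (\<lambda>x. g (f x)) \<in> lin_maps M P"
  by (auto simp: lin_maps_def Pi_iff)

lemma submodule_image:
  assumes M: "module real_ring M" and N: "module real_ring N" and f: "f \<in> lin_maps M N"
  shows "submodule (f ` carrier M) real_ring N"
proof (rule submodule_realI[OF N])
  show "\<zero>\<^bsub>N\<^esub> \<in> f ` carrier M"
    using lin_map_zero[OF M N f] module_closed(1)[OF M] by force
next
  fix x y assume "x \<in> f ` carrier M" "y \<in> f ` carrier M"
  then show "x \<oplus>\<^bsub>N\<^esub> y \<in> f ` carrier M"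
    using lin_mapsD(2)[OF f] module_closed(2)[OF M] by (smt (verit) imageE imageI)
next
  fix a x assume "x \<in> f ` carrier M"
  then show "a \<odot>\<^bsub>N\<^esub> x \<in> f ` carrier M"
    using lin_mapsD(3)[OF f] module_closed(3)[OF M] by (smt (verit) imageE imageI)
qed (use lin_mapsD(1)[OF f] in auto)

lemma submodule_kernel:
  assumes M: "module real_ring M" and N: "module real_ring N" and f: "f \<in> lin_maps M N"
  shows "submodule {x \<in> carrier M. f x = \<zero>\<^bsub>N\<^esub>} real_ring M"
  by (rule submodule_realI[OF M])
    (use lin_mapsD[OF f] module_closed[OF M] module_closed[OF N] lin_map_zero[OF M N f] in auto)

lemma submodule_carrier_update:
  assumes "module real_ring M" "submodule S real_ring M" "submodule N real_ring M" "N \<subseteq> S"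
  shows "submodule N real_ring (M\<lparr>carrier := S\<rparr>)"
  by (rule submodule_realI[OF submodule_module[OF assms(1,2)]])
    (use assms(4) submodule_real[OF assms(3)] in auto)

lemma lin_maps_restrict:
  assumes "f \<in> lin_maps M N" "S \<subseteq> carrier M" "f ` S \<subseteq> T"
  shows "f \<in> lin_maps (M\<lparr>carrier := S\<rparr>) (N\<lparr>carrier := T\<rparr>)"
  using assms by (auto simp: lin_maps_def image_subset_iff subset_eq)

lemma lin_maps_restrict_dom:
  assumes "f \<in> lin_maps M N" "S \<subseteq> carrier M"
  shows "f \<in> lin_maps (M\<lparr>carrier := S\<rparr>) N"
  using assms by (auto simp: lin_maps_def subset_eq)

text \<open>Presents \<open>Q\<close> as \<open>M / N\<close>; arguments about cosets become arguments about representatives.\<close>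

definition quotient_proj :: "('x \<Rightarrow> 'y) \<Rightarrow> (real, 'x) module \<Rightarrow> 'x set \<Rightarrow> (real, 'y) module \<Rightarrow> bool" where
  "quotient_proj \<pi> M N Q \<longleftrightarrow> module real_ring M \<and> module real_ring Q \<and> \<pi> \<in> lin_maps M Q \<and>
     \<pi> ` carrier M = carrier Q \<and> {x \<in> carrier M. \<pi> x = \<zero>\<^bsub>Q\<^esub>} = N"

lemma quotient_projD:
  assumes "quotient_proj \<pi> M N Q"
  shows "module real_ring M" "module real_ring Q" "\<pi> \<in> lin_maps M Q"
    and "\<pi> ` carrier M = carrier Q" "x \<in> carrier M \<Longrightarrow> \<pi> x = \<zero>\<^bsub>Q\<^esub> \<longleftrightarrow> x \<in> N"
    and "N \<subseteq> carrier M"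
  using assms by (auto simp: quotient_proj_def)

lemma quotient_proj_eq_iff:
  assumes "quotient_proj \<pi> M N Q" "x \<in> carrier M" "y \<in> carrier M"
  shows "\<pi> x = \<pi> y \<longleftrightarrow> (\<exists>n\<in>N. x = n \<oplus>\<^bsub>M\<^esub> y)"
  using lin_map_eq_iff[OF quotient_projD(1-3)[OF assms(1)] assms(2,3)]
    quotient_projD(5,6)[OF assms(1)] by auto

lemma quot_mod_sum:
  assumes M: "module real_ring M" and N: "submodule N real_ring M"
    and x: "x \<in> carrier M" and y: "y \<in> carrier M"
  shows "(N +>\<^bsub>M\<^esub> x) <+>\<^bsub>M\<^esub> (N +>\<^bsub>M\<^esub> y) = N +>\<^bsub>M\<^esub> (x \<oplus>\<^bsub>M\<^esub> y)"
proof -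
  interpret module real_ring M by fact
  have "abelian_subgroup N M"
    by (rule abelian_subgroupI3)
      (use N M in \<open>auto simp: additive_subgroup_def submodule_def module_def\<close>)
  then show ?thesis using x y by (rule abelian_subgroup.a_rcos_sum)
qed

text \<open>The sum with \<open>N\<close> matters for \<open>a = 0\<close>, where scaling collapses
  the coset to a single point.\<close>

lemma quot_mod_scale:
  assumes M: "module real_ring M" and N: "submodule N real_ring M" and x: "x \<in> carrier M"
  shows "N <+>\<^bsub>M\<^esub> ((\<lambda>x. a \<odot>\<^bsub>M\<^esub> x) ` (N +>\<^bsub>M\<^esub> x)) = N +>\<^bsub>M\<^esub> (a \<odot>\<^bsub>M\<^esub> x)"
proof -
  interpret module real_ring M by fact
  note sub = submodule_real[OF N]
  have *: "n \<oplus>\<^bsub>M\<^esub> a \<odot>\<^bsub>M\<^esub> (h \<oplus>\<^bsub>M\<^esub> x) = (n \<oplus>\<^bsub>M\<^esub> a \<odot>\<^bsub>M\<^esub> h) \<oplus>\<^bsub>M\<^esub> a \<odot>\<^bsub>M\<^esub> x" if "n \<in> N" "h \<in> N" for n h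
  proof -
    have "n \<in> carrier M" "h \<in> carrier M" using that sub(1) by auto
    then show ?thesis using x smult_r_distr[of a h x] by (simp add: M.a_assoc)
  qed
  show ?thesis
  proof
    show "N <+>\<^bsub>M\<^esub> ((\<lambda>x. a \<odot>\<^bsub>M\<^esub> x) ` (N +>\<^bsub>M\<^esub> x)) \<subseteq> N +>\<^bsub>M\<^esub> (a \<odot>\<^bsub>M\<^esub> x)"
      using * sub(3,4) by (auto simp: a_r_coset_def' set_add_def') blast
    show "N +>\<^bsub>M\<^esub> (a \<odot>\<^bsub>M\<^esub> x) \<subseteq> N <+>\<^bsub>M\<^esub> ((\<lambda>x. a \<odot>\<^bsub>M\<^esub> x) ` (N +>\<^bsub>M\<^esub> x))"
      using coset_self[OF M N x] by (auto simp: a_r_coset_def'[of M N "a \<odot>\<^bsub>M\<^esub> x"] set_add_def')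
  qed
qed

lemma quotient_proj_quot_mod:
  assumes M: "module real_ring M" and N: "submodule N real_ring M"
  shows "quotient_proj (\<lambda>x. N +>\<^bsub>M\<^esub> x) M N (quot_mod M N)"
proof -
  interpret M: module real_ring M by fact
  note sub = submodule_real[OF N]
  let ?Q = "quot_mod M N"
  have car: "carrier ?Q = (\<lambda>x. N +>\<^bsub>M\<^esub> x) ` carrier M"
    by (auto simp: quot_mod_def A_RCOSETS_def')
  have add: "(N +>\<^bsub>M\<^esub> x) \<oplus>\<^bsub>?Q\<^esub> (N +>\<^bsub>M\<^esub> y) = N +>\<^bsub>M\<^esub> (x \<oplus>\<^bsub>M\<^esub> y)"
    if "x \<in> carrier M" "y \<in> carrier M" for x y
    using quot_mod_sum[OF M N that] by (simp add: quot_mod_def)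
  have sm: "a \<odot>\<^bsub>?Q\<^esub> (N +>\<^bsub>M\<^esub> x) = N +>\<^bsub>M\<^esub> (a \<odot>\<^bsub>M\<^esub> x)" if "x \<in> carrier M" for a x
    using quot_mod_scale[OF M N that] by (simp add: quot_mod_def)
  have n0: "N +>\<^bsub>M\<^esub> \<zero>\<^bsub>M\<^esub> = N"
    using sub(1) by (force simp: a_r_coset_def')
  then have zero: "\<zero>\<^bsub>?Q\<^esub> = N +>\<^bsub>M\<^esub> \<zero>\<^bsub>M\<^esub>" by (simp add: quot_mod_def)
  have "module real_ring ?Q"
    by (rule real_moduleI)
      (use M.smult_l_distr M.smult_r_distr M.smult_assoc1 M.smult_one M.smult_l_null in
       \<open>auto simp: car add sm zero M.M.a_ac\<close>)
  moreover have "(\<lambda>x. N +>\<^bsub>M\<^esub> x) \<in> lin_maps M ?Q"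
    by (rule lin_mapsI) (auto simp: car add sm)
  moreover have "{x \<in> carrier M. N +>\<^bsub>M\<^esub> x = \<zero>\<^bsub>?Q\<^esub>} = N"
    using coset_eq_iff[OF M N _ M.M.zero_closed] sub(1) unfolding zero by force
  ultimately show ?thesis using M car by (simp add: quotient_proj_def)
qed

text \<open>The image of a coset under \<open>f\<close> is in general only part of a coset of
  \<open>N'\<close>. The sum with \<open>N'\<close> in \<open>quot_map\<close> fills it up, and
  \<open>fN\<close> keeps it inside.\<close>

lemma quot_map_coset:
  assumes M: "module real_ring M" and N: "submodule N real_ring M" and x: "x \<in> carrier M"
    and M': "module real_ring M'" and N': "submodule N' real_ring M'"
    and f: "f \<in> lin_maps M M'" and fN: "f ` N \<subseteq> N'"
  shows "quot_map M' N' f (N +>\<^bsub>M\<^esub> x) = N' +>\<^bsub>M'\<^esub> f x"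
proof -
  interpret M': module real_ring M' by fact
  note sub = submodule_real[OF N] and sub' = submodule_real[OF N']
  note l = lin_mapsD[OF f]
  have *: "n \<oplus>\<^bsub>M'\<^esub> f (h \<oplus>\<^bsub>M\<^esub> x) = (n \<oplus>\<^bsub>M'\<^esub> f h) \<oplus>\<^bsub>M'\<^esub> f x" if "n \<in> N'" "h \<in> N" for n h
  proof -
    have "n \<in> carrier M'" "h \<in> carrier M" using that sub(1) sub'(1) by auto
    then show ?thesis using x l by (simp add: M'.M.a_assoc)
  qed
  show ?thesis
  proof
    have "n \<oplus>\<^bsub>M'\<^esub> f (h \<oplus>\<^bsub>M\<^esub> x) \<in> N' +>\<^bsub>M'\<^esub> f x" if "n \<in> N'" "h \<in> N" for n h
      using *[OF that] sub'(3)[of n "f h"] fN that by (force simp: a_r_coset_def')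
    then show "quot_map M' N' f (N +>\<^bsub>M\<^esub> x) \<subseteq> N' +>\<^bsub>M'\<^esub> f x"
      by (auto simp: quot_map_def set_add_def' a_r_coset_def'[of M])
    show "N' +>\<^bsub>M'\<^esub> f x \<subseteq> quot_map M' N' f (N +>\<^bsub>M\<^esub> x)"
      using coset_self[OF M N x] by (auto simp: quot_map_def a_r_coset_def'[of M'] set_add_def')
  qed
qed

text \<open>Well-definedness is hidden in the hypothesis on \<open>g\<close>, which is already a
  function on \<open>Q\<close>; only linearity remains. This suits the maps that are given by cosets
  or by a definite description.\<close>

lemma lin_maps_descend:
  assumes q: "quotient_proj \<pi> M N Q" and f: "f \<in> lin_maps M P"
    and g: "\<And>x. x \<in> carrier M \<Longrightarrow> g (\<pi> x) = f x"
  shows "g \<in> lin_maps Q P"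
proof -
  note qp = quotient_projD[OF q]
  note l = lin_mapsD[OF qp(3)] and lf = lin_mapsD[OF f] and mc = module_closed[OF qp(1)]
  have 1: "\<exists>u\<in>carrier M. x = \<pi> u" if "x \<in> carrier Q" for x using qp(4) that by blast
  show ?thesis
  proof (rule lin_mapsI)
    show "g x \<in> carrier P" if "x \<in> carrier Q" for x using 1[OF that] g lf by auto
  next
    fix x y assume "x \<in> carrier Q" "y \<in> carrier Q"
    then obtain u v where uv: "u \<in> carrier M" "v \<in> carrier M" "x = \<pi> u" "y = \<pi> v" using 1 by metis
    then have "x \<oplus>\<^bsub>Q\<^esub> y = \<pi> (u \<oplus>\<^bsub>M\<^esub> v)" using l by simp
    then show "g (x \<oplus>\<^bsub>Q\<^esub> y) = g x \<oplus>\<^bsub>P\<^esub> g y" using uv g mc lf by simp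
  next
    fix a x assume "x \<in> carrier Q"
    then obtain u where u: "u \<in> carrier M" "x = \<pi> u" using 1 by metis
    then have "a \<odot>\<^bsub>Q\<^esub> x = \<pi> (a \<odot>\<^bsub>M\<^esub> u)" using l by simp
    then show "g (a \<odot>\<^bsub>Q\<^esub> x) = a \<odot>\<^bsub>P\<^esub> g x" using u g mc lf by simp
  qed
qed

text \<open>The common kernel \<open>N\<close> makes \<open>\<pi>'\<close> constant on the fibres of
  \<open>\<pi>\<close>, so any choice of representatives defines the same map.\<close>

lemma lin_isomorphic_quotients:
  assumes q: "quotient_proj \<pi> M N Q" and q': "quotient_proj \<pi>' M N Q'"
  shows "lin_isomorphic Q Q'"
proof -
  note qp = quotient_projD[OF q] and qp' = quotient_projD[OF q']
  define h where "h = (\<lambda>z. \<pi>' (SOME x. x \<in> carrier M \<and> \<pi> x = z))"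
  have h: "h (\<pi> x) = \<pi>' x" if x: "x \<in> carrier M" for x
  proof -
    define y where "y = (SOME y. y \<in> carrier M \<and> \<pi> y = \<pi> x)"
    have "y \<in> carrier M \<and> \<pi> y = \<pi> x" unfolding y_def by (rule someI[of _ x]) (simp add: x)
    then have "\<pi>' y = \<pi>' x"
      using quotient_proj_eq_iff[OF q _ x, of y] quotient_proj_eq_iff[OF q' _ x, of y] by simp
    then show ?thesis by (simp add: h_def y_def)
  qed
  have "h \<in> lin_maps Q Q'" by (rule lin_maps_descend[OF q qp'(3) h])
  moreover have "bij_betw h (carrier Q) (carrier Q')"
    unfolding bij_betw_def
  proof
    show "inj_on h (carrier Q)"
      unfolding qp(4)[symmetric]
      using h by (auto simp: inj_on_def quotient_proj_eq_iff[OF q] quotient_proj_eq_iff[OF q'])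
    show "h ` carrier Q = carrier Q'"
      unfolding qp(4)[symmetric] qp'(4)[symmetric] image_image by (rule image_cong) (auto simp: h)
  qed
  ultimately show ?thesis by (auto simp: lin_isomorphic_def lin_isos_def)
qed

lemma lin_isos_inv:
  assumes "f \<in> lin_isos M N" "module real_ring M"
  shows "inv_into (carrier M) f \<in> lin_isos N M"
proof -
  have l: "f \<in> lin_maps M N" and b: "bij_betw f (carrier M) (carrier N)"
    using assms by (auto simp: lin_isos_def)
  let ?g = "inv_into (carrier M) f"
  have g: "?g (f x) = x" if "x \<in> carrier M" for x
    using b that by (simp add: bij_betw_def)
  have 1: "\<exists>u\<in>carrier M. x = f u" if "x \<in> carrier N" for x using b that by (auto simp: bij_betw_def)
  have "?g \<in> lin_maps N M"
  proof (rule lin_mapsI)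
    show "?g x \<in> carrier M" if "x \<in> carrier N" for x using 1[OF that] g by auto
  next
    fix x y assume "x \<in> carrier N" "y \<in> carrier N"
    then obtain u v where "u \<in> carrier M" "v \<in> carrier M" "x = f u" "y = f v" using 1 by metis
    then show "?g (x \<oplus>\<^bsub>N\<^esub> y) = ?g x \<oplus>\<^bsub>M\<^esub> ?g y"
      using g module_closed[OF assms(2)] lin_mapsD(2)[OF l, symmetric] by simp
  next
    fix a x assume "x \<in> carrier N"
    then obtain u where "u \<in> carrier M" "x = f u" using 1 by metis
    then show "?g (a \<odot>\<^bsub>N\<^esub> x) = a \<odot>\<^bsub>M\<^esub> ?g x"
      using g module_closed[OF assms(2)] lin_mapsD(3)[OF l, symmetric] by simp
  qed
  then show ?thesis using bij_betw_inv_into[OF b] by (simp add: lin_isos_def)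
qed

lemma lin_isomorphic_sym: "\<lbrakk>lin_isomorphic M N; module real_ring M\<rbrakk> \<Longrightarrow> lin_isomorphic N M"
  using lin_isos_inv by (fastforce simp: lin_isomorphic_def)

lemma lin_isomorphic_trans:
  assumes "lin_isomorphic M N" "lin_isomorphic N P"
  shows "lin_isomorphic M P"
proof -
  obtain f g where "f \<in> lin_isos M N" "g \<in> lin_isos N P"
    using assms by (auto simp: lin_isomorphic_def)
  then have "(\<lambda>x. g (f x)) \<in> lin_isos M P"
    using lin_map_comp[of f M N g P] bij_betw_trans[of f "carrier M" "carrier N" g "carrier P"]
    by (auto simp: lin_isos_def comp_def)
  then show ?thesis by (auto simp: lin_isomorphic_def)
qed

lemma lin_isomorphic_refl: "lin_isomorphic M M"
proof -
  have "(\<lambda>x. x) \<in> lin_isos M M" by (auto simp: lin_isos_def lin_maps_def bij_betw_def)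
  then show ?thesis by (auto simp: lin_isomorphic_def)
qed

text \<open>Serves for passing first to a graded quotient and then to its cohomology.\<close>

lemma quotient_proj_comp:
  assumes q: "quotient_proj \<pi> M N Q" and q': "quotient_proj \<rho> Q L R"
  shows "quotient_proj (\<lambda>x. \<rho> (\<pi> x)) M {x \<in> carrier M. \<pi> x \<in> L} R"
  unfolding quotient_proj_def
proof (intro conjI)
  note qp = quotient_projD[OF q] and qp' = quotient_projD[OF q']
  show "module real_ring M" "module real_ring R" by (fact qp(1), fact qp'(2))
  show "(\<lambda>x. \<rho> (\<pi> x)) \<in> lin_maps M R" by (rule lin_map_comp[OF qp(3) qp'(3)])
  show "(\<lambda>x. \<rho> (\<pi> x)) ` carrier M = carrier R" using qp(4) qp'(4) by (metis image_image)
  show "{x \<in> carrier M. \<rho> (\<pi> x) = \<zero>\<^bsub>R\<^esub>} = {x \<in> carrier M. \<pi> x \<in> L}"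
    using qp'(5)[OF lin_mapsD(1)[OF qp(3)]] by blast
qed

lemma quotient_proj_cohomology:
  assumes M: "\<And>i. module real_ring (M i)"
    and d: "\<And>i. d i \<in> lin_maps (M i) (M (i + 1))"
    and dd: "\<And>i x. x \<in> carrier (M i) \<Longrightarrow> d (i + 1) (d i x) = \<zero>\<^bsub>M (i + 1 + 1)\<^esub>"
  shows "quotient_proj (coh_class M d i) (cocycles M d i) (coboundaries M d i) (cohomology M d i)"
proof -
  have d': "d (i - 1) \<in> lin_maps (M (i - 1)) (M i)" using d[of "i - 1"] by simp
  have Z: "submodule {x \<in> carrier (M i). d i x = \<zero>\<^bsub>M (i + 1)\<^esub>} real_ring (M i)"
    by (rule submodule_kernel[OF M M d])
  have B: "submodule (coboundaries M d i) real_ring (M i)"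
    unfolding coboundaries_def by (rule submodule_image[OF M M d'])
  have "coboundaries M d i \<subseteq> {x \<in> carrier (M i). d i x = \<zero>\<^bsub>M (i + 1)\<^esub>}"
    using dd[of _ "i - 1"] lin_mapsD(1)[OF d'] by (auto simp: coboundaries_def)
  from quotient_proj_quot_mod[OF submodule_module[OF M Z] submodule_carrier_update[OF M Z B this]]
  show ?thesis by (simp add: cocycles_def cohomology_def coh_class_def[abs_def])
qed

section \<open>Derived couples\<close>

locale exact_couple_at =
  fixes r :: nat and C :: "('d, 'e) couple"
  assumes exact: "exact_couple r C"
begin

abbreviation D where "D \<equiv> dobj C"
abbreviation E where "E \<equiv> eobj C"

lemma D_module: "module real_ring (D p q)" and E_module: "module real_ring (E p q)"
  using exact by (simp_all add: exact_couple_def)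

text \<open>The bidegrees are stated as equational side conditions, so that the rules apply whatever the
  syntactic form of the indices.\<close>

lemma imap_lin: "\<lbrakk>p' = p - 1; q' = q + 1\<rbrakk> \<Longrightarrow> imap C p q \<in> lin_maps (D p q) (D p' q')"
  and jmap_lin: "\<lbrakk>p' = p + int r - 1; q' = q - int r + 1\<rbrakk> \<Longrightarrow>
      jmap C p q \<in> lin_maps (D p q) (E p' q')"
  and kmap_lin: "p' = p + 1 \<Longrightarrow> kmap C p q \<in> lin_maps (E p q) (D p' q)"
  using exact by (simp_all add: exact_couple_def)

lemma jmap_zero_iff:
  assumes "p' = p + int r - 1" "q' = q - int r + 1" "p'' = p + 1" "q'' = q - 1" "x \<in> carrier (D p q)"
  shows "jmap C p q x = \<zero>\<^bsub>E p' q'\<^esub> \<longleftrightarrow> (\<exists>y\<in>carrier (D p'' q''). x = imap C p'' q'' y)"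
proof -
  have "imap C (p + 1) (q - 1) ` carrier (D (p + 1) (q - 1)) =
       {x \<in> carrier (D p q). jmap C p q x = \<zero>\<^bsub>E (p + int r - 1) (q - int r + 1)\<^esub>}"
    using exact by (simp add: exact_couple_def)
  then show ?thesis using assms by blast
qed

lemma kmap_zero_iff:
  assumes "p' = p + 1" "p'' = p - int r + 1" "q'' = q + int r - 1" "x \<in> carrier (E p q)"
  shows "kmap C p q x = \<zero>\<^bsub>D p' q\<^esub> \<longleftrightarrow> (\<exists>y\<in>carrier (D p'' q''). x = jmap C p'' q'' y)"
proof -
  have "jmap C (p - int r + 1) (q + int r - 1) ` carrier (D (p - int r + 1) (q + int r - 1)) =
       {x \<in> carrier (E p q). kmap C p q x = \<zero>\<^bsub>D (p + 1) q\<^esub>}"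
    using exact by (simp add: exact_couple_def)
  then show ?thesis using assms by blast
qed

lemma imap_zero_iff:
  assumes "p' = p - 1" "q' = q + 1" "x \<in> carrier (D p q)"
  shows "imap C p q x = \<zero>\<^bsub>D p' q'\<^esub> \<longleftrightarrow> (\<exists>y\<in>carrier (E p' q). x = kmap C p' q y)"
proof -
  have "kmap C (p - 1) q ` carrier (E (p - 1) q) =
       {x \<in> carrier (D p q). imap C p q x = \<zero>\<^bsub>D (p - 1) (q + 1)\<^esub>}"
    using exact by (simp add: exact_couple_def)
  then show ?thesis using assms by blast
qed

lemma diff_lin:
  assumes "p' = p + int r" "q' = q - int r + 1"
  shows "couple_diff C p q \<in> lin_maps (E p q) (E p' q')"
  unfolding couple_diff_def[abs_def]
  by (rule lin_map_comp[OF kmap_lin[OF refl] jmap_lin]) (use assms in auto)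

text \<open>In the middle of \<open>j k j k\<close> stands \<open>k j\<close>, which is zero by
  exactness at \<open>E\<close>.\<close>

lemma diff_diff:
  assumes "p' = p + int r" "q' = q - int r + 1" "p'' = p' + int r" "q'' = q' - int r + 1"
    and x: "x \<in> carrier (E p q)"
  shows "couple_diff C p' q' (couple_diff C p q x) = \<zero>\<^bsub>E p'' q''\<^esub>"
proof -
  have k: "kmap C p q x \<in> carrier (D (p + 1) q)" using lin_mapsD(1)[OF kmap_lin[OF refl] x] .
  have j: "jmap C (p + 1) q (kmap C p q x) \<in> carrier (E p' q')"
    by (rule lin_mapsD(1)[OF jmap_lin k]) (use assms in auto)
  have "kmap C p' q' (jmap C (p + 1) q (kmap C p q x)) = \<zero>\<^bsub>D (p' + 1) q'\<^esub>"
    using kmap_zero_iff[OF refl _ _ j, of "p + 1" q] k assms by auto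
  then show ?thesis
    using lin_map_zero[OF D_module E_module jmap_lin, of p'' "p' + 1" q'' q'] assms
    by (simp add: couple_diff_def)
qed

abbreviation Z where "Z \<equiv> page_cycles r E (couple_diff C)"
abbreviation B where "B \<equiv> page_boundaries r E (couple_diff C)"
abbreviation C' where "C' \<equiv> derived_couple r C"

lemma Z_carrier: "\<lbrakk>p' = p + int r; q' = q - int r + 1\<rbrakk> \<Longrightarrow>
    carrier (Z p q) = {x \<in> carrier (E p q). couple_diff C p q x = \<zero>\<^bsub>E p' q'\<^esub>}"
  by (simp add: page_cycles_def)

lemma B_eq: "\<lbrakk>p' = p - int r; q' = q + int r - 1\<rbrakk> \<Longrightarrow>
    B p q = couple_diff C p' q' ` carrier (E p' q')"
  by (simp add: page_boundaries_def)

lemma Z_ops [simp]: "add (Z p q) = add (E p q)" "smult (Z p q) = smult (E p q)"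
  "\<zero>\<^bsub>Z p q\<^esub> = \<zero>\<^bsub>E p q\<^esub>" "N +>\<^bsub>Z p q\<^esub> x = N +>\<^bsub>E p q\<^esub> x"
  by (simp_all add: page_cycles_def)

lemma Z_submodule: "submodule (carrier (Z p q)) real_ring (E p q)"
  unfolding Z_carrier[OF refl refl] by (rule submodule_kernel[OF E_module E_module diff_lin]) auto

lemma Z_module: "module real_ring (Z p q)"
  using submodule_module[OF E_module Z_submodule] by (simp add: page_cycles_def)

lemma B_submodule: "submodule (B p q) real_ring (E p q)"
  unfolding B_eq[OF refl refl] by (rule submodule_image[OF E_module E_module diff_lin]) auto

lemma B_subset_Z: "B p q \<subseteq> carrier (Z p q)"
proof
  fix x assume x: "x \<in> B p q"
  then have "couple_diff C p q x = \<zero>\<^bsub>E (p + int r) (q - int r + 1)\<^esub>"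
    using diff_diff[of p "p - int r" q "q + int r - 1" "p + int r" "q - int r + 1"]
    by (auto simp: B_eq[OF refl refl])
  then show "x \<in> carrier (Z p q)"
    using x submodule_real(1)[OF B_submodule] by (auto simp: Z_carrier[OF refl refl])
qed

lemma derived_quotient: "quotient_proj (\<lambda>x. B p q +>\<^bsub>E p q\<^esub> x) (Z p q) (B p q) (eobj C' p q)"
proof -
  have "submodule (B p q) real_ring (Z p q)"
    using submodule_carrier_update[OF E_module Z_submodule B_submodule B_subset_Z]
    by (simp add: page_cycles_def)
  from quotient_proj_quot_mod[OF Z_module this]
  show ?thesis by (simp add: derived_couple_def page_homology_def)
qed

lemma derived_dobj: "dobj C' p q =
    (D p q)\<lparr>carrier := imap C (p + 1) (q - 1) ` carrier (D (p + 1) (q - 1))\<rparr>"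
  by (simp add: derived_couple_def)

lemma derived_dobj_submodule: "submodule (carrier (dobj C' p q)) real_ring (D p q)"
  using submodule_image[OF D_module D_module imap_lin, of p "p + 1" q "q - 1"]
  by (simp add: derived_dobj)

lemma derived_imap: "imap C' = imap C"
  by (simp add: derived_couple_def)

lemma jmap_in_Z:
  assumes a: "a \<in> carrier (D p q)" and "p' = p + int r - 1" "q' = q - int r + 1"
  shows "jmap C p q a \<in> carrier (Z p' q')"
proof -
  have j: "jmap C p q a \<in> carrier (E p' q')"
    by (rule lin_mapsD(1)[OF jmap_lin a]) (use assms in auto)
  have "kmap C p' q' (jmap C p q a) = \<zero>\<^bsub>D (p' + 1) q'\<^esub>"
    using kmap_zero_iff[OF refl _ _ j, of p q] a assms by auto
  then show ?thesis
    using j lin_map_zero[OF D_module E_module jmap_lin, of "p' + int r" "p' + 1" "q' - int r + 1" q']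
    by (auto simp: Z_carrier[OF refl refl] couple_diff_def)
qed

text \<open>Well-definedness of the derived \<open>j\<close>: the difference of \<open>a\<close> and
  \<open>a'\<close> is killed by \<open>i\<close>, hence equals some \<open>k b\<close>, and
  \<open>j k b\<close> is a boundary.\<close>

lemma jmap_coset_cong:
  assumes a: "a \<in> carrier (D p q)" and a': "a' \<in> carrier (D p q)"
    and eq: "imap C p q a = imap C p q a'" and idx: "p' = p + int r - 1" "q' = q - int r + 1"
  shows "B p' q' +>\<^bsub>E p' q'\<^esub> jmap C p q a = B p' q' +>\<^bsub>E p' q'\<^esub> jmap C p q a'"
proof -
  obtain n where n: "n \<in> carrier (D p q)" "imap C p q n = \<zero>\<^bsub>D (p - 1) (q + 1)\<^esub>" "a = n \<oplus>\<^bsub>D p q\<^esub> a'"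
    using eq lin_map_eq_iff[OF D_module D_module imap_lin[OF refl refl] a a'] by auto
  obtain b where b: "b \<in> carrier (E (p - 1) q)" "n = kmap C (p - 1) q b"
    using imap_zero_iff[OF refl refl n(1)] n(2) by auto
  have "jmap C p q n \<in> B p' q'"
    unfolding B_eq[OF refl refl] using b idx by (auto simp: couple_diff_def)
  moreover have "jmap C p q a = jmap C p q n \<oplus>\<^bsub>E p' q'\<^esub> jmap C p q a'"
    unfolding n(3) by (rule lin_mapsD(2)[OF jmap_lin n(1) a']) (use idx in auto)
  ultimately show ?thesis
    using quotient_proj_eq_iff[OF derived_quotient jmap_in_Z[OF a idx] jmap_in_Z[OF a' idx]]
    by auto
qed

lemma derived_jmap:
  assumes a: "a \<in> carrier (D p' q')" and idx: "p' = p + 1" "q' = q - 1"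
    and idx2: "p'' = p + int r" "q'' = q - int r"
  shows "jmap C' p q (imap C p' q' a) = B p'' q'' +>\<^bsub>E p'' q''\<^esub> jmap C p' q' a"
  unfolding derived_couple_def couple.simps
proof (rule the_equality)
  show "\<exists>b\<in>carrier (D (p + 1) (q - 1)). imap C p' q' a = imap C (p + 1) (q - 1) b \<and>
      B p'' q'' +>\<^bsub>E p'' q''\<^esub> jmap C p' q' a =
      B (p + int r) (q - int r) +>\<^bsub>E (p + int r) (q - int r)\<^esub> jmap C (p + 1) (q - 1) b"
    using a idx idx2 by auto
next
  fix \<eta> assume "\<exists>b\<in>carrier (D (p + 1) (q - 1)). imap C p' q' a = imap C (p + 1) (q - 1) b \<and>
      \<eta> = B (p + int r) (q - int r) +>\<^bsub>E (p + int r) (q - int r)\<^esub> jmap C (p + 1) (q - 1) b"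
  then obtain b where b: "b \<in> carrier (D p' q')" "imap C p' q' a = imap C p' q' b"
    "\<eta> = B p'' q'' +>\<^bsub>E p'' q''\<^esub> jmap C p' q' b" using idx idx2 by auto
  show "\<eta> = B p'' q'' +>\<^bsub>E p'' q''\<^esub> jmap C p' q' a"
    unfolding b(3) by (rule jmap_coset_cong[OF b(1) a b(2)[symmetric]]) (use idx idx2 in auto)
qed

text \<open>A boundary has the form \<open>j k x\<close>, and \<open>k j = 0\<close>. Hence
  \<open>k\<close> is constant on the cosets that make up the derived \<open>E\<close> term.\<close>

lemma kmap_B: 
  assumes h: "h \<in> B p q"
  shows "kmap C p q h = \<zero>\<^bsub>D (p + 1) q\<^esub>"
proof -
  have hE: "h \<in> carrier (E p q)" using h submodule_real(1)[OF B_submodule] by auto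
  from h obtain x where x: "x \<in> carrier (E (p - int r) (q + int r - 1))"
    "h = jmap C (p - int r + 1) (q + int r - 1) (kmap C (p - int r) (q + int r - 1) x)"
    by (auto simp: B_eq[OF refl refl] couple_diff_def)
  then show ?thesis
    using kmap_zero_iff[OF refl refl refl hE] lin_mapsD(1)[OF kmap_lin[OF refl] x(1)] by auto
qed

lemma derived_kmap:
  assumes b: "b \<in> carrier (E p q)"
  shows "kmap C' p q (B p q +>\<^bsub>E p q\<^esub> b) = kmap C p q b"
  unfolding derived_couple_def couple.simps
proof (rule the_equality)
  show "\<exists>c\<in>B p q +>\<^bsub>E p q\<^esub> b. kmap C p q b = kmap C p q c"
    using coset_self[OF E_module B_submodule b] by auto
next
  fix y assume "\<exists>c\<in>B p q +>\<^bsub>E p q\<^esub> b. y = kmap C p q c"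
  then obtain h where h: "h \<in> B p q" "y = kmap C p q (h \<oplus>\<^bsub>E p q\<^esub> b)"
    by (auto simp: a_r_coset_def')
  have "h \<in> carrier (E p q)" using h submodule_real(1)[OF B_submodule] by auto
  then show "y = kmap C p q b"
    using h(2) kmap_B[OF h(1)] lin_mapsD(1,2)[OF kmap_lin[OF refl]] b module_closed(5)[OF D_module]
    by simp
qed

text \<open>The condition \<open>j (k x) = 0\<close> is read through exactness at \<open>D\<close>.
  The cycles are thus the elements that \<open>k\<close> sends into the derived \<open>D\<close>
  term.\<close>

lemma Z_iff:
  assumes "p' = p + 2" "q' = q - 1"
  shows "x \<in> carrier (Z p q) \<longleftrightarrow>
    x \<in> carrier (E p q) \<and> (\<exists>y\<in>carrier (D p' q'). kmap C p q x = imap C p' q' y)"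
proof (cases "x \<in> carrier (E p q)")
  case True
  then have k: "kmap C p q x \<in> carrier (D (p + 1) q)" using lin_mapsD(1)[OF kmap_lin[OF refl]] by auto
  show ?thesis
    using jmap_zero_iff[OF refl refl _ _ k, of p' q'] True assms
    by (auto simp: Z_carrier[OF refl refl] couple_diff_def)
qed (auto simp: Z_carrier[OF refl refl])

lemma derived_dobj_iff:
  "\<lbrakk>p' = p + 1; q' = q - 1\<rbrakk> \<Longrightarrow>
    x \<in> carrier (dobj C' p q) \<longleftrightarrow> (\<exists>a\<in>carrier (D p' q'). x = imap C p' q' a)"
  by (auto simp: derived_dobj)

lemma derived_eobj_obtain:
  assumes "\<xi> \<in> carrier (eobj C' p q)"
  obtains b where "b \<in> carrier (Z p q)" "\<xi> = B p q +>\<^bsub>E p q\<^esub> b"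
  using assms quotient_projD(4)[OF derived_quotient, of p q] by auto

lemma Z_subset: "b \<in> carrier (Z p q) \<Longrightarrow> b \<in> carrier (E p q)"
  using submodule_real(1)[OF Z_submodule] by auto

section \<open>Linearity and exactness of the derived maps\<close>

lemma derived_D_module: "module real_ring (dobj C' p q)"
  using submodule_module[OF D_module derived_dobj_submodule] unfolding derived_dobj by simp

lemma derived_imap_lin:
  assumes "p' = p - 1" "q' = q + 1"
  shows "imap C p q \<in> lin_maps (dobj C' p q) (dobj C' p' q')"
proof -
  have "imap C (p + 1) (q - 1) ` carrier (D (p + 1) (q - 1)) \<subseteq> carrier (D p q)"
    using lin_mapsD(1)[OF imap_lin] by force
  then show ?thesis
    unfolding derived_dobj using assms
    by (intro lin_maps_restrict[OF imap_lin]) auto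
qed

lemma derived_jmap_lin:
  assumes "p' = p + int r" "q' = q - int r"
  shows "jmap C' p q \<in> lin_maps (dobj C' p q) (eobj C' p' q')"
proof -
  let ?a = "p + 1" and ?b = "q - 1"
  have i: "imap C ?a ?b \<in> lin_maps (D ?a ?b) (D p q)" by (rule imap_lin) auto
  have jZ: "jmap C ?a ?b \<in> lin_maps (D ?a ?b) (Z p' q')"
    using jmap_in_Z[of _ ?a ?b p' q'] lin_mapsD(2,3)[OF jmap_lin[of p' ?a q' ?b]] assms
    by (intro lin_mapsI) auto
  \<comment> \<open>The derived \<open>D\<close> term is presented as the quotient of the old one by
    the kernel of \<open>i\<close>, so that the linearity of \<open>j\<close> descends to the
    derived map.\<close>
  have q: "quotient_proj (imap C ?a ?b) (D ?a ?b) {x \<in> carrier (D ?a ?b). imap C ?a ?b x = \<zero>\<^bsub>D p q\<^esub>}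
      (dobj C' p q)"
    using lin_mapsD(2,3)[OF i] derived_D_module[of p q] D_module
    by (auto simp: quotient_proj_def derived_dobj intro!: lin_mapsI)
  show ?thesis
    by (rule lin_maps_descend[OF q lin_map_comp[OF jZ quotient_projD(3)[OF derived_quotient]]])
      (rule derived_jmap, use assms in auto)
qed

lemma derived_kmap_lin:
  assumes "p' = p + 1"
  shows "kmap C' p q \<in> lin_maps (eobj C' p q) (dobj C' p' q)"
proof (rule lin_maps_descend[OF derived_quotient])
  show "kmap C p q \<in> lin_maps (Z p q) (dobj C' p' q)"
  proof (rule lin_mapsI)
    fix x assume "x \<in> carrier (Z p q)"
    then show "kmap C p q x \<in> carrier (dobj C' p' q)"
      using derived_dobj_iff[of "p + 2" p' "q - 1" q] assms by (auto simp: Z_iff[OF refl refl])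
  qed (use lin_mapsD(2,3)[OF kmap_lin[of p' p q]] assms Z_subset in \<open>auto simp: derived_dobj\<close>)
qed (auto intro: derived_kmap Z_subset)

text \<open>Write \<open>x = i a\<close>. The class of \<open>j a\<close> is zero when
  \<open>j a = j k b\<close> for some \<open>b\<close>. Then \<open>a - k b\<close> lies in the
  image of \<open>i\<close>, that is, in the derived \<open>D\<close> term, and it still maps to
  \<open>x\<close> because \<open>i k = 0\<close>. The converse runs through the same
  relations.\<close>

lemma derived_jmap_zero_iff:
  assumes x: "x \<in> carrier (dobj C' p q)" and "p' = p + 1" "q' = q - 1"
    and "p'' = p + int r" "q'' = q - int r"
  shows "jmap C' p q x = \<zero>\<^bsub>eobj C' p'' q''\<^esub> \<longleftrightarrow> (\<exists>y\<in>carrier (dobj C' p' q'). x = imap C p' q' y)"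
proof -
  obtain a where a: "a \<in> carrier (D p' q')" "x = imap C p' q' a"
    using x derived_dobj_iff[OF assms(2,3)] by auto
  have ja: "jmap C p' q' a \<in> carrier (Z p'' q'')"
    by (rule jmap_in_Z[OF a(1)]) (use assms in auto)
  have jl: "jmap C p' q' \<in> lin_maps (D p' q') (E p'' q'')"
    by (rule jmap_lin) (use assms in auto)
  have il: "imap C p' q' \<in> lin_maps (D p' q') (D p q)"
    by (rule imap_lin) (use assms in auto)
  have "jmap C' p q x = \<zero>\<^bsub>eobj C' p'' q''\<^esub> \<longleftrightarrow> jmap C p' q' a \<in> B p'' q''"
    unfolding a(2) derived_jmap[OF a(1) assms(2-5)]
    by (rule quotient_projD(5)[OF derived_quotient ja])
  also have "\<dots> \<longleftrightarrow> (\<exists>b\<in>carrier (E p q'). jmap C p' q' a = jmap C p' q' (kmap C p q' b))"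
  proof -
    have "B p'' q'' = couple_diff C p q' ` carrier (E p q')" by (rule B_eq) (use assms in auto)
    then show ?thesis using assms by (auto simp: couple_diff_def)
  qed
  also have "\<dots> \<longleftrightarrow> (\<exists>y\<in>carrier (dobj C' p' q'). x = imap C p' q' y)"
  proof
    assume "\<exists>b\<in>carrier (E p q'). jmap C p' q' a = jmap C p' q' (kmap C p q' b)"
    then obtain b where b: "b \<in> carrier (E p q')" "jmap C p' q' a = jmap C p' q' (kmap C p q' b)"
      by blast
    let ?k = "kmap C p q' b"
    have k: "?k \<in> carrier (D p' q')" using lin_mapsD(1)[OF kmap_lin b(1)] assms by auto
    have ik: "imap C p' q' ?k = \<zero>\<^bsub>D p q\<^esub>"
      using imap_zero_iff[of p p' q q' ?k] k b assms by auto
    obtain n where n: "n \<in> carrier (D p' q')" "jmap C p' q' n = \<zero>\<^bsub>E p'' q''\<^esub>"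
      "a = n \<oplus>\<^bsub>D p' q'\<^esub> ?k"
      using lin_map_eq_iff[OF D_module E_module jl a(1) k] b(2) by blast
    have "\<exists>c\<in>carrier (D (p' + 1) (q' - 1)). n = imap C (p' + 1) (q' - 1) c"
      using jmap_zero_iff[of p'' p' q'' q', OF _ _ refl refl n(1)] n(2) assms by simp
    then have "n \<in> carrier (dobj C' p' q')" using derived_dobj_iff[OF refl refl] by blast
    moreover have "x = imap C p' q' n"
      using a(2) n(3) lin_mapsD(1,2)[OF il] n(1) k ik module_closed(6)[OF D_module] by simp
    ultimately show "\<exists>y\<in>carrier (dobj C' p' q'). x = imap C p' q' y" by blast
  next
    assume "\<exists>y\<in>carrier (dobj C' p' q'). x = imap C p' q' y"
    then obtain y where y: "y \<in> carrier (dobj C' p' q')" "x = imap C p' q' y" by blast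
    have yD: "y \<in> carrier (D p' q')" using y(1) submodule_real(1)[OF derived_dobj_submodule] by auto
    have jy: "jmap C p' q' y = \<zero>\<^bsub>E p'' q''\<^esub>"
      using jmap_zero_iff[of p'' p' q'' q', OF _ _ refl refl yD] y(1) assms
      by (simp add: derived_dobj_iff[OF refl refl])
    obtain n where n: "n \<in> carrier (D p' q')" "imap C p' q' n = \<zero>\<^bsub>D p q\<^esub>" "a = n \<oplus>\<^bsub>D p' q'\<^esub> y"
      using lin_map_eq_iff[OF D_module D_module il a(1) yD] y(2) a(2) by metis
    obtain b where b: "b \<in> carrier (E p q')" "n = kmap C p q' b"
      using imap_zero_iff[of p p' q q' n] n(1,2) assms by auto
    have "jmap C p' q' a = jmap C p' q' (kmap C p q' b)"
      using n(3) lin_mapsD(1,2)[OF jl] n(1) yD jy b(2) module_closed(6)[OF E_module] by simp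
    then show "\<exists>b\<in>carrier (E p q'). jmap C p' q' a = jmap C p' q' (kmap C p q' b)" using b by blast
  qed
  finally show ?thesis .
qed

text \<open>The derived \<open>k\<close> is computed on a representative \<open>b\<close>. If
  \<open>k b = 0\<close>, then \<open>b = j a\<close>, and the class of \<open>j a\<close> is by
  definition the derived \<open>j\<close> of \<open>i a\<close>.\<close>

lemma derived_kmap_zero_iff:
  assumes x: "\<xi> \<in> carrier (eobj C' p q)" and "p' = p + 1" "p'' = p - int r" "q'' = q + int r"
  shows "kmap C' p q \<xi> = \<zero>\<^bsub>dobj C' p' q\<^esub> \<longleftrightarrow> (\<exists>y\<in>carrier (dobj C' p'' q''). \<xi> = jmap C' p'' q'' y)"
proof -
  obtain b where b: "b \<in> carrier (Z p q)" "\<xi> = B p q +>\<^bsub>E p q\<^esub> b"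
    using derived_eobj_obtain[OF x] .
  have bE: "b \<in> carrier (E p q)" by (rule Z_subset[OF b(1)])
  let ?s = "p'' + 1" and ?t = "q'' - 1"
  have jm: "jmap C' p'' q'' (imap C ?s ?t a) = B p q +>\<^bsub>E p q\<^esub> jmap C ?s ?t a"
    if "a \<in> carrier (D ?s ?t)" for a
    by (rule derived_jmap[OF that]) (use assms in auto)
  have jE: "jmap C ?s ?t a \<in> carrier (Z p q)" if "a \<in> carrier (D ?s ?t)" for a
    by (rule jmap_in_Z[OF that]) (use assms in auto)
  have kj: "kmap C p q (jmap C ?s ?t a) = \<zero>\<^bsub>D p' q\<^esub>" if "a \<in> carrier (D ?s ?t)" for a
    using kmap_zero_iff[of p' p ?s ?t q, OF _ _ _ Z_subset[OF jE[OF that]]] that assms by auto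
  have "kmap C' p q \<xi> = \<zero>\<^bsub>dobj C' p' q\<^esub> \<longleftrightarrow> kmap C p q b = \<zero>\<^bsub>D p' q\<^esub>"
    unfolding b(2) derived_kmap[OF bE] by (simp add: derived_dobj)
  also have "\<dots> \<longleftrightarrow> (\<exists>y\<in>carrier (dobj C' p'' q''). \<xi> = jmap C' p'' q'' y)"
  proof
    assume "kmap C p q b = \<zero>\<^bsub>D p' q\<^esub>"
    then obtain a where a: "a \<in> carrier (D ?s ?t)" "b = jmap C ?s ?t a"
      using kmap_zero_iff[of p' p ?s ?t q, OF _ _ _ bE] assms by auto
    then show "\<exists>y\<in>carrier (dobj C' p'' q''). \<xi> = jmap C' p'' q'' y"
      using jm[OF a(1)] b(2) derived_dobj_iff[OF refl refl] by (metis)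
  next
    assume "\<exists>y\<in>carrier (dobj C' p'' q''). \<xi> = jmap C' p'' q'' y"
    then obtain y where "y \<in> carrier (dobj C' p'' q'')" "\<xi> = jmap C' p'' q'' y" by blast
    then obtain a where a: "a \<in> carrier (D ?s ?t)" "\<xi> = jmap C' p'' q'' (imap C ?s ?t a)"
      using derived_dobj_iff[of ?s p'' ?t q'' y] by auto
    then have "kmap C p q b = kmap C p q (jmap C ?s ?t a)"
      using jm[OF a(1)] b(2) derived_kmap[OF bE] derived_kmap[OF Z_subset[OF jE[OF a(1)]]] by metis
    then show "kmap C p q b = \<zero>\<^bsub>D p' q\<^esub>" using kj[OF a(1)] by simp
  qed
  finally show ?thesis .
qed

text \<open>Exactness of the old couple yields \<open>x = k b\<close>. As \<open>x\<close> lies in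
  the image of \<open>i\<close>, the element \<open>b\<close> is automatically a cycle by
  \<open>Z_iff\<close>, so its class is available.\<close>

lemma derived_imap_zero_iff:
  assumes x: "x \<in> carrier (dobj C' p q)" and idx: "p' = p - 1" "q' = q + 1"
  shows "imap C p q x = \<zero>\<^bsub>dobj C' p' q'\<^esub> \<longleftrightarrow> (\<exists>\<xi>\<in>carrier (eobj C' p' q). x = kmap C' p' q \<xi>)"
proof -
  have xD: "x \<in> carrier (D p q)" using x submodule_real(1)[OF derived_dobj_submodule] by auto
  have "imap C p q x = \<zero>\<^bsub>dobj C' p' q'\<^esub> \<longleftrightarrow> (\<exists>b\<in>carrier (E p' q). x = kmap C p' q b)"
    using imap_zero_iff[OF idx xD] by (simp add: derived_dobj)
  also have "\<dots> \<longleftrightarrow> (\<exists>b\<in>carrier (Z p' q). x = kmap C p' q b)"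
  proof -
    have "\<exists>a\<in>carrier (D (p + 1) (q - 1)). x = imap C (p + 1) (q - 1) a"
      using x derived_dobj_iff[OF refl refl] by blast
    then have "b \<in> carrier (Z p' q)" if "b \<in> carrier (E p' q)" "x = kmap C p' q b" for b
      using that Z_iff[of "p + 1" p' "q - 1" q b] idx by simp
    then show ?thesis using Z_subset by blast
  qed
  also have "\<dots> \<longleftrightarrow> (\<exists>\<xi>\<in>carrier (eobj C' p' q). x = kmap C' p' q \<xi>)"
    using quotient_projD(4)[OF derived_quotient, of p' q, symmetric] derived_kmap Z_subset by force
  finally show ?thesis .
qed

text \<open>The stage grows by one because the derived \<open>j\<close> first goes back along
  \<open>i\<close>, which adds \<open>(1, -1)\<close> to its bidegree.\<close>

theorem exact_derived_couple: "exact_couple (Suc r) C'"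
  unfolding exact_couple_def derived_imap
proof (intro allI conjI)
  fix p q
  show "module real_ring (dobj C' p q)" "module real_ring (eobj C' p q)"
    using derived_D_module quotient_projD(2)[OF derived_quotient] by auto
  show "imap C p q \<in> lin_maps (dobj C' p q) (dobj C' (p - 1) (q + 1))"
    "jmap C' p q \<in> lin_maps (dobj C' p q) (eobj C' (p + int (Suc r) - 1) (q - int (Suc r) + 1))"
    "kmap C' p q \<in> lin_maps (eobj C' p q) (dobj C' (p + 1) q)"
    by (rule derived_imap_lin derived_jmap_lin derived_kmap_lin; simp)+
  have "imap C (p + 1) (q - 1) y \<in> carrier (dobj C' p q)" if "y \<in> carrier (dobj C' (p + 1) (q - 1))" for y
    using lin_mapsD(1)[OF derived_imap_lin that] by simp
  then show "imap C (p + 1) (q - 1) ` carrier (dobj C' (p + 1) (q - 1)) =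
      {x \<in> carrier (dobj C' p q). jmap C' p q x = \<zero>\<^bsub>eobj C' (p + int (Suc r) - 1) (q - int (Suc r) + 1)\<^esub>}"
    using derived_jmap_zero_iff[OF _ refl refl, of _ p q "p + int (Suc r) - 1" "q - int (Suc r) + 1"]
    by auto
  have "jmap C' (p - int (Suc r) + 1) (q + int (Suc r) - 1) y \<in> carrier (eobj C' p q)"
    if "y \<in> carrier (dobj C' (p - int (Suc r) + 1) (q + int (Suc r) - 1))" for y
    using lin_mapsD(1)[OF derived_jmap_lin that] by simp
  then show "jmap C' (p - int (Suc r) + 1) (q + int (Suc r) - 1) `
        carrier (dobj C' (p - int (Suc r) + 1) (q + int (Suc r) - 1)) =
      {x \<in> carrier (eobj C' p q). kmap C' p q x = \<zero>\<^bsub>dobj C' (p + 1) q\<^esub>}"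
    using derived_kmap_zero_iff[OF _ refl, of _ p q "p - int (Suc r) + 1" "q + int (Suc r) - 1"]
    by auto
  have "kmap C' (p - 1) q y \<in> carrier (dobj C' p q)" if "y \<in> carrier (eobj C' (p - 1) q)" for y
    using lin_mapsD(1)[OF derived_kmap_lin that] by simp
  then show "kmap C' (p - 1) q ` carrier (eobj C' (p - 1) q) =
      {x \<in> carrier (dobj C' p q). imap C p q x = \<zero>\<^bsub>dobj C' (p - 1) (q + 1)\<^esub>}"
    using derived_imap_zero_iff[OF _ refl refl, of _ p q] by auto
qed

end

section \<open>Complements and filtered vector spaces\<close>

lemma submodule_zero: "module real_ring M \<Longrightarrow> submodule {\<zero>\<^bsub>M\<^esub>} real_ring M"
  using module_closed[of M] by (intro submodule_realI) auto

text \<open>A complement is a submodule maximal among those meeting \<open>N\<close> only in zero.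
  If some \<open>x\<close> were not in \<open>N + W\<close>, the span of \<open>W\<close> and
  \<open>x\<close> would still meet \<open>N\<close> trivially, against maximality.\<close>

lemma submodule_complement:
  assumes M: "module real_ring M" and N: "submodule N real_ring M"
  obtains W where "submodule W real_ring M" "W \<inter> N = {\<zero>\<^bsub>M\<^esub>}"
    "\<And>x. x \<in> carrier M \<Longrightarrow> \<exists>n\<in>N. \<exists>w\<in>W. x = n \<oplus>\<^bsub>M\<^esub> w"
proof -
  interpret M: module real_ring M by fact
  note subN = submodule_real[OF N]
  define \<A> where "\<A> = {W. submodule W real_ring M \<and> W \<inter> N = {\<zero>\<^bsub>M\<^esub>}}"
  have "\<A> \<noteq> {}" using submodule_zero[OF M] subN(2) by (auto simp: \<A>_def)
  moreover have "\<Union>\<C> \<in> \<A>" if ne: "\<C> \<noteq> {}" and ch: "subset.chain \<A> \<C>" for \<C>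
  proof -
    have sub: "submodule W real_ring M" "W \<inter> N = {\<zero>\<^bsub>M\<^esub>}" if "W \<in> \<C>" for W
      using ch that by (auto simp: subset.chain_def \<A>_def)
    have lin: "U \<subseteq> U' \<or> U' \<subseteq> U" if "U \<in> \<C>" "U' \<in> \<C>" for U U'
      using subset.chain_total[OF ch that] by auto
    have "submodule (\<Union>\<C>) real_ring M"
    proof (rule submodule_realI[OF M])
      show "\<Union>\<C> \<subseteq> carrier M" using submodule_real(1)[OF sub(1)] by blast
      show "\<zero>\<^bsub>M\<^esub> \<in> \<Union>\<C>" using submodule_real(2)[OF sub(1)] ne by blast
    next
      fix x y assume "x \<in> \<Union>\<C>" "y \<in> \<Union>\<C>"
      then obtain U U' where UU: "U \<in> \<C>" "U' \<in> \<C>" "x \<in> U" "y \<in> U'" by blast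
      show "x \<oplus>\<^bsub>M\<^esub> y \<in> \<Union>\<C>"
        using lin[OF UU(1,2)] UU submodule_real(3)[OF sub(1)[OF UU(1)]]
          submodule_real(3)[OF sub(1)[OF UU(2)]] by blast
    next
      fix a x assume "x \<in> \<Union>\<C>"
      then show "a \<odot>\<^bsub>M\<^esub> x \<in> \<Union>\<C>" using submodule_real(4)[OF sub(1)] by blast
    qed
    then show ?thesis using sub(2) ne by (auto simp: \<A>_def)
  qed
  ultimately obtain W where W: "submodule W real_ring M" "W \<inter> N = {\<zero>\<^bsub>M\<^esub>}"
    and max: "\<And>U. \<lbrakk>submodule U real_ring M; U \<inter> N = {\<zero>\<^bsub>M\<^esub>}; W \<subseteq> U\<rbrakk> \<Longrightarrow> U = W"
    using subset_Zorn_nonempty[of \<A>] by (auto simp: \<A>_def)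
  note subW = submodule_real[OF W(1)]
  have car: "w \<in> carrier M" if "w \<in> W \<or> w \<in> N" for w using that subW(1) subN(1) by auto
  have "\<exists>n\<in>N. \<exists>w\<in>W. x = n \<oplus>\<^bsub>M\<^esub> w" if x: "x \<in> carrier M" for x
  proof (rule ccontr)
    assume no: "\<not> ?thesis"
    define U where "U = {w \<oplus>\<^bsub>M\<^esub> a \<odot>\<^bsub>M\<^esub> x | w a. w \<in> W}"
    have U: "submodule U real_ring M"
    proof (rule submodule_realI[OF M])
      show "U \<subseteq> carrier M" using car x by (auto simp: U_def)
      show "\<zero>\<^bsub>M\<^esub> \<in> U"
        unfolding U_def using subW(2) M.smult_l_null[OF x] by (auto intro!: exI[of _ "\<zero>\<^bsub>M\<^esub>"] exI[of _ 0])
    next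
      fix y z assume "y \<in> U" "z \<in> U"
      then obtain v w a b where vw: "v \<in> W" "w \<in> W" "y = v \<oplus>\<^bsub>M\<^esub> a \<odot>\<^bsub>M\<^esub> x" "z = w \<oplus>\<^bsub>M\<^esub> b \<odot>\<^bsub>M\<^esub> x"
        by (auto simp: U_def)
      have "y \<oplus>\<^bsub>M\<^esub> z = (v \<oplus>\<^bsub>M\<^esub> w) \<oplus>\<^bsub>M\<^esub> (a + b) \<odot>\<^bsub>M\<^esub> x"
        using vw car x M.smult_l_distr[of a b x] by (simp add: M.M.a_ac)
      then show "y \<oplus>\<^bsub>M\<^esub> z \<in> U" using subW(3)[OF vw(1,2)] by (auto simp: U_def)
    next
      fix c y assume "y \<in> U"
      then obtain v a where v: "v \<in> W" "y = v \<oplus>\<^bsub>M\<^esub> a \<odot>\<^bsub>M\<^esub> x" by (auto simp: U_def)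
      have "c \<odot>\<^bsub>M\<^esub> y = c \<odot>\<^bsub>M\<^esub> v \<oplus>\<^bsub>M\<^esub> (c * a) \<odot>\<^bsub>M\<^esub> x"
        using v car x M.smult_r_distr[of c v "a \<odot>\<^bsub>M\<^esub> x"] M.smult_assoc1[of c a x] by simp
      then show "c \<odot>\<^bsub>M\<^esub> y \<in> U" using subW(4)[OF v(1)] by (auto simp: U_def)
    qed
    have "y = \<zero>\<^bsub>M\<^esub>" if "y \<in> U" "y \<in> N" for y
    proof -
      obtain w a where w: "w \<in> W" "y = w \<oplus>\<^bsub>M\<^esub> a \<odot>\<^bsub>M\<^esub> x" using \<open>y \<in> U\<close> by (auto simp: U_def)
      show ?thesis
      proof (cases "a = 0")
        case True
        then have "y = w" using w x car M.smult_l_null[OF x] by simp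
        then show ?thesis using W(2) w(1) \<open>y \<in> N\<close> by blast
      next
        \<comment> \<open>As \<open>a\<close> is invertible, the relation can be solved for
          \<open>x\<close>, which would put \<open>x\<close> into \<open>N + W\<close> against
          \<open>no\<close>.\<close>
        case False
        have ax: "a \<odot>\<^bsub>M\<^esub> x = y \<oplus>\<^bsub>M\<^esub> \<ominus>\<^bsub>M\<^esub> w"
          using w x car by (simp add: M.M.a_ac M.M.r_neg1 M.M.r_neg2)
        have "x = (inverse a * a) \<odot>\<^bsub>M\<^esub> x" using False x M.smult_one[OF x] by simp
        also have "\<dots> = inverse a \<odot>\<^bsub>M\<^esub> (y \<oplus>\<^bsub>M\<^esub> \<ominus>\<^bsub>M\<^esub> w)"
          using M.smult_assoc1[of "inverse a" a x] x by (simp add: ax)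
        also have "\<dots> = inverse a \<odot>\<^bsub>M\<^esub> y \<oplus>\<^bsub>M\<^esub> inverse a \<odot>\<^bsub>M\<^esub> (\<ominus>\<^bsub>M\<^esub> w)"
          using M.smult_r_distr[of "inverse a" y "\<ominus>\<^bsub>M\<^esub> w"] \<open>y \<in> N\<close> w(1) car by simp
        finally show ?thesis using no subN(4)[OF \<open>y \<in> N\<close>] subW(4)[OF subW(5)[OF w(1)]] by blast
      qed
    qed
    then have UN: "U \<inter> N = {\<zero>\<^bsub>M\<^esub>}" using submodule_real(2)[OF U] subN(2) by blast
    have "w \<in> U" if w: "w \<in> W" for w
    proof -
      have "w = w \<oplus>\<^bsub>M\<^esub> 0 \<odot>\<^bsub>M\<^esub> x" using car[of w] w M.smult_l_null[OF x] by simp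
      then show ?thesis unfolding U_def using w by blast
    qed
    then have "U = W" using max[OF U UN] by auto
    moreover have "x \<in> U"
    proof -
      have "x = \<zero>\<^bsub>M\<^esub> \<oplus>\<^bsub>M\<^esub> 1 \<odot>\<^bsub>M\<^esub> x" using x M.smult_one[OF x] by simp
      then show ?thesis unfolding U_def using subW(2) by blast
    qed
    ultimately have "x \<in> W" by simp
    then show False using no subN(2) x by force
  qed
  then show thesis using that[OF W] by blast
qed

text \<open>A complement of the kernel is mapped isomorphically onto \<open>Q\<close>; the section
  is the inverse of this restriction.\<close>

lemma linear_section:
  assumes q: "quotient_proj \<pi> M N Q"
  obtains s where "s \<in> lin_maps Q M" "\<And>z. z \<in> carrier Q \<Longrightarrow> \<pi> (s z) = z"
proof -
  note qp = quotient_projD[OF q]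
  have N: "submodule N real_ring M"
    using submodule_kernel[OF qp(1-3)] q by (simp add: quotient_proj_def)
  obtain W where W: "submodule W real_ring M" "W \<inter> N = {\<zero>\<^bsub>M\<^esub>}"
    and sum: "\<And>x. x \<in> carrier M \<Longrightarrow> \<exists>n\<in>N. \<exists>w\<in>W. x = n \<oplus>\<^bsub>M\<^esub> w"
    using submodule_complement[OF qp(1) N] by blast
  note subW = submodule_real[OF W(1)]
  let ?W = "M\<lparr>carrier := W\<rparr>"
  have mW: "module real_ring ?W" by (rule submodule_module[OF qp(1) W(1)])
  have l: "\<pi> \<in> lin_maps ?W Q" using lin_maps_restrict_dom[OF qp(3) subW(1)] .
  have "inj_on \<pi> W"
  proof (rule inj_onI)
    fix x y assume x: "x \<in> W" and y: "y \<in> W" and "\<pi> x = \<pi> y"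
    then obtain n where n: "n \<in> W" "\<pi> n = \<zero>\<^bsub>Q\<^esub>" "x = n \<oplus>\<^bsub>M\<^esub> y"
      using lin_map_eq_iff[OF mW qp(2) l, of x y] by auto
    have "n \<in> N" using n(1,2) qp(5) subW(1) by blast
    then have "n = \<zero>\<^bsub>M\<^esub>" using n(1) W(2) by blast
    then show "x = y" using n(3) module_closed(5)[OF qp(1)] y subW(1) by auto
  qed
  moreover have "\<pi> ` W = carrier Q"
  proof
    show "\<pi> ` W \<subseteq> carrier Q" using lin_mapsD(1)[OF l] by auto
    show "carrier Q \<subseteq> \<pi> ` W"
    proof
      fix z assume "z \<in> carrier Q"
      then obtain x where x: "x \<in> carrier M" "z = \<pi> x" using qp(4) by blast
      obtain n w where nw: "n \<in> N" "w \<in> W" "x = n \<oplus>\<^bsub>M\<^esub> w" using sum[OF x(1)] by blast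
      have "\<pi> x = \<pi> w"
        using quotient_proj_eq_iff[OF q x(1)] nw subW(1) by blast
      then show "z \<in> \<pi> ` W" using x nw by blast
    qed
  qed
  ultimately have iso: "\<pi> \<in> lin_isos ?W Q" using l by (simp add: lin_isos_def bij_betw_def)
  have "inv_into W \<pi> \<in> lin_maps Q ?W" using lin_isos_inv[OF iso mW] by (simp add: lin_isos_def)
  then have "inv_into W \<pi> \<in> lin_maps Q M" using subW(1) by (auto simp: lin_maps_def Pi_iff)
  moreover have "\<pi> (inv_into W \<pi> z) = z" if "z \<in> carrier Q" for z
    using that \<open>\<pi> ` W = carrier Q\<close> f_inv_into_f[of z \<pi> W] by simp
  ultimately show thesis using that by blast
qed

text \<open>The isomorphism sends \<open>x\<close> to the family \<open>\<pi>\<^sub>k x\<^sub>k\<close>, where \<open>x\<^sub>0 = x\<close> and \<open>x\<^bsub>k+1\<^esub> = x\<^sub>k - s\<^sub>k (\<pi>\<^sub>k x\<^sub>k)\<close>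
  for linear sections \<open>s\<^sub>k\<close> of \<open>\<pi>\<^sub>k\<close>.\<close>

lemma direct_sum_graded:
  fixes F :: "int \<Rightarrow> 'x set" and E :: "int \<Rightarrow> int \<Rightarrow> (real, 'y) module" and n :: nat
  assumes V: "module real_ring V" and F: "\<And>p. submodule (F p) real_ring V"
    and top: "\<And>p. p \<le> 0 \<Longrightarrow> F p = carrier V" and bot: "\<And>p. p > int n \<Longrightarrow> F p = {\<zero>\<^bsub>V\<^esub>}"
    and gr: "\<And>p. \<exists>\<pi>. quotient_proj \<pi> (V\<lparr>carrier := F p\<rparr>) (F (p + 1)) (E p (i - p))"
  shows "lin_isomorphic (direct_sum {(p, q). p + q = i} (\<lambda>(p, q). E p q)) V"
proof -
  interpret V: module real_ring V by fact
  note sF = submodule_real[OF F]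
  obtain \<pi> where \<pi>: "\<And>p. quotient_proj (\<pi> p) (V\<lparr>carrier := F p\<rparr>) (F (p + 1)) (E p (i - p))"
    using gr by metis
  note qp = quotient_projD[OF \<pi>]
  have "\<exists>s. s \<in> lin_maps (E p (i - p)) (V\<lparr>carrier := F p\<rparr>) \<and>
      (\<forall>z\<in>carrier (E p (i - p)). \<pi> p (s z) = z)" for p
    by (rule linear_section[OF \<pi>[of p]]) blast
  then obtain s where s: "\<And>p. s p \<in> lin_maps (E p (i - p)) (V\<lparr>carrier := F p\<rparr>)"
    "\<And>p z. z \<in> carrier (E p (i - p)) \<Longrightarrow> \<pi> p (s p z) = z" by metis
  have FV: "x \<in> carrier V" if "x \<in> F p" for x p using sF(1) that by auto
  have \<pi>E: "\<pi> p x \<in> carrier (E p (i - p))" if "x \<in> F p" for x p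
    using lin_mapsD(1)[OF qp(3)] that by simp
  have \<pi>add: "\<pi> p (x \<oplus>\<^bsub>V\<^esub> y) = \<pi> p x \<oplus>\<^bsub>E p (i - p)\<^esub> \<pi> p y" if "x \<in> F p" "y \<in> F p" for x y p
    using lin_mapsD(2)[OF qp(3)] that by simp
  have \<pi>sm: "\<pi> p (a \<odot>\<^bsub>V\<^esub> x) = a \<odot>\<^bsub>E p (i - p)\<^esub> \<pi> p x" if "x \<in> F p" for x a p
    using lin_mapsD(3)[OF qp(3)] that by simp
  have \<pi>0: "\<pi> p x = \<zero>\<^bsub>E p (i - p)\<^esub> \<longleftrightarrow> x \<in> F (p + 1)" if "x \<in> F p" for x p
    using qp(5)[of x p] that by simp
  have Fmono: "F (p + 1) \<subseteq> F p" for p using qp(6)[of p] by simp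
  have sF': "s p z \<in> F p" if "z \<in> carrier (E p (i - p))" for p z
    using lin_mapsD(1)[OF s(1) that] by simp
  have sadd: "s p (x \<oplus>\<^bsub>E p (i - p)\<^esub> y) = s p x \<oplus>\<^bsub>V\<^esub> s p y"
    if "x \<in> carrier (E p (i - p))" "y \<in> carrier (E p (i - p))" for p x y
    using lin_mapsD(2)[OF s(1) that] by simp
  have ssm: "s p (a \<odot>\<^bsub>E p (i - p)\<^esub> x) = a \<odot>\<^bsub>V\<^esub> s p x"
    if "x \<in> carrier (E p (i - p))" for p x a
    using lin_mapsD(3)[OF s(1) that] by simp
  have s0: "s p \<zero>\<^bsub>E p (i - p)\<^esub> = \<zero>\<^bsub>V\<^esub>" for p
    using lin_map_zero[OF qp(2) qp(1) s(1)] by simp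
  \<comment> \<open>Outside the range from 0 to \<open>n\<close> two consecutive filtration steps
    coincide. The bound is \<open>p < 0\<close> and not \<open>p \<le> 0\<close>, since
    \<open>p + 1\<close> must also lie where the filtration is everything.\<close>
  have trivial: "carrier (E p (i - p)) = {\<zero>\<^bsub>E p (i - p)\<^esub>}" if "p < 0 \<or> p > int n" for p
  proof -
    have "F p = F (p + 1)" 
    proof (cases "p < 0")
      case True
      then have "p \<le> 0" "p + 1 \<le> 0" by linarith+
      then show ?thesis using top by metis
    next
      case False
      then have "p > int n" "p + 1 > int n" using that by linarith+
      then show ?thesis using bot by metis
    qed
    have "z = \<zero>\<^bsub>E p (i - p)\<^esub>" if z: "z \<in> carrier (E p (i - p))" for z
    proof -
      obtain u where u: "u \<in> F p" "z = \<pi> p u" using z unfolding qp(4)[of p, symmetric] by auto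
      have "u \<in> F (p + 1)" using u(1) by (subst \<open>F p = F (p + 1)\<close>[symmetric])
      then show ?thesis using \<pi>0[OF u(1)] u(2) by simp
    qed
    then show ?thesis using module_closed(1)[OF qp(2)] by blast
  qed
  \<comment> \<open>\<open>P p\<close> is the linear projection of \<open>F p\<close> onto the
    complement of \<open>F (p + 1)\<close> chosen by the section.\<close>
  define P where "P p x = s p (\<pi> p x)" for p x
  have PF: "P p x \<in> F p" if "x \<in> F p" for p x using sF' \<pi>E that by (simp add: P_def)
  have Padd: "P p (x \<oplus>\<^bsub>V\<^esub> y) = P p x \<oplus>\<^bsub>V\<^esub> P p y" if "x \<in> F p" "y \<in> F p" for p x y
    unfolding P_def \<pi>add[OF that] by (rule sadd[OF \<pi>E[OF that(1)] \<pi>E[OF that(2)]])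
  have Psm: "P p (a \<odot>\<^bsub>V\<^esub> x) = a \<odot>\<^bsub>V\<^esub> P p x" if "x \<in> F p" for p x a
    unfolding P_def \<pi>sm[OF that] by (rule ssm[OF \<pi>E[OF that]])
  have P0: "P p x = \<zero>\<^bsub>V\<^esub>" if "x \<in> F (p + 1)" for p x
    using that \<pi>0[of x p] Fmono[of p] s0 by (auto simp: P_def)
  have \<pi>P: "\<pi> p (P p x) = \<pi> p x" if "x \<in> F p" for p x using s(2) \<pi>E that by (simp add: P_def)
  define R where "R k x = rec_nat x (\<lambda>k y. y \<oplus>\<^bsub>V\<^esub> (- 1) \<odot>\<^bsub>V\<^esub> P (int k) y) k" for k x
  have R_0: "R 0 x = x" and R_Suc: "R (Suc k) x = R k x \<oplus>\<^bsub>V\<^esub> (- 1) \<odot>\<^bsub>V\<^esub> P (int k) (R k x)" for k x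
    by (simp_all add: R_def)
  \<comment> \<open>Removing its \<open>P\<close>-part leaves a remainder with zero component in
    degree \<open>k\<close>, so the remainder drops into the next filtration step.\<close>
  have RF: "R k x \<in> F (int k)" if "x \<in> carrier V" for k x
  proof (induction k)
    case 0 then show ?case using that top by (simp add: R_0)
  next
    case (Suc k)
    let ?y = "R k x" and ?p = "int k"
    have in_F: "R (Suc k) x \<in> F ?p" using Suc PF[OF Suc] sF(3,4) by (simp add: R_Suc)
    have "\<pi> ?p (R (Suc k) x) = \<pi> ?p ?y \<oplus>\<^bsub>E ?p (i - ?p)\<^esub> (- 1) \<odot>\<^bsub>E ?p (i - ?p)\<^esub> \<pi> ?p ?y"
      using Suc PF[OF Suc] sF(4) by (simp add: R_Suc \<pi>add \<pi>sm \<pi>P)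
    also have "\<dots> = \<zero>\<^bsub>E ?p (i - ?p)\<^esub>"
    proof -
      interpret E: module real_ring "E ?p (i - ?p)" by (rule qp(2))
      show ?thesis using \<pi>E[OF Suc] module_minus_eq[OF qp(2) \<pi>E[OF Suc]] E.M.r_neg by metis
    qed
    finally show ?case using \<pi>0[OF in_F] by (simp add: add.commute)
  qed
  have Radd: "R k (x \<oplus>\<^bsub>V\<^esub> y) = R k x \<oplus>\<^bsub>V\<^esub> R k y" if "x \<in> carrier V" "y \<in> carrier V" for k x y
  proof (induction k)
    case (Suc k)
    have "R k x \<in> carrier V" "P (int k) (R k x) \<in> carrier V"
      "R k y \<in> carrier V" "P (int k) (R k y) \<in> carrier V"
      using RF[OF that(1)] RF[OF that(2)] PF FV by blast+
    then show ?case
      using RF[OF that(1), of k] RF[OF that(2), of k]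
      by (simp add: R_Suc Suc Padd V.smult_r_distr V.M.a_ac)
  qed (simp add: R_0)
  have Rsm: "R k (a \<odot>\<^bsub>V\<^esub> x) = a \<odot>\<^bsub>V\<^esub> R k x" if "x \<in> carrier V" for k x a
  proof (induction k)
    case (Suc k)
    have "R k x \<in> carrier V" "P (int k) (R k x) \<in> carrier V" using RF[OF that] PF FV by blast+
    then show ?case
      using RF[OF that, of k] V.smult_assoc1[of a "-1" "P (int k) (R k x)"]
        V.smult_assoc1[of "-1" a "P (int k) (R k x)"]
      by (simp add: R_Suc Suc Psm V.smult_r_distr)
  qed (simp add: R_0)
  \<comment> \<open>An element of \<open>F m\<close> has no components below \<open>m\<close>, so
    nothing is removed before stage \<open>m\<close>.\<close>
  have R_id: "R k x = x" if "x \<in> F (int m)" "k \<le> m" for k m x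
    using that(2)
  proof (induction k)
    case (Suc k)
    have "F (int m) \<subseteq> F (int k + 1)"
    proof -
      have "F (int k + 1 + int j) \<subseteq> F (int k + 1)" for j
      proof (induction j)
        case (Suc j)
        then show ?case using Fmono[of "int k + 1 + int j"] by (simp add: add.assoc)
      qed simp
      from this[of "m - Suc k"] show ?thesis using Suc.prems by simp
    qed
    then have "P (int k) x = \<zero>\<^bsub>V\<^esub>" using P0 that by blast
    then show ?case using Suc FV[OF that(1)] module_closed[OF V] by (simp add: R_Suc)
  qed (simp add: R_0)
  \<comment> \<open>For negative \<open>p\<close> the value \<open>nat p = 0\<close> is harmless:
    the remainder is \<open>x\<close> itself, which lies in \<open>F p\<close>, and the target
    module is trivial.\<close>
  define \<Psi> where "\<Psi> x = (\<lambda>(p, q)\<in>{(p, q). p + q = i}. \<pi> p (R (nat p) x))" for x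
  have Rnat: "R (nat p) x \<in> F p" if "x \<in> carrier V" for p x
    using RF[OF that, of "nat p"] top[of p] that by (cases "p \<ge> 0") (auto simp: R_0)
  let ?S = "direct_sum {(p, q). p + q = i} (\<lambda>(p, q). E p q)"
  have \<Psi>_car: "\<Psi> x \<in> carrier ?S" if "x \<in> carrier V" for x
  proof -
    have mem: "\<pi> p (R (nat p) x) \<in> carrier (E p q)" if "p + q = i" for p q
      using \<pi>E[OF Rnat[OF \<open>x \<in> carrier V\<close>, of p]] that by (auto simp: algebra_simps)
    have "{a \<in> {(p, q). p + q = i}. \<Psi> x a \<noteq> \<zero>\<^bsub>(case a of (p, q) \<Rightarrow> E p q)\<^esub>} \<subseteq>
        (\<lambda>p. (p, i - p)) ` {0..int n}"
    proof
      fix a assume a: "a \<in> {a \<in> {(p, q). p + q = i}. \<Psi> x a \<noteq> \<zero>\<^bsub>(case a of (p, q) \<Rightarrow> E p q)\<^esub>}"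
      then obtain p where p: "a = (p, i - p)" by (cases a) (auto simp: algebra_simps)
      then have "\<pi> p (R (nat p) x) \<noteq> \<zero>\<^bsub>E p (i - p)\<^esub>" using a by (auto simp: \<Psi>_def)
      then have "\<not> (p < 0 \<or> p > int n)" using trivial[of p] mem[of p "i - p"] by auto
      then show "a \<in> (\<lambda>p. (p, i - p)) ` {0..int n}" using p by auto
    qed
    then have "finite {a \<in> {(p, q). p + q = i}. \<Psi> x a \<noteq> \<zero>\<^bsub>(case a of (p, q) \<Rightarrow> E p q)\<^esub>}"
      by (rule finite_subset) auto
    then show ?thesis using mem by (auto simp: direct_sum_def \<Psi>_def)
  qed
  have "\<Psi> \<in> lin_maps V ?S"
  proof (rule lin_mapsI)
    fix x y assume xy: "x \<in> carrier V" "y \<in> carrier V"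
    have "\<pi> p (R (nat p) (x \<oplus>\<^bsub>V\<^esub> y)) = \<pi> p (R (nat p) x) \<oplus>\<^bsub>E p q\<^esub> \<pi> p (R (nat p) y)" if "p + q = i" for p q
      using \<pi>add[OF Rnat[OF xy(1)] Rnat[OF xy(2)], of p] Radd[OF xy] that by (auto simp: algebra_simps)
    then show "\<Psi> (x \<oplus>\<^bsub>V\<^esub> y) = \<Psi> x \<oplus>\<^bsub>?S\<^esub> \<Psi> y"
      by (auto simp: direct_sum_def \<Psi>_def fun_eq_iff)
  next
    fix a x assume x: "x \<in> carrier V"
    have "\<pi> p (R (nat p) (a \<odot>\<^bsub>V\<^esub> x)) = a \<odot>\<^bsub>E p q\<^esub> \<pi> p (R (nat p) x)" if "p + q = i" for p q
      using \<pi>sm[OF Rnat[OF x], of p] Rsm[OF x] that by (auto simp: algebra_simps)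
    then show "\<Psi> (a \<odot>\<^bsub>V\<^esub> x) = a \<odot>\<^bsub>?S\<^esub> \<Psi> x"
      by (auto simp: direct_sum_def \<Psi>_def fun_eq_iff)
  qed (rule \<Psi>_car)
  moreover have "inj_on \<Psi> (carrier V)"
  proof (rule inj_onI)
    fix x y assume xy: "x \<in> carrier V" "y \<in> carrier V" and eq: "\<Psi> x = \<Psi> y"
    define d where "d = x \<oplus>\<^bsub>V\<^esub> (- 1) \<odot>\<^bsub>V\<^esub> y"
    have d: "d \<in> carrier V" using xy by (simp add: d_def)
    have "\<pi> (int k) (R k d) = \<zero>\<^bsub>E (int k) (i - int k)\<^esub>" for k
    proof -
      let ?p = "int k"
      interpret E: module real_ring "E ?p (i - ?p)" by (rule qp(2))
      have "\<pi> ?p (R k x) = \<pi> ?p (R k y)"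
        using fun_cong[OF eq, of "(?p, i - ?p)"] by (simp add: \<Psi>_def)
      moreover have "\<pi> ?p (R k d) = \<pi> ?p (R k x) \<oplus>\<^bsub>E ?p (i - ?p)\<^esub> (- 1) \<odot>\<^bsub>E ?p (i - ?p)\<^esub> \<pi> ?p (R k y)"
        using xy RF[OF xy(1), of k] RF[OF xy(2), of k] sF(4)
        by (simp add: d_def Radd Rsm \<pi>add \<pi>sm)
      ultimately show ?thesis
        using \<pi>E[OF RF[OF xy(2), of k]] module_minus_eq[OF qp(2)] E.M.r_neg by metis
    qed
    then have P_R: "P (int k) (R k d) = \<zero>\<^bsub>V\<^esub>" for k by (simp add: P_def s0)
    \<comment> \<open>With all components zero nothing is ever removed, so \<open>d\<close> equals
      its last remainder, which lies in the zero space \<open>F (n + 1)\<close>.\<close>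
    have "R k d = d" for k
    proof (induction k)
      case (Suc k)
      have "R (Suc k) d = R k d" using FV[OF RF[OF d]] module_closed[OF V] by (simp add: R_Suc P_R)
      then show ?case using Suc by simp
    qed (simp add: R_0)
    then have "d = \<zero>\<^bsub>V\<^esub>" using RF[OF d, of "Suc n"] bot[of "int (Suc n)"] by simp
    then have "x \<oplus>\<^bsub>V\<^esub> \<ominus>\<^bsub>V\<^esub> y = \<zero>\<^bsub>V\<^esub>" using module_minus_eq[OF V xy(2)] by (simp add: d_def)
    then show "x = y" using xy V.M.minus_equality V.M.minus_minus by (metis V.M.a_inv_closed V.M.a_comm)
  qed
  moreover have "carrier ?S \<subseteq> \<Psi> ` carrier V"
  proof
    fix f assume f: "f \<in> carrier ?S"
    have fE: "f (p, i - p) \<in> carrier (E p (i - p))" for p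
      using f by (fastforce simp: direct_sum_def PiE_iff)
    \<comment> \<open>Surjectivity by downward induction: a preimage with the right components from
      some index on is corrected by one vector to match the component just below. It starts from
      zero in \<open>F (n + 1)\<close>, where nothing is prescribed.\<close>
    have "\<exists>y\<in>F (int (Suc n - j)). \<forall>m. Suc n - j \<le> m \<and> m \<le> n \<longrightarrow>
        \<pi> (int m) (R m y) = f (int m, i - int m)" if "j \<le> Suc n" for j
      using that
    proof (induction j)
      case 0
      show ?case by (rule bexI[OF _ sF(2)]) auto
    next
      case (Suc j)
      define k where "k = Suc n - Suc j"
      have Sk: "Suc n - j = Suc k" using Suc.prems by (simp add: k_def)
      obtain z where z: "z \<in> F (int (Suc k))"
        "\<And>m. \<lbrakk>Suc k \<le> m; m \<le> n\<rbrakk> \<Longrightarrow> \<pi> (int m) (R m z) = f (int m, i - int m)"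
        using Suc unfolding Sk by auto
      have zk: "z \<in> F (int k)" using z(1) Fmono[of "int k"] by (auto simp: add.commute)
      define w where "w = s (int k) (f (int k, i - int k))"
      have w: "w \<in> F (int k)" using sF'[OF fE] by (simp add: w_def)
      have \<pi>w: "\<pi> (int k) w = f (int k, i - int k)" using s(2)[OF fE] by (simp add: w_def)
      \<comment> \<open>The vector \<open>w\<close> is its own \<open>P\<close>-part in degree
        \<open>k\<close>, so it is used up at that stage and leaves the higher components of
        \<open>z\<close> untouched.\<close>
      have Rw: "R m w = \<zero>\<^bsub>V\<^esub>" if "Suc k \<le> m" for m
        using that
      proof (induction m rule: dec_induct)
        case base
        have "R (Suc k) w = w \<oplus>\<^bsub>V\<^esub> (- 1) \<odot>\<^bsub>V\<^esub> w"
          using R_id[OF w, of k] \<pi>w by (simp add: R_Suc P_def w_def)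
        then show ?case using V.M.r_neg[OF FV[OF w]] module_minus_eq[OF V FV[OF w]] by simp
      next
        case (step m)
        then show ?case
          using P0[OF sF(2), of "int m"] module_closed[OF V] by (simp add: R_Suc)
      qed
      have "\<pi> (int m) (R m (z \<oplus>\<^bsub>V\<^esub> w)) = f (int m, i - int m)" if m: "k \<le> m" "m \<le> n" for m
      proof (cases "m = k")
        case True
        have "R k (z \<oplus>\<^bsub>V\<^esub> w) = z \<oplus>\<^bsub>V\<^esub> w" using R_id[OF sF(3)[OF zk w]] by simp
        moreover have "\<pi> (int k) z = \<zero>\<^bsub>E (int k) (i - int k)\<^esub>"
          using \<pi>0[OF zk] z(1) by (simp add: add.commute)
        ultimately show ?thesis
          using True zk w \<pi>w fE module_closed(5)[OF qp(2)] by (simp add: \<pi>add)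
      next
        case False
        then have "R m (z \<oplus>\<^bsub>V\<^esub> w) = R m z"
          using Rw[of m] m Radd[of z w m] FV[OF zk] FV[OF w] FV[OF RF[OF FV[OF zk], of m]] by simp
        then show ?thesis using z(2)[of m] False m by simp
      qed
      then show ?case using sF(3)[OF zk w] unfolding k_def[symmetric] by auto
    qed
    from this[of "Suc n"] obtain y where y: "y \<in> F 0"
      "\<And>m. m \<le> n \<Longrightarrow> \<pi> (int m) (R m y) = f (int m, i - int m)" by auto
    have "\<pi> p (R (nat p) y) = f (p, i - p)" for p
    proof (cases "0 \<le> p \<and> p \<le> int n")
      case True
      then show ?thesis using y(2)[of "nat p"] by (simp add: nat_le_iff)
    next
      case False
      then have "carrier (E p (i - p)) = {\<zero>\<^bsub>E p (i - p)\<^esub>}" using trivial[of p] by auto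
      then show ?thesis using \<pi>E[OF Rnat[OF FV[OF y(1)], of p]] fE[of p] by auto
    qed
    then have "\<Psi> y a = f a" for a
    proof (cases "a \<in> {(p, q). p + q = i}")
      case True
      then obtain p where "a = (p, i - p)" by (cases a) (auto simp: algebra_simps)
      then show ?thesis using \<open>\<And>p. \<pi> p (R (nat p) y) = f (p, i - p)\<close> by (simp add: \<Psi>_def)
    next
      case False
      have "f \<in> (\<Pi>\<^sub>E a\<in>{(p, q). p + q = i}. carrier (case a of (p, q) \<Rightarrow> E p q))"
        using f by (simp add: direct_sum_def)
      from PiE_arb[OF this False] show ?thesis using False by (simp only: \<Psi>_def restrict_apply if_False)
    qed
    then have "f = \<Psi> y" by auto
    then show "f \<in> \<Psi> ` carrier V" using FV[OF y(1)] by blast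
  qed
  ultimately have "\<Psi> \<in> lin_isos V ?S"
    using \<Psi>_car by (auto simp: lin_isos_def bij_betw_def)
  then show ?thesis using lin_isomorphic_sym[of V ?S] V by (auto simp: lin_isomorphic_def)
qed

section \<open>The sequence of derived couples\<close>

definition transport_module :: "('x \<Rightarrow> 'y) \<Rightarrow> (real, 'x) module \<Rightarrow> (real, 'y) module" where
  "transport_module \<phi> M = (let \<psi> = inv_into (carrier M) \<phi> in
     \<lparr>carrier = \<phi> ` carrier M, mult = undefined, one = undefined, zero = \<phi> \<zero>\<^bsub>M\<^esub>,
      add = (\<lambda>x y. \<phi> (\<psi> x \<oplus>\<^bsub>M\<^esub> \<psi> y)), smult = (\<lambda>a x. \<phi> (a \<odot>\<^bsub>M\<^esub> \<psi> x))\<rparr>)"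

lemma transport_module:
  assumes M: "module real_ring M" and inj: "inj_on \<phi> (carrier M)"
  shows "module real_ring (transport_module \<phi> M)" and "\<phi> \<in> lin_isos M (transport_module \<phi> M)"
    and "\<zero>\<^bsub>transport_module \<phi> M\<^esub> = \<phi> \<zero>\<^bsub>M\<^esub>"
proof -
  interpret M: module real_ring M by fact
  let ?N = "transport_module \<phi> M"
  have car: "carrier ?N = \<phi> ` carrier M" by (simp add: transport_module_def Let_def)
  show zero: "\<zero>\<^bsub>?N\<^esub> = \<phi> \<zero>\<^bsub>M\<^esub>" by (simp add: transport_module_def Let_def)
  have add: "\<phi> x \<oplus>\<^bsub>?N\<^esub> \<phi> y = \<phi> (x \<oplus>\<^bsub>M\<^esub> y)" if "x \<in> carrier M" "y \<in> carrier M" for x y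
    using that inj by (simp add: transport_module_def Let_def)
  have sm: "a \<odot>\<^bsub>?N\<^esub> \<phi> x = \<phi> (a \<odot>\<^bsub>M\<^esub> x)" if "x \<in> carrier M" for a x
    using that inj by (simp add: transport_module_def Let_def)
  show "module real_ring ?N"
    by (rule real_moduleI)
      (use M.smult_l_distr M.smult_r_distr M.smult_assoc1 M.smult_one M.smult_l_null in
       \<open>auto simp: car add sm zero M.M.a_ac\<close>)
  show "\<phi> \<in> lin_isos M ?N"
    using inj by (auto simp: lin_isos_def bij_betw_def car add sm intro!: lin_mapsI)
qed

text \<open>The stage \<open>r\<close> is a parameter because it determines the position of the
  values of \<open>jmap\<close>, hence the component of \<open>\<phi>\<close> to be applied to
  them.\<close>

definition transport_couple ::
  "nat \<Rightarrow> (int \<Rightarrow> int \<Rightarrow> 'e \<Rightarrow> 'f) \<Rightarrow> ('d, 'e) couple \<Rightarrow> ('d, 'f) couple" where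
  "transport_couple r \<phi> C =
     \<lparr>dobj = dobj C, eobj = (\<lambda>p q. transport_module (\<phi> p q) (eobj C p q)), imap = imap C,
      jmap = (\<lambda>p q x. \<phi> (p + int r - 1) (q - int r + 1) (jmap C p q x)),
      kmap = (\<lambda>p q x. kmap C p q (inv_into (carrier (eobj C p q)) (\<phi> p q) x))\<rparr>"

lemma exact_transport_couple:
  assumes C: "exact_couple r C" and inj: "\<And>p q. inj_on (\<phi> p q) (carrier (eobj C p q))"
  shows "exact_couple r (transport_couple r \<phi> C)"
proof -
  interpret exact_couple_at r C by unfold_locales (rule C)
  let ?T = "transport_couple r \<phi> C"
  note tm = transport_module[OF E_module inj]
  have \<phi>: "\<phi> p q \<in> lin_isos (E p q) (eobj ?T p q)" for p q
    using tm(2) by (simp add: transport_couple_def)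
  then have \<phi>l: "\<phi> p q \<in> lin_maps (E p q) (eobj ?T p q)" for p q by (simp add: lin_isos_def)
  have car: "carrier (eobj ?T p q) = \<phi> p q ` carrier (E p q)" for p q
    using \<phi> by (auto simp: lin_isos_def bij_betw_def)
  have inv: "inv_into (carrier (E p q)) (\<phi> p q) \<in> lin_maps (eobj ?T p q) (E p q)" for p q
    using lin_isos_inv[OF \<phi> E_module] by (simp add: lin_isos_def)
  have \<phi>0: "\<phi> p q x = \<zero>\<^bsub>eobj ?T p q\<^esub> \<longleftrightarrow> x = \<zero>\<^bsub>E p q\<^esub>" if "x \<in> carrier (E p q)" for p q x
    using tm(3) inj[THEN inj_onD, of p q x "\<zero>\<^bsub>E p q\<^esub>"] module_closed(1)[OF E_module] that
    by (auto simp: transport_couple_def)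
  have inv\<phi>: "inv_into (carrier (E p q)) (\<phi> p q) (\<phi> p q x) = x" if "x \<in> carrier (E p q)" for p q x
    using inj that by simp
  have jE: "jmap C p q x \<in> carrier (E (p + int r - 1) (q - int r + 1))" if "x \<in> carrier (D p q)" for p q x
    by (rule lin_mapsD(1)[OF jmap_lin that]) auto
  have d: "dobj ?T = D" "imap ?T = imap C"
    "jmap ?T = (\<lambda>p q x. \<phi> (p + int r - 1) (q - int r + 1) (jmap C p q x))"
    "kmap ?T = (\<lambda>p q x. kmap C p q (inv_into (carrier (E p q)) (\<phi> p q) x))"
    by (simp_all add: transport_couple_def)
  show ?thesis
    unfolding exact_couple_def
  proof (intro allI conjI)
    fix p q
    show "module real_ring (dobj ?T p q)" using D_module by (simp add: d)
    show "module real_ring (eobj ?T p q)" using tm(1) by (simp add: transport_couple_def)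
    show "imap ?T p q \<in> lin_maps (dobj ?T p q) (dobj ?T (p - 1) (q + 1))"
      unfolding d by (rule imap_lin) auto
    show "jmap ?T p q \<in> lin_maps (dobj ?T p q) (eobj ?T (p + int r - 1) (q - int r + 1))"
      unfolding d by (rule lin_map_comp[OF jmap_lin \<phi>l]) auto
    show "kmap ?T p q \<in> lin_maps (eobj ?T p q) (dobj ?T (p + 1) q)"
      unfolding d by (rule lin_map_comp[OF inv kmap_lin]) auto
    have "imap C (p + 1) (q - 1) ` carrier (D (p + 1) (q - 1)) =
        {x \<in> carrier (D p q). jmap C p q x = \<zero>\<^bsub>E (p + int r - 1) (q - int r + 1)\<^esub>}"
      using exact by (simp add: exact_couple_def)
    then show "imap ?T (p + 1) (q - 1) ` carrier (dobj ?T (p + 1) (q - 1)) =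
        {x \<in> carrier (dobj ?T p q). jmap ?T p q x = \<zero>\<^bsub>eobj ?T (p + int r - 1) (q - int r + 1)\<^esub>}"
      unfolding d using \<phi>0[OF jE] by auto
    have "jmap C (p - int r + 1) (q + int r - 1) ` carrier (D (p - int r + 1) (q + int r - 1)) =
        {x \<in> carrier (E p q). kmap C p q x = \<zero>\<^bsub>D (p + 1) q\<^esub>}"
      using exact by (simp add: exact_couple_def)
    then have "\<phi> p q ` jmap C (p - int r + 1) (q + int r - 1) `
        carrier (D (p - int r + 1) (q + int r - 1)) =
        {x \<in> carrier (eobj ?T p q). kmap ?T p q x = \<zero>\<^bsub>D (p + 1) q\<^esub>}"
      unfolding car d by (auto simp: inv\<phi>)
    then show "jmap ?T (p - int r + 1) (q + int r - 1) `
          carrier (dobj ?T (p - int r + 1) (q + int r - 1)) =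
        {x \<in> carrier (eobj ?T p q). kmap ?T p q x = \<zero>\<^bsub>dobj ?T (p + 1) q\<^esub>}"
      by (simp add: d image_image)
    have "kmap C (p - 1) q ` carrier (E (p - 1) q) =
        {x \<in> carrier (D p q). imap C p q x = \<zero>\<^bsub>D (p - 1) (q + 1)\<^esub>}"
      using exact by (simp add: exact_couple_def)
    moreover have "kmap ?T (p - 1) q ` carrier (eobj ?T (p - 1) q) = kmap C (p - 1) q ` carrier (E (p - 1) q)"
      unfolding car d image_image by (rule image_cong) (auto simp: inv\<phi>)
    ultimately show "kmap ?T (p - 1) q ` carrier (eobj ?T (p - 1) q) =
        {x \<in> carrier (dobj ?T p q). imap ?T p q x = \<zero>\<^bsub>dobj ?T (p - 1) (q + 1)\<^esub>}"
      by (simp add: d)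
  qed
qed

text \<open>Every coset is replaced by a chosen representative, so that all pages have the same type.\<close>

definition next_couple :: "nat \<Rightarrow> ('d, 'e) couple \<Rightarrow> ('d, 'e) couple" where
  "next_couple r C = transport_couple (Suc r) (\<lambda>p q S. SOME x. x \<in> S) (derived_couple r C)"

text \<open>A coset is recovered from any one of its elements as the coset of that element.\<close>

lemma (in exact_couple_at) inj_on_representative:
  "inj_on (\<lambda>S. SOME x. x \<in> S) (carrier (eobj C' p q))"
proof (rule inj_onI)
  have *: "S = B p q +>\<^bsub>E p q\<^esub> (SOME x. x \<in> S)" if "S \<in> carrier (eobj C' p q)" for S
  proof -
    obtain b where b: "b \<in> carrier (Z p q)" "S = B p q +>\<^bsub>E p q\<^esub> b"
      using derived_eobj_obtain[OF \<open>S \<in> carrier (eobj C' p q)\<close>] .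
    have bE: "b \<in> carrier (E p q)" by (rule Z_subset[OF b(1)])
    define x where "x = (SOME x. x \<in> S)"
    have "x \<in> S" unfolding x_def
      by (rule someI[of _ b]) (use coset_self[OF E_module B_submodule bE] b(2) in auto)
    then obtain h where h: "h \<in> B p q" "x = h \<oplus>\<^bsub>E p q\<^esub> b"
      by (auto simp: b(2) a_r_coset_def')
    have "x \<in> carrier (E p q)"
      using h(2) module_closed(2)[OF E_module subsetD[OF submodule_real(1)[OF B_submodule] h(1)] bE] by simp
    then have "B p q +>\<^bsub>E p q\<^esub> x = B p q +>\<^bsub>E p q\<^esub> b"
      using coset_eq_iff[OF E_module B_submodule _ bE] h by auto
    then show ?thesis using b(2) by (simp add: x_def)
  qed
  fix S U assume "S \<in> carrier (eobj C' p q)" "U \<in> carrier (eobj C' p q)"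
    "(SOME x. x \<in> S) = (SOME x. x \<in> U)"
  then show "S = U" using * by metis
qed

lemma next_couple:
  assumes "exact_couple r C"
  shows "exact_couple (Suc r) (next_couple r C)" and "is_derived_couple r C (next_couple r C)"
proof -
  interpret exact_couple_at r C by unfold_locales (rule assms)
  show "exact_couple (Suc r) (next_couple r C)"
    unfolding next_couple_def by (rule exact_transport_couple[OF exact_derived_couple inj_on_representative])
  let ?\<phi> = "\<lambda>(p::int) (q::int) S. SOME x. x \<in> S"
  have iso: "?\<phi> p q \<in> lin_isos (eobj C' p q) (eobj (next_couple r C) p q)" for p q
    using transport_module(2)[OF quotient_projD(2)[OF derived_quotient] inj_on_representative]
    by (simp add: next_couple_def transport_couple_def)
  have k: "kmap (next_couple r C) p q (SOME x. x \<in> \<xi>) = kmap C' p q \<xi>"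
    if "\<xi> \<in> carrier (eobj C' p q)" for p q \<xi>
    using inv_into_f_f[OF inj_on_representative that] by (simp add: next_couple_def transport_couple_def)
  show "is_derived_couple r C (next_couple r C)"
    unfolding is_derived_couple_def
    by (intro conjI exI[of _ ?\<phi>] allI ballI iso k)
      (simp_all add: next_couple_def transport_couple_def)
qed

text \<open>Couples are counted from 1; the entry at index 0 is a filler.\<close>

primrec couple_seq :: "('d, 'e) couple \<Rightarrow> nat \<Rightarrow> ('d, 'e) couple" where
  "couple_seq C 0 = C"
| "couple_seq C (Suc n) = (if n = 0 then C else next_couple n (couple_seq C n))"

lemma derived_couples_exist:
  assumes "exact_couple 1 C"
  shows "\<exists>S. derived_couples C S"
proof
  have "exact_couple (Suc n) (couple_seq C (Suc n))" for n
    using assms next_couple(1) by (induction n) auto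
  then have ex: "exact_couple r (couple_seq C r)" if "r \<ge> 1" for r using that by (cases r) auto
  then show "derived_couples C (couple_seq C)"
    using next_couple(2)[OF ex] by (auto simp: derived_couples_def)
qed

lemma derived_couples_spectral_sequence:
  assumes "derived_couples C\<^sub>1 C"
  shows "spectral_sequence (\<lambda>r. eobj (C r)) (\<lambda>r. couple_diff (C r))"
  unfolding spectral_sequence_def
proof (intro allI impI)
  fix r p q assume "1 \<le> (r::nat)"
  then interpret exact_couple_at r "C r"
    using assms by unfold_locales (auto simp: derived_couples_def)
  have "lin_isomorphic (eobj C' p q) (eobj (C (Suc r)) p q)"
    using assms \<open>1 \<le> r\<close> by (fastforce simp: derived_couples_def is_derived_couple_def lin_isomorphic_def)
  then have iso: "lin_isomorphic (page_homology r E (couple_diff (C r)) p q) (eobj (C (Suc r)) p q)"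
    by (simp add: derived_couple_def)
  show "module real_ring (E p q) \<and>
       couple_diff (C r) p q \<in> lin_maps (E p q) (E (p + int r) (q + 1 - int r)) \<and>
       (\<forall>x\<in>carrier (E p q). couple_diff (C r) (p + int r) (q + 1 - int r) (couple_diff (C r) p q x) =
          \<zero>\<^bsub>E (p + 2 * int r) (q + 2 - 2 * int r)\<^esub>) \<and>
       lin_isomorphic (page_homology r E (couple_diff (C r)) p q) (eobj (C (Suc r)) p q)"
    using E_module iso by (auto intro!: diff_lin diff_diff)
qed

section \<open>Convergence of a bounded exact couple\<close>

text \<open>The \<open>D\<close> terms vanish for \<open>p > n\<close> and are constant, with value \<open>V (p + q)\<close>, for \<open>p \<le> 0\<close>;
  \<open>aug p q\<close> is the map of \<open>D\<^sup>p\<^sup>,\<^sup>q\<close> to this constant value.\<close>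

locale bounded_couple =
  fixes C\<^sub>1 :: "('d, 'e) couple" and C :: "nat \<Rightarrow> ('d, 'e) couple"
    and n :: nat and V :: "int \<Rightarrow> (real, 'd) module" and aug :: "int \<Rightarrow> int \<Rightarrow> 'd \<Rightarrow> 'd"
  assumes seq: "derived_couples C\<^sub>1 C"
    and vanish: "p > int n \<Longrightarrow> carrier (dobj C\<^sub>1 p q) = {\<zero>\<^bsub>dobj C\<^sub>1 p q\<^esub>}"
    and const: "p \<le> 0 \<Longrightarrow> dobj C\<^sub>1 p q = V (p + q)"
    and imap_id: "\<lbrakk>p \<le> 0; x \<in> carrier (dobj C\<^sub>1 p q)\<rbrakk> \<Longrightarrow> imap C\<^sub>1 p q x = x"
    and aug_id: "\<lbrakk>p \<le> 0; x \<in> carrier (dobj C\<^sub>1 p q)\<rbrakk> \<Longrightarrow> aug p q x = x"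
    and aug_imap: "x \<in> carrier (dobj C\<^sub>1 p q) \<Longrightarrow> aug (p - 1) (q + 1) (imap C\<^sub>1 p q x) = aug p q x"
begin

lemma exact_at: "r \<ge> 1 \<Longrightarrow> exact_couple_at r (C r)"
  using seq by unfold_locales (auto simp: derived_couples_def)

lemma C_1: "C 1 = C\<^sub>1" using seq by (simp add: derived_couples_def)

lemma derived: "r \<ge> 1 \<Longrightarrow> is_derived_couple r (C r) (C (Suc r))"
  using seq by (simp add: derived_couples_def)

abbreviation D\<^sub>1 where "D\<^sub>1 \<equiv> dobj C\<^sub>1"

lemma D1_module: "module real_ring (D\<^sub>1 p q)"
  using exact_couple_at.D_module[OF exact_at[of 1]] by (simp add: C_1[simplified])

lemma imap1_lin: "\<lbrakk>p' = p - 1; q' = q + 1\<rbrakk> \<Longrightarrow> imap C\<^sub>1 p q \<in> lin_maps (D\<^sub>1 p q) (D\<^sub>1 p' q')"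
  using exact_couple_at.imap_lin[OF exact_at[of 1]] by (simp add: C_1[simplified])

text \<open>The image of the \<open>s\<close>-fold composite of the first \<open>i\<close>. By
  \<open>dobj_C\<close> it is the carrier of the \<open>D\<close> term with index
  \<open>s + 1\<close>, one more than the number of maps.\<close>

primrec im :: "nat \<Rightarrow> int \<Rightarrow> int \<Rightarrow> 'd set" where
  "im 0 p q = carrier (D\<^sub>1 p q)"
| "im (Suc s) p q = imap C\<^sub>1 (p + 1) (q - 1) ` im s (p + 1) (q - 1)"

lemma im_subset: "im s p q \<subseteq> carrier (D\<^sub>1 p q)"
proof (induction s arbitrary: p q)
  case (Suc s)
  have "imap C\<^sub>1 (p + 1) (q - 1) \<in> lin_maps (D\<^sub>1 (p + 1) (q - 1)) (D\<^sub>1 p q)"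
    by (rule imap1_lin) auto
  from lin_mapsD(1)[OF this] Suc[of "p + 1" "q - 1"] show ?case by auto
qed simp

text \<open>The two claims need each other: \<open>is_derived_couple\<close> prescribes
  \<open>imap\<close> only on the derived carrier. The next carrier is rewritten with the second
  claim, and the second claim needs the carriers to know where it applies.\<close>

lemma dobj_C: "dobj (C (Suc s)) p q = (D\<^sub>1 p q)\<lparr>carrier := im s p q\<rparr>"
  and imap_C: "x \<in> im s p q \<Longrightarrow> imap (C (Suc s)) p q x = imap C\<^sub>1 p q x"
proof (induction s arbitrary: p q x)
  case 0
  { case 1 then show ?case using C_1 by simp }
  { case 2 then show ?case using C_1 by simp }
next
  case (Suc s)
  have der: "is_derived_couple (Suc s) (C (Suc s)) (C (Suc (Suc s)))" by (rule derived) simp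
  have d: "dobj (C (Suc (Suc s))) p q = (dobj (C (Suc s)) p q)
      \<lparr>carrier := imap (C (Suc s)) (p + 1) (q - 1) ` carrier (dobj (C (Suc s)) (p + 1) (q - 1))\<rparr>" for p q
    using der by (simp add: is_derived_couple_def derived_couple_def)
  have dS: "dobj (C (Suc (Suc s))) p q = (D\<^sub>1 p q)\<lparr>carrier := im (Suc s) p q\<rparr>" for p q
    unfolding d using Suc.IH(1)[of p q] Suc.IH(1)[of "p + 1" "q - 1"] Suc.IH(2) by (simp cong: image_cong)
  { case 1 show ?case by (rule dS) }
  { case 2
    then have x: "x \<in> carrier (dobj (C (Suc (Suc s))) p q)" by (simp add: dS)
    then have "x \<in> carrier (dobj (derived_couple (Suc s) (C (Suc s))) p q)"
      using der by (simp add: is_derived_couple_def)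
    then have "x \<in> carrier (dobj (C (Suc s)) p q)"
      using submodule_real(1)[OF exact_couple_at.derived_dobj_submodule[OF exact_at]] by fastforce
    then have "x \<in> im s p q" by (simp add: Suc.IH(1))
    moreover have "imap (C (Suc (Suc s))) p q x = imap (C (Suc s)) p q x"
      using der x by (simp add: is_derived_couple_def derived_couple_def)
    ultimately show ?case using Suc.IH(2) by simp }
qed

lemma im_vanish:
  assumes "p + int s > int n" shows "im s p q = {\<zero>\<^bsub>D\<^sub>1 p q\<^esub>}"
  using assms
proof (induction s arbitrary: p q)
  case 0 then show ?case using vanish by simp
next
  case (Suc s)
  have "imap C\<^sub>1 (p + 1) (q - 1) \<in> lin_maps (D\<^sub>1 (p + 1) (q - 1)) (D\<^sub>1 p q)"
    by (rule imap1_lin) auto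
  then show ?case using Suc.IH[of "p + 1" "q - 1"] Suc.prems lin_map_zero[OF D1_module D1_module] by simp
qed

section \<open>The limiting filtration and the stable pages\<close>

definition filt :: "int \<Rightarrow> int \<Rightarrow> 'd set" where
  "filt p i = aug p (i - p) ` carrier (D\<^sub>1 p (i - p))"

text \<open>Since \<open>aug\<close> is invariant under \<open>i\<close>, it sends an
  \<open>s\<close>-fold image to the augmentation of the starting term at \<open>p + s\<close>; for
  \<open>p \<le> 0\<close> it is the identity.\<close>

lemma im_filt:
  assumes "p \<le> 0" shows "im s p q = filt (p + int s) (p + q)"
proof -
  have *: "aug p q ` im s p q = aug (p + int s) (q - int s) ` carrier (D\<^sub>1 (p + int s) (q - int s))" for p q
  proof (induction s arbitrary: p q)
    case (Suc s)
    have "aug p q ` im (Suc s) p q = aug (p + 1) (q - 1) ` im s (p + 1) (q - 1)"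
      using aug_imap[of _ "p + 1" "q - 1"] im_subset[of s "p + 1" "q - 1"]
      by (simp add: image_image cong: image_cong) (rule image_cong, auto)
    then show ?case using Suc[of "p + 1" "q - 1"] by (simp add: algebra_simps)
  qed simp
  have "aug p q ` im s p q = im s p q"
    using aug_id[OF assms] im_subset[of s p q] by force
  then show ?thesis using *[of p q] by (simp add: filt_def algebra_simps)
qed

lemma V_module: "module real_ring (V i)"
  using D1_module[of 0 i] const[of 0 i] by simp

lemma filt_nonpos: "p \<le> 0 \<Longrightarrow> filt p i = carrier (V i)"
  using im_filt[of p 0 "i - p"] const[of p "i - p"] by simp

lemma filt_top: "p > int n \<Longrightarrow> filt p i = {\<zero>\<^bsub>V i\<^esub>}"
  using im_filt[of 0 "nat p" i] im_vanish[of 0 "nat p" i] const[of 0 i] by simp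

text \<open>Read off from the module structure of a \<open>D\<close> term: the filtration step is
  its carrier at position \<open>(0, i)\<close>. For negative \<open>p\<close> the index
  \<open>nat p = 0\<close> gives the whole space, which is the right value.\<close>

lemma filt_submodule: "submodule (filt p i) real_ring (V i)"
proof -
  interpret exact_couple_at "Suc (nat p)" "C (Suc (nat p))" by (rule exact_at) simp
  have "module real_ring ((V i)\<lparr>carrier := im (nat p) 0 i\<rparr>)"
    using D_module[of 0 i] dobj_C[of "nat p" 0 i] const[of 0 i] by simp
  then have "submodule (im (nat p) 0 i) real_ring (V i)"
    using module.module_incl_imp_submodule[OF V_module] im_subset[of "nat p" 0 i] const[of 0 i] by simp
  moreover have "im (nat p) 0 i = filt p i"
    using im_filt[of 0 "nat p" i] filt_nonpos[of p i] filt_nonpos[of 0 i] by (cases "p \<ge> 0") auto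
  ultimately show ?thesis by simp
qed

abbreviation Er where "Er \<equiv> \<lambda>r. eobj (C r)"
abbreviation dr where "dr \<equiv> \<lambda>r. couple_diff (C r)"

lemma kmap_vanish:
  assumes "r \<ge> 1" "p + int r > int n" "x \<in> carrier (Er r p q)"
  shows "kmap (C r) p q x = \<zero>\<^bsub>dobj (C r) (p + 1) q\<^esub>"
proof -
  interpret exact_couple_at r "C r" by (rule exact_at[OF assms(1)])
  \<comment> \<open>The \<open>D\<close> term of page \<open>r\<close> is an
    \<open>(r - 1)\<close>-fold image, so the relevant index is
    \<open>p + 1 + (r - 1) = p + r\<close>.\<close>
  have "im (r - 1) (p + 1) q = {\<zero>\<^bsub>D\<^sub>1 (p + 1) q\<^esub>}"
    by (rule im_vanish) (use assms in \<open>auto simp: of_nat_diff\<close>)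
  then show ?thesis
    using lin_mapsD(1)[OF kmap_lin[OF refl] assms(3)] dobj_C[of "r - 1" "p + 1" q] assms(1) by simp
qed

text \<open>For \<open>p < 0\<close> the map \<open>i\<close> leaving the target of \<open>k\<close>
  is the identity, and \<open>i k = 0\<close>.\<close>

lemma kmap_vanish_nonpos:
  assumes "r \<ge> 1" "p < 0" "x \<in> carrier (Er r p q)"
  shows "kmap (C r) p q x = \<zero>\<^bsub>dobj (C r) (p + 1) q\<^esub>"
proof -
  interpret exact_couple_at r "C r" by (rule exact_at[OF assms(1)])
  let ?k = "kmap (C r) p q x"
  have k: "?k \<in> carrier (D (p + 1) q)" using lin_mapsD(1)[OF kmap_lin[OF refl] assms(3)] .
  then have k1: "?k \<in> im (r - 1) (p + 1) q" using dobj_C[of "r - 1" "p + 1" q] assms(1) by simp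
  then have "imap (C r) (p + 1) q ?k = ?k"
    using imap_C[OF k1] imap_id[of "p + 1" ?k q] im_subset[of "r - 1" "p + 1" q] assms by auto
  moreover have "imap (C r) (p + 1) q ?k = \<zero>\<^bsub>D p (q + 1)\<^esub>"
    using imap_zero_iff[of p "p + 1" "q + 1" q, OF _ _ k] assms(3) by auto
  moreover have "\<zero>\<^bsub>D p (q + 1)\<^esub> = \<zero>\<^bsub>D (p + 1) q\<^esub>"
    using dobj_C[of "r - 1"] const[of p "q + 1"] const[of "p + 1" q] assms by (simp add: algebra_simps)
  ultimately show ?thesis by simp
qed

lemma diff_vanish:
  assumes "r \<ge> 1" "p + int r > int n \<or> p < 0" "x \<in> carrier (Er r p q)" "p' = p + int r" "q' = q - int r + 1"
  shows "dr r p q x = \<zero>\<^bsub>Er r p' q'\<^esub>"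
proof -
  interpret exact_couple_at r "C r" by (rule exact_at[OF assms(1)])
  have "kmap (C r) p q x = \<zero>\<^bsub>D (p + 1) q\<^esub>"
    using kmap_vanish kmap_vanish_nonpos assms by blast
  moreover have "jmap (C r) (p + 1) q \<in> lin_maps (D (p + 1) q) (E p' q')"
    by (rule jmap_lin) (use assms in auto)
  ultimately show ?thesis using lin_map_zero[OF D_module E_module] by (simp add: couple_diff_def)
qed

text \<open>Outgoing differentials vanish because \<open>p + s > n\<close>; incoming ones start at
  \<open>p - s < 0\<close>, where \<open>k\<close> is zero.\<close>

lemma stable:
  assumes "r \<ge> 1" "p + int r > int n" "p < int r"
  shows "stable_from Er dr r p q"
  unfolding stable_from_def
proof (intro allI impI conjI ballI)
  fix s assume s: "r \<le> s"
  have s1: "s \<ge> 1" using s assms by simp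
  interpret exact_couple_at s "C s" by (rule exact_at[OF s1])
  show "dr s p q x = \<zero>\<^bsub>E (p + int s) (q - int s + 1)\<^esub>" if "x \<in> carrier (E p q)" for x
    by (rule diff_vanish[OF s1 _ that]) (use s assms in auto)
  have "dr s (p - int s) (q + int s - 1) x = \<zero>\<^bsub>E p q\<^esub>"
    if "x \<in> carrier (E (p - int s) (q + int s - 1))" for x
    by (rule diff_vanish[OF s1 _ that]) (use s assms in auto)
  then show "page_boundaries s E (couple_diff (C s)) p q = {\<zero>\<^bsub>E p q\<^esub>}"
    unfolding page_boundaries_def using module_closed(1)[OF E_module] by fastforce
qed

text \<open>The map \<open>j\<close> into position \<open>(p, q)\<close> starts at
  \<open>(p - s, q + s)\<close> with \<open>s = r - 1\<close>. The bound \<open>p < r\<close> puts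
  this start into the constant range, where the \<open>D\<close> term is a filtration step. The
  other bound makes \<open>k\<close> zero, so \<open>j\<close> is onto. Its kernel is the image of
  \<open>i\<close>, which is the next filtration step.\<close>

lemma page_quotient:
  assumes "r \<ge> 1" "p + int r > int n" "p < int r"
  shows "\<exists>\<pi>. quotient_proj \<pi> ((V (p + q))\<lparr>carrier := filt p (p + q)\<rparr>) (filt (p + 1) (p + q)) (Er r p q)"
proof -
  interpret exact_couple_at r "C r" by (rule exact_at[OF assms(1)])
  define s where "s = r - 1"
  have r: "r = Suc s" using assms by (simp add: s_def)
  let ?p = "p - int s" and ?q = "q + int s"
  have p0: "?p \<le> 0" using assms r by simp
  have D: "D ?p ?q = (V (p + q))\<lparr>carrier := filt p (p + q)\<rparr>"
    unfolding r using dobj_C[of s ?p ?q] const[OF p0, of ?q] im_filt[OF p0, of s ?q] by simp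
  have j: "jmap (C r) ?p ?q \<in> lin_maps (D ?p ?q) (E p q)"
    by (rule jmap_lin) (use r in auto)
  have "jmap (C r) ?p ?q ` carrier (D ?p ?q) = carrier (E p q)"
  proof
    show "jmap (C r) ?p ?q ` carrier (D ?p ?q) \<subseteq> carrier (E p q)" using lin_mapsD(1)[OF j] by auto
    show "carrier (E p q) \<subseteq> jmap (C r) ?p ?q ` carrier (D ?p ?q)"
    proof
      fix x assume x: "x \<in> carrier (E p q)"
      have "\<exists>y\<in>carrier (D ?p ?q). x = jmap (C r) ?p ?q y"
        using kmap_zero_iff[OF refl _ _ x, of ?p ?q] kmap_vanish[OF assms(1,2) x] r by simp
      then show "x \<in> jmap (C r) ?p ?q ` carrier (D ?p ?q)" by blast
    qed
  qed
  moreover have "{x \<in> carrier (D ?p ?q). jmap (C r) ?p ?q x = \<zero>\<^bsub>E p q\<^esub>} = filt (p + 1) (p + q)"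
  proof -
    have "{x \<in> carrier (D ?p ?q). jmap (C r) ?p ?q x = \<zero>\<^bsub>E p q\<^esub>} =
        imap (C r) (?p + 1) (?q - 1) ` carrier (D (?p + 1) (?q - 1))"
      using exact by (simp add: exact_couple_def r)
    also have "\<dots> = im (Suc s) ?p ?q"
      unfolding r using dobj_C[of s "?p + 1" "?q - 1"] imap_C[of _ s "?p + 1" "?q - 1"]
      by (simp cong: image_cong)
    also have "\<dots> = filt (p + 1) (p + q)"
      using im_filt[OF p0, of "Suc s" ?q] by (simp add: algebra_simps)
    finally show ?thesis .
  qed
  ultimately have "quotient_proj (jmap (C r) ?p ?q) (D ?p ?q) (filt (p + 1) (p + q)) (E p q)"
    using D_module E_module j by (simp add: quotient_proj_def)
  then show ?thesis unfolding D by blast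
qed

text \<open>Where the page is stable, all elements are cycles and the boundaries are zero, so
  homology is a quotient by zero.\<close>

lemma page_step:
  assumes "r \<ge> 1" "stable_from Er dr r p q"
  shows "lin_isomorphic (Er r p q) (Er (Suc r) p q)"
proof -
  interpret exact_couple_at r "C r" by (rule exact_at[OF assms(1)])
  have B: "B p q = {\<zero>\<^bsub>E p q\<^esub>}"
    and d: "\<And>x. x \<in> carrier (E p q) \<Longrightarrow> couple_diff (C r) p q x = \<zero>\<^bsub>E (p + int r) (q - int r + 1)\<^esub>"
    using assms(2) unfolding stable_from_def by blast+
  have "carrier (Z p q) = carrier (E p q)" using d by (auto simp: Z_carrier[OF refl refl])
  then have "quotient_proj (\<lambda>x. B p q +>\<^bsub>E p q\<^esub> x) (E p q) {\<zero>\<^bsub>E p q\<^esub>} (eobj C' p q)"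
    using derived_quotient[of p q] unfolding B by (simp add: page_cycles_def)
  moreover have "quotient_proj (\<lambda>x. x) (E p q) {\<zero>\<^bsub>E p q\<^esub>} (E p q)"
    using E_module module_closed(1)[OF E_module] by (auto simp: quotient_proj_def lin_maps_def)
  ultimately have "lin_isomorphic (E p q) (eobj C' p q)" using lin_isomorphic_quotients by blast
  moreover have "lin_isomorphic (eobj C' p q) (Er (Suc r) p q)"
    using derived[OF assms(1)] by (fastforce simp: is_derived_couple_def lin_isomorphic_def)
  ultimately show ?thesis by (rule lin_isomorphic_trans)
qed

lemma pages_isomorphic:
  assumes "r \<ge> 1" "stable_from Er dr r p q" "r \<le> s"
  shows "lin_isomorphic (Er r p q) (Er s p q)"
  using assms(3)
proof (induction s rule: dec_induct)
  case base show ?case by (rule lin_isomorphic_refl)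
next
  case (step s)
  have "stable_from Er dr s p q" using assms(2) step by (auto simp: stable_from_def)
  then show ?case using page_step[of s] step assms(1) lin_isomorphic_trans by fastforce
qed

lemma exists_stable: "\<exists>r\<ge>1. stable_from Er dr r p q"
  by (rule exI[of _ "Suc (nat \<bar>p\<bar> + n)"]) (auto intro!: stable)

text \<open>The least stable page may come before those covered by \<open>page_quotient\<close>; a
  presentation of a later page is composed with an isomorphism back to it.\<close>

lemma E_infinity_quotient:
  "\<exists>\<pi>. quotient_proj \<pi> ((V (p + q))\<lparr>carrier := filt p (p + q)\<rparr>) (filt (p + 1) (p + q))
     (E_infinity Er dr p q)"
proof -
  define r where "r = (LEAST r. 1 \<le> r \<and> stable_from Er dr r p q)"
  have r: "1 \<le> r \<and> stable_from Er dr r p q"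
    unfolding r_def using LeastI_ex[OF exists_stable[of p q]] by simp
  have Einf: "E_infinity Er dr p q = Er r p q" by (simp add: E_infinity_def r_def)
  \<comment> \<open>Large enough for both bounds of \<open>page_quotient\<close> and not below the
    stable index \<open>r\<close>.\<close>
  define s where "s = Suc (nat \<bar>p\<bar> + n + r)"
  obtain \<pi> where \<pi>: "quotient_proj \<pi> ((V (p + q))\<lparr>carrier := filt p (p + q)\<rparr>)
      (filt (p + 1) (p + q)) (Er s p q)"
    using page_quotient[of s p q] by (force simp: s_def)
  have mod: "module real_ring (Er r p q)" "module real_ring (Er s p q)"
    using exact_couple_at.E_module[OF exact_at] r quotient_projD(2)[OF \<pi>] by blast+
  have "lin_isomorphic (Er r p q) (Er s p q)"
    by (rule pages_isomorphic) (use r in \<open>auto simp: s_def\<close>)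
  then obtain \<psi> where \<psi>: "\<psi> \<in> lin_isos (Er s p q) (Er r p q)"
    using lin_isomorphic_sym[OF _ mod(1)] by (auto simp: lin_isomorphic_def)
  then have \<psi>l: "\<psi> \<in> lin_maps (Er s p q) (Er r p q)" and \<psi>b: "bij_betw \<psi> (carrier (Er s p q)) (carrier (Er r p q))"
    by (auto simp: lin_isos_def)
  note qp = quotient_projD[OF \<pi>]
  have \<psi>0: "\<psi> z = \<zero>\<^bsub>Er r p q\<^esub> \<longleftrightarrow> z = \<zero>\<^bsub>Er s p q\<^esub>" if "z \<in> carrier (Er s p q)" for z
    using lin_map_zero[OF mod(2,1) \<psi>l] \<psi>b module_closed(1)[OF mod(2)] that
    by (metis bij_betw_def inj_on_contraD)
  have "quotient_proj (\<lambda>x. \<psi> (\<pi> x)) ((V (p + q))\<lparr>carrier := filt p (p + q)\<rparr>)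
      (filt (p + 1) (p + q)) (Er r p q)"
    unfolding quotient_proj_def
  proof (intro conjI)
    show "(\<lambda>x. \<psi> (\<pi> x)) ` carrier ((V (p + q))\<lparr>carrier := filt p (p + q)\<rparr>) = carrier (Er r p q)"
      using qp(4) \<psi>b by (metis bij_betw_def image_image)
    show "{x \<in> carrier ((V (p + q))\<lparr>carrier := filt p (p + q)\<rparr>). \<psi> (\<pi> x) = \<zero>\<^bsub>Er r p q\<^esub>} =
        filt (p + 1) (p + q)"
      using \<psi>0[OF lin_mapsD(1)[OF qp(3)]] qp(5,6) by blast
  qed (use qp(1) mod lin_map_comp[OF qp(3) \<psi>l] in auto)
  then show ?thesis unfolding Einf by blast
qed

lemma E_infinity_iso:
  "lin_isomorphic (E_infinity Er dr p q)
     (quot_mod ((V (p + q))\<lparr>carrier := filt p (p + q)\<rparr>) (filt (p + 1) (p + q)))"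
proof -
  let ?M = "(V (p + q))\<lparr>carrier := filt p (p + q)\<rparr>"
  obtain \<pi> where \<pi>: "quotient_proj \<pi> ?M (filt (p + 1) (p + q)) (E_infinity Er dr p q)"
    using E_infinity_quotient by blast
  have "submodule (filt (p + 1) (p + q)) real_ring ?M"
    using submodule_kernel[OF quotient_projD(1-3)[OF \<pi>]] \<pi> by (simp add: quotient_proj_def)
  from lin_isomorphic_quotients[OF \<pi> quotient_proj_quot_mod[OF quotient_projD(1)[OF \<pi>] this]]
  show ?thesis .
qed

lemma E_infinity_direct_sum:
  "lin_isomorphic (direct_sum {(p, q). p + q = i} (\<lambda>(p, q). E_infinity Er dr p q)) (V i)"
proof (rule direct_sum_graded[OF V_module filt_submodule, where n = n])
  show "\<exists>\<pi>. quotient_proj \<pi> ((V i)\<lparr>carrier := filt p i\<rparr>) (filt (p + 1) i)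
      (E_infinity Er dr p (i - p))" for p
    using E_infinity_quotient[of p "i - p"] by simp
qed (use filt_nonpos filt_top in auto)

end

section \<open>Exterior algebra on lists of vectors\<close>

text \<open>Interior product with \<open>v\<close>, which occupies the first argument.\<close>

definition insertion :: "'b \<Rightarrow> ('b list \<Rightarrow> real) \<Rightarrow> 'b list \<Rightarrow> real" where
  "insertion v \<alpha> ws = \<alpha> (v # ws)"

text \<open>The grading involution. It carries the sign of the antiderivation law for inhomogeneous
  forms, where no degree can be named.\<close>

definition grade_sign :: "('b list \<Rightarrow> real) \<Rightarrow> 'b list \<Rightarrow> real" where
  "grade_sign \<alpha> ws = (-1) ^ length ws * \<alpha> ws"

definition shuffle_inv :: "nat \<Rightarrow> nat set \<Rightarrow> (nat \<times> nat) set" where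
  "shuffle_inv n S = {(i, j). i < j \<and> j < n \<and> i \<notin> S \<and> j \<in> S}"

lemma finite_shuffle_inv: "finite (shuffle_inv n S)"
  by (rule finite_subset[of _ "{..<n} \<times> {..<n}"]) (auto simp: shuffle_inv_def)

text \<open>Giving the first argument to the left factor creates no inversion.\<close>

lemma shuffle_inv_with_zero:
  "card (shuffle_inv (Suc n) (insert 0 (Suc ` S))) = card (shuffle_inv n S)"
proof -
  have "shuffle_inv (Suc n) (insert 0 (Suc ` S)) = map_prod Suc Suc ` shuffle_inv n S"
  proof (intro equalityI subsetI)
    fix x assume "x \<in> shuffle_inv (Suc n) (insert 0 (Suc ` S))"
    then obtain i j where x: "x = (i, j)" "i < j" "j < Suc n" "i \<notin> insert 0 (Suc ` S)" "j \<in> insert 0 (Suc ` S)"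
      by (auto simp: shuffle_inv_def)
    then obtain i' j' where "i = Suc i'" "j = Suc j'" by (cases i; cases j) auto
    with x show "x \<in> map_prod Suc Suc ` shuffle_inv n S" by (auto simp: shuffle_inv_def)
  qed (auto simp: shuffle_inv_def)
  moreover have "card (map_prod Suc Suc ` shuffle_inv n S) = card (shuffle_inv n S)"
    by (rule card_image) (auto simp: inj_on_def)
  ultimately show ?thesis by simp
qed

text \<open>An initial argument given to the right factor is inverted with every argument of the
  left factor. The extra \<open>card S\<close> is the source of \<open>grade_sign\<close> in the
  recursion below.\<close>

lemma shuffle_inv_without_zero:
  assumes "S \<subseteq> {..<n}"
  shows "card (shuffle_inv (Suc n) (Suc ` S)) = card (shuffle_inv n S) + card S"
proof -
  have eq: "shuffle_inv (Suc n) (Suc ` S) = map_prod Suc Suc ` shuffle_inv n S \<union> (\<lambda>j. (0, Suc j)) ` S"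
  proof (intro equalityI subsetI)
    fix x assume "x \<in> shuffle_inv (Suc n) (Suc ` S)"
    then obtain i j where x: "x = (i, Suc j)" "i < Suc j" "j < n" "i \<notin> Suc ` S" "j \<in> S"
      by (auto simp: shuffle_inv_def)
    then show "x \<in> map_prod Suc Suc ` shuffle_inv n S \<union> (\<lambda>j. (0, Suc j)) ` S"
      by (cases i) (auto simp: shuffle_inv_def)
  qed (use assms in \<open>auto simp: shuffle_inv_def\<close>)
  have "card (map_prod Suc Suc ` shuffle_inv n S) = card (shuffle_inv n S)"
    by (rule card_image) (auto simp: inj_on_def)
  moreover have "card ((\<lambda>j. (0::nat, Suc j)) ` S) = card S"
    by (rule card_image) (auto simp: inj_on_def)
  moreover have "finite S" using assms finite_subset by blast
  ultimately show ?thesis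
    unfolding eq by (subst card_Un_disjoint) (auto simp: finite_shuffle_inv)
qed

lemma wedge_alt_Nil [simp]: "wedge_alt \<alpha> \<beta> [] = \<alpha> [] * \<beta> []"
  by (simp add: wedge_alt_def)

text \<open>The antiderivation law, obtained by splitting the sum according to the factor that
  receives \<open>v\<close>. It replaces the shuffle sum in the inductions that follow.\<close>

lemma wedge_alt_Cons:
  "wedge_alt \<alpha> \<beta> (v # vs) =
     wedge_alt (insertion v \<alpha>) \<beta> vs + wedge_alt (grade_sign \<alpha>) (insertion v \<beta>) vs"
proof -
  let ?n = "length vs"
  define t where "t S = (-1) ^ card (shuffle_inv (Suc ?n) S) * \<alpha> (nths (v # vs) S) * \<beta> (nths (v # vs) (- S))" for S
  have split: "Pow {..<Suc ?n} = (\<lambda>S. insert 0 (Suc ` S)) ` Pow {..<?n} \<union> (\<lambda>S. Suc ` S) ` Pow {..<?n}"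
    by (simp add: lessThan_Suc_eq_insert_0 Pow_insert image_Pow_surj[symmetric] image_image Un_commute)
  have i1: "inj_on (\<lambda>S. insert 0 (Suc ` S)) (Pow {..<?n})"
  proof (rule inj_onI)
    fix S U assume "insert 0 (Suc ` S) = insert 0 (Suc ` U)"
    then have "Suc ` S = Suc ` U" by (simp add: insert_ident)
    then show "S = U" by (simp add: inj_image_eq_iff)
  qed
  have i2: "inj_on (\<lambda>S. Suc ` S) (Pow {..<?n})" by (auto simp: inj_on_def inj_image_eq_iff)
  have "wedge_alt \<alpha> \<beta> (v # vs) = sum t (Pow {..<Suc ?n})"
    by (simp add: wedge_alt_def t_def shuffle_inv_def)
  also have "\<dots> = (\<Sum>S\<in>Pow {..<?n}. t (insert 0 (Suc ` S))) + (\<Sum>S\<in>Pow {..<?n}. t (Suc ` S))"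
    unfolding split by (subst sum.union_disjoint) (auto simp: sum.reindex[OF i1] sum.reindex[OF i2])
  also have "(\<Sum>S\<in>Pow {..<?n}. t (insert 0 (Suc ` S))) = wedge_alt (insertion v \<alpha>) \<beta> vs"
    unfolding wedge_alt_def
  proof (rule sum.cong[OF refl])
    fix S assume "S \<in> Pow {..<?n}"
    have "{j. Suc j \<in> insert 0 (Suc ` S)} = S" "{j. Suc j \<in> - insert 0 (Suc ` S)} = - S" by auto
    then show "t (insert 0 (Suc ` S)) = (- 1) ^ card {(i, j). i < j \<and> j < ?n \<and> i \<notin> S \<and> j \<in> S} *
         insertion v \<alpha> (nths vs S) * \<beta> (nths vs (- S))"
      unfolding t_def shuffle_inv_with_zero by (simp add: nths_Cons insertion_def shuffle_inv_def)
  qed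
  also have "(\<Sum>S\<in>Pow {..<?n}. t (Suc ` S)) = wedge_alt (grade_sign \<alpha>) (insertion v \<beta>) vs"
    unfolding wedge_alt_def
  proof (rule sum.cong[OF refl])
    fix S assume S: "S \<in> Pow {..<?n}"
    have sets: "{j. Suc j \<in> Suc ` S} = S" "{j. Suc j \<in> - Suc ` S} = - S" by auto
    have S': "S \<subseteq> {..<?n}" using S by simp
    have "length (nths vs S) = card S"
      using S by (auto simp: length_nths intro!: arg_cong[where f = card])
    then show "t (Suc ` S) = (- 1) ^ card {(i, j). i < j \<and> j < ?n \<and> i \<notin> S \<and> j \<in> S} *
         grade_sign \<alpha> (nths vs S) * insertion v \<beta> (nths vs (- S))"
      unfolding t_def shuffle_inv_without_zero[OF S'] nths_Cons sets
      by (simp add: insertion_def grade_sign_def shuffle_inv_def power_add)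
  qed
  finally show ?thesis .
qed

lemma wedge_alt_lin_left:
  "wedge_alt (\<lambda>ws. a * \<alpha> ws + b * \<alpha>' ws) \<beta> vs = a * wedge_alt \<alpha> \<beta> vs + b * wedge_alt \<alpha>' \<beta> vs"
  by (simp add: wedge_alt_def sum_distrib_left sum.distrib[symmetric] algebra_simps)

lemma wedge_alt_lin_right:
  "wedge_alt \<alpha> (\<lambda>ws. a * \<beta> ws + b * \<beta>' ws) vs = a * wedge_alt \<alpha> \<beta> vs + b * wedge_alt \<alpha> \<beta>' vs"
  by (simp add: wedge_alt_def sum_distrib_left sum.distrib[symmetric] algebra_simps)

lemma wedge_alt_add:
  "wedge_alt (\<lambda>ws. \<alpha> ws + \<alpha>' ws) \<beta> vs = wedge_alt \<alpha> \<beta> vs + wedge_alt \<alpha>' \<beta> vs"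
  "wedge_alt \<alpha> (\<lambda>ws. \<beta> ws + \<beta>' ws) vs = wedge_alt \<alpha> \<beta> vs + wedge_alt \<alpha> \<beta>' vs"
  by (simp_all add: wedge_alt_def sum.distrib[symmetric] algebra_simps)

lemma wedge_alt_scale:
  "wedge_alt (\<lambda>ws. a * \<alpha> ws) \<beta> vs = a * wedge_alt \<alpha> \<beta> vs"
  "wedge_alt \<alpha> (\<lambda>ws. a * \<beta> ws) vs = a * wedge_alt \<alpha> \<beta> vs"
  by (simp_all add: wedge_alt_def sum_distrib_left algebra_simps)

lemma wedge_alt_zero [simp]: "wedge_alt (\<lambda>_. 0) \<beta> vs = 0" "wedge_alt \<alpha> (\<lambda>_. 0) vs = 0"
  by (simp_all add: wedge_alt_def)

lemma wedge_alt_minus: 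
  "wedge_alt (\<lambda>ws. - \<alpha> ws) \<beta> vs = - wedge_alt \<alpha> \<beta> vs"
  "wedge_alt \<alpha> (\<lambda>ws. - \<beta> ws) vs = - wedge_alt \<alpha> \<beta> vs"
  by (simp_all add: wedge_alt_def sum_negf)

lemma grade_sign_grade_sign [simp]: "grade_sign (grade_sign \<alpha>) = \<alpha>"
  by (auto simp: grade_sign_def fun_eq_iff power_mult_distrib[symmetric])

lemma insertion_grade_sign: "insertion v (grade_sign \<alpha>) = (\<lambda>ws. - grade_sign (insertion v \<alpha>) ws)"
  by (auto simp: grade_sign_def insertion_def)

lemma insertion_wedge_alt: "insertion v (wedge_alt \<alpha> \<beta>) =
    (\<lambda>vs. wedge_alt (insertion v \<alpha>) \<beta> vs + wedge_alt (grade_sign \<alpha>) (insertion v \<beta>) vs)"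
  by (simp add: insertion_def[of v "wedge_alt \<alpha> \<beta>"] wedge_alt_Cons fun_eq_iff)

lemma grade_sign_wedge_alt: "grade_sign (wedge_alt \<alpha> \<beta>) = wedge_alt (grade_sign \<alpha>) (grade_sign \<beta>)"
proof
  fix vs show "grade_sign (wedge_alt \<alpha> \<beta>) vs = wedge_alt (grade_sign \<alpha>) (grade_sign \<beta>) vs"
  proof (induction vs arbitrary: \<alpha> \<beta>)
    case (Cons v vs)
    have K: "wedge_alt (grade_sign \<alpha>) (grade_sign \<beta>) vs = (-1) ^ length vs * wedge_alt \<alpha> \<beta> vs" for \<alpha> \<beta>
      unfolding Cons.IH[symmetric] by (rule grade_sign_def)
    show ?case
      using K[of "insertion v \<alpha>" \<beta>] K[of "grade_sign \<alpha>" "insertion v \<beta>"]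
      by (simp add: wedge_alt_Cons grade_sign_def[of "wedge_alt \<alpha> \<beta>"] insertion_grade_sign
          wedge_alt_minus algebra_simps)
  qed (simp add: grade_sign_def)
qed

text \<open>Both bracketings obey the same three-term recursion, in which \<open>v\<close> is given
  to one of the three factors.\<close>

lemma wedge_alt_assoc: "wedge_alt \<alpha> (wedge_alt \<beta> \<gamma>) vs = wedge_alt (wedge_alt \<alpha> \<beta>) \<gamma> vs"
proof (induction vs arbitrary: \<alpha> \<beta> \<gamma>)
  case (Cons v vs)
  show ?case
    by (simp add: wedge_alt_Cons insertion_wedge_alt grade_sign_wedge_alt wedge_alt_add Cons)
qed simp

text \<open>Degrees enter only as eigenvalues of \<open>grade_sign\<close>, so the rule also covers
  inhomogeneous forms of fixed parity, such as an odd form with components in several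
  degrees.\<close>

lemma wedge_alt_graded_commute:
  assumes "grade_sign \<alpha> = (\<lambda>ws. (-1) ^ a * \<alpha> ws)" "grade_sign \<beta> = (\<lambda>ws. (-1) ^ b * \<beta> ws)"
  shows "wedge_alt \<alpha> \<beta> vs = (-1) ^ (a * b) * wedge_alt \<beta> \<alpha> vs"
  using assms
proof (induction vs arbitrary: \<alpha> \<beta> a b)
  case Nil
  \<comment> \<open>A nonzero value on the empty list forces \<open>a\<close> to be even, and then
    the sign is one.\<close>
  have "\<alpha> [] = (-1) ^ a * \<alpha> []"
    using fun_cong[OF Nil(1), of "[]"] by (simp only: grade_sign_def list.size power_0 mult_1)
  then have "\<alpha> [] = 0 \<or> (-1 :: real) ^ (a * b) = 1"
    by (metis mult_cancel_right1 power_mult power_one)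
  then show ?case by auto
next
  case (Cons v vs)
  \<comment> \<open>Contraction lowers the degree, but only its parity matters; \<open>Suc c\<close>
    avoids subtraction at \<open>c = 0\<close>.\<close>
  have ins: "grade_sign (insertion v \<gamma>) = (\<lambda>ws. (-1) ^ Suc c * insertion v \<gamma> ws)"
    if "grade_sign \<gamma> = (\<lambda>ws. (-1) ^ c * \<gamma> ws)" for \<gamma> :: "'a list \<Rightarrow> real" and c
  proof
    fix ws
    have "insertion v (grade_sign \<gamma>) ws = - grade_sign (insertion v \<gamma>) ws"
      by (simp only: insertion_grade_sign)
    moreover have "insertion v (grade_sign \<gamma>) ws = (-1) ^ c * insertion v \<gamma> ws"
      unfolding that insertion_def ..
    ultimately show "grade_sign (insertion v \<gamma>) ws = (-1) ^ Suc c * insertion v \<gamma> ws" by simp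
  qed
  note \<alpha> = ins[OF Cons.prems(1)] and \<beta> = ins[OF Cons.prems(2)]
  have expand: "wedge_alt \<alpha> \<beta> (v # vs) = (-1) ^ (Suc a * b) * wedge_alt \<beta> (insertion v \<alpha>) vs +
      (-1) ^ a * ((-1) ^ (a * Suc b) * wedge_alt (insertion v \<beta>) \<alpha> vs)"
    unfolding wedge_alt_Cons Cons.prems(1) wedge_alt_scale
    using Cons.IH[OF \<alpha> Cons.prems(2)] Cons.IH[OF Cons.prems(1) \<beta>] by simp
  have expand': "wedge_alt \<beta> \<alpha> (v # vs) = wedge_alt (insertion v \<beta>) \<alpha> vs +
      (-1) ^ b * wedge_alt \<beta> (insertion v \<alpha>) vs"
    unfolding wedge_alt_Cons Cons.prems(2) wedge_alt_scale by simp
  have e1: "(-1 :: real) ^ (Suc a * b) = (-1) ^ b * (-1) ^ (a * b)"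
    by (simp add: power_add)
  have e2: "(-1 :: real) ^ a * ((-1) ^ (a * Suc b) * x) = (-1) ^ (a * b) * x" for x
  proof -
    have "(-1 :: real) ^ a * (-1) ^ a = 1" by (simp add: power_mult_distrib[symmetric])
    then show ?thesis by (simp add: power_add mult.assoc[symmetric])
  qed
  show ?case unfolding expand e1 e2 expand' by (simp add: distrib_left)
qed

text \<open>Commuting the two factors changes the sign, so the product equals its negative.\<close>

lemma wedge_alt_odd_self:
  assumes "grade_sign \<alpha> = (\<lambda>ws. - \<alpha> ws)"
  shows "wedge_alt \<alpha> \<alpha> vs = 0"
  using wedge_alt_graded_commute[of \<alpha> 1 \<alpha> 1 vs] assms by simp

lemma wedge_alt_odd_square:
  assumes "grade_sign \<alpha> = (\<lambda>ws. - \<alpha> ws)"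
  shows "wedge_alt \<alpha> (wedge_alt \<alpha> \<beta>) vs = 0"
proof -
  have "wedge_alt \<alpha> \<alpha> = (\<lambda>_. 0)" using wedge_alt_odd_self[OF assms] by auto
  then show ?thesis by (simp add: wedge_alt_assoc)
qed

lemma wedge_alt_map: "wedge_alt \<alpha> \<beta> (map f vs) = wedge_alt (\<lambda>ws. \<alpha> (map f ws)) (\<lambda>ws. \<beta> (map f ws)) vs"
  by (simp add: wedge_alt_def nths_map)

text \<open>Degree bookkeeping for inhomogeneous forms: a nonzero value of the product exhibits
  degrees of the two factors that add up.\<close>

lemma wedge_alt_length:
  assumes "wedge_alt \<alpha> \<beta> vs \<noteq> 0"
  shows "\<exists>us ws. length us + length ws = length vs \<and> \<alpha> us \<noteq> 0 \<and> \<beta> ws \<noteq> 0"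
  using assms
proof (induction vs arbitrary: \<alpha> \<beta>)
  case (Cons v vs)
  then have "wedge_alt (insertion v \<alpha>) \<beta> vs \<noteq> 0 \<or> wedge_alt (grade_sign \<alpha>) (insertion v \<beta>) vs \<noteq> 0"
    by (auto simp: wedge_alt_Cons)
  then show ?case
  proof
    assume "wedge_alt (insertion v \<alpha>) \<beta> vs \<noteq> 0"
    from Cons.IH[OF this] obtain us ws where "length us + length ws = length vs" "\<alpha> (v # us) \<noteq> 0" "\<beta> ws \<noteq> 0"
      by (auto simp: insertion_def)
    then show ?case by (intro exI[of _ "v # us"] exI[of _ ws]) auto
  next
    assume "wedge_alt (grade_sign \<alpha>) (insertion v \<beta>) vs \<noteq> 0"
    from Cons.IH[OF this] obtain us ws where "length us + length ws = length vs" "\<alpha> us \<noteq> 0" "\<beta> (v # ws) \<noteq> 0"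
      by (auto simp: insertion_def grade_sign_def)
    then show ?case by (intro exI[of _ us] exI[of _ "v # ws"]) auto
  qed
qed auto

section \<open>Multilinear and alternating functions on lists\<close>

definition multilinear :: "('b::real_vector list \<Rightarrow> real) \<Rightarrow> bool" where
  "multilinear \<alpha> \<longleftrightarrow> (\<forall>us ws. linear (\<lambda>v. \<alpha> (us @ v # ws)))"

lemma alternating_form_iff:
  "alternating_form \<alpha> \<longleftrightarrow> multilinear \<alpha> \<and> (\<forall>us vs ws v. \<alpha> (us @ v # vs @ v # ws) = 0)"
  by (simp add: alternating_form_def multilinear_def)

lemma multilinearD:
  assumes "multilinear \<alpha>"
  shows "\<alpha> (us @ (x + y) # ws) = \<alpha> (us @ x # ws) + \<alpha> (us @ y # ws)"
    and "\<alpha> (us @ (r *\<^sub>R x) # ws) = r * \<alpha> (us @ x # ws)"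
proof -
  have l: "linear (\<lambda>v. \<alpha> (us @ v # ws))" using assms by (simp add: multilinear_def)
  show "\<alpha> (us @ (x + y) # ws) = \<alpha> (us @ x # ws) + \<alpha> (us @ y # ws)" using linear_add[OF l] .
  show "\<alpha> (us @ (r *\<^sub>R x) # ws) = r * \<alpha> (us @ x # ws)" using linear_cmul[OF l] by simp
qed

lemma multilinearI:
  assumes "\<And>us x y ws. \<alpha> (us @ (x + y) # ws) = \<alpha> (us @ x # ws) + \<alpha> (us @ y # ws)"
    and "\<And>us r x ws. \<alpha> (us @ (r *\<^sub>R x) # ws) = r * \<alpha> (us @ x # ws)"
  shows "multilinear \<alpha>"
  unfolding multilinear_def by (intro allI linearI) (simp_all add: assms)

lemma multilinear_insertion: "multilinear \<alpha> \<Longrightarrow> multilinear (insertion v \<alpha>)"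
  using multilinearD[of \<alpha> "v # us" for us] by (intro multilinearI) (simp_all add: insertion_def)

lemma multilinear_grade_sign: "multilinear \<alpha> \<Longrightarrow> multilinear (grade_sign \<alpha>)"
  using multilinearD[of \<alpha>] by (intro multilinearI) (simp_all add: grade_sign_def algebra_simps)

lemma multilinear_lincomb:
  "\<lbrakk>multilinear \<alpha>; multilinear \<beta>\<rbrakk> \<Longrightarrow> multilinear (\<lambda>ws. a * \<alpha> ws + b * \<beta> ws)"
  using multilinearD[of \<alpha>] multilinearD[of \<beta>] by (intro multilinearI) (simp_all add: algebra_simps)

lemma multilinear_zero: "multilinear (\<lambda>_. 0)"
  by (intro multilinearI) auto

lemma insertion_add: "multilinear \<alpha> \<Longrightarrow> insertion (x + y) \<alpha> = (\<lambda>ws. insertion x \<alpha> ws + insertion y \<alpha> ws)"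
  and insertion_scale: "multilinear \<alpha> \<Longrightarrow> insertion (r *\<^sub>R x) \<alpha> = (\<lambda>ws. r * insertion x \<alpha> ws)"
  using multilinearD[of \<alpha> "[]"] by (simp_all add: insertion_def fun_eq_iff)

lemma multilinear_wedge_alt:
  assumes "multilinear \<alpha>" "multilinear \<beta>"
  shows "multilinear (wedge_alt \<alpha> \<beta>)"
proof -
  have "wedge_alt \<alpha> \<beta> (us @ (x + y) # ws) = wedge_alt \<alpha> \<beta> (us @ x # ws) + wedge_alt \<alpha> \<beta> (us @ y # ws) \<and>
    wedge_alt \<alpha> \<beta> (us @ (r *\<^sub>R x) # ws) = r * wedge_alt \<alpha> \<beta> (us @ x # ws)" for us x y r ws
    using assms
  proof (induction us arbitrary: \<alpha> \<beta>)
    case Nil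
    then show ?case
      by (simp add: wedge_alt_Cons insertion_add insertion_scale wedge_alt_add wedge_alt_scale
          algebra_simps)
  next
    case (Cons u us)
    then show ?case
      using Cons.IH[OF multilinear_insertion[OF Cons.prems(1)] Cons.prems(2)]
        Cons.IH[OF multilinear_grade_sign[OF Cons.prems(1)] multilinear_insertion[OF Cons.prems(2)]]
      by (simp add: wedge_alt_Cons algebra_simps)
  qed
  then show ?thesis by (intro multilinearI) auto
qed

text \<open>Polarisation: expand the value that has \<open>v + w\<close> in both neighbouring
  slots.\<close>

lemma adjacent_swap:
  assumes m: "multilinear \<alpha>" and a: "\<And>us ws v. \<alpha> (us @ v # v # ws) = 0"
  shows "\<alpha> (us @ v # w # ws) = - \<alpha> (us @ w # v # ws)"
proof -
  have second: "\<alpha> (us @ u # (v + w) # ws) = \<alpha> (us @ u # v # ws) + \<alpha> (us @ u # w # ws)" for u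
    using multilinearD(1)[OF m, of "us @ [u]" v w ws] by (simp only: append_assoc append.simps)
  show ?thesis
    using a[of us "v + w" ws] a[of us v ws] a[of us w ws] second[of v] second[of w]
      multilinearD(1)[OF m, of us v w "(v + w) # ws"] by linarith
qed

text \<open>Adjacent swaps bring two equal arguments next to each other, changing only the sign.
  Testing neighbours is what the list recursions can do.\<close>

lemma alternating_formI:
  assumes m: "multilinear \<alpha>" and a: "\<And>us ws v. \<alpha> (us @ v # v # ws) = 0"
  shows "alternating_form \<alpha>"
proof -
  have "\<alpha> (us @ v # vs @ v # ws) = 0" for us vs ws v
  proof (induction vs arbitrary: us)
    case (Cons w vs)
    have "\<alpha> (us @ v # w # (vs @ v # ws)) = - \<alpha> (us @ w # v # (vs @ v # ws))"
      by (rule adjacent_swap[OF m a])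
    then show ?case using Cons[of "us @ [w]"] by simp
  qed (use a in simp)
  then show ?thesis using m by (simp add: alternating_form_iff)
qed

lemma alternating_formD:
  assumes "alternating_form \<alpha>"
  shows "multilinear \<alpha>" "\<alpha> (us @ v # vs @ v # ws) = 0" "\<alpha> (us @ v # v # ws) = 0"
    and "\<alpha> (v # w # ws) = - \<alpha> (w # v # ws)"
proof -
  show m: "multilinear \<alpha>" and a: "\<alpha> (us @ v # vs @ v # ws) = 0" for us v vs ws
    using assms by (auto simp: alternating_form_iff)
  show "\<alpha> (us @ v # v # ws) = 0" using a[of us v "[]" ws] by simp
  show "\<alpha> (v # w # ws) = - \<alpha> (w # v # ws)"
    using adjacent_swap[OF m, of "[]" v w ws] a[of _ _ "[]"] by simp
qed

lemma alternating_insertion: "alternating_form \<alpha> \<Longrightarrow> alternating_form (insertion v \<alpha>)"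
  using alternating_formD(3)[of \<alpha> "v # us" for us]
  by (intro alternating_formI[OF multilinear_insertion[OF alternating_formD(1)]]) (simp_all add: insertion_def)

lemma alternating_grade_sign: "alternating_form \<alpha> \<Longrightarrow> alternating_form (grade_sign \<alpha>)"
  using alternating_formD(3)[of \<alpha>]
  by (intro alternating_formI[OF multilinear_grade_sign[OF alternating_formD(1)]]) (simp_all add: grade_sign_def)

lemma insertion_twice_zero: "alternating_form \<alpha> \<Longrightarrow> insertion v (insertion v \<alpha>) = (\<lambda>_. 0)"
  using alternating_formD(3)[of \<alpha> "[]"] by (simp add: insertion_def fun_eq_iff)

text \<open>Contracting twice with the same \<open>v\<close> leaves two mixed terms. They cancel
  because contraction anticommutes with \<open>grade_sign\<close>.\<close>

lemma alternating_wedge_alt: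
  assumes "alternating_form \<alpha>" "alternating_form \<beta>"
  shows "alternating_form (wedge_alt \<alpha> \<beta>)"
proof (rule alternating_formI)
  show "multilinear (wedge_alt \<alpha> \<beta>)"
    using assms by (intro multilinear_wedge_alt alternating_formD(1))
  show "wedge_alt \<alpha> \<beta> (us @ v # v # ws) = 0" for us ws v
    using assms
  proof (induction us arbitrary: \<alpha> \<beta>)
    case Nil
    then show ?case
      by (simp add: wedge_alt_Cons insertion_twice_zero insertion_grade_sign wedge_alt_minus)
  next
    case (Cons u us)
    then show ?case by (simp add: wedge_alt_Cons alternating_insertion alternating_grade_sign)
  qed
qed

lemma alternating_lincomb:
  "\<lbrakk>alternating_form \<alpha>; alternating_form \<beta>\<rbrakk> \<Longrightarrow> alternating_form (\<lambda>ws. a * \<alpha> ws + b * \<beta> ws)"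
  by (intro alternating_formI[OF multilinear_lincomb[OF alternating_formD(1) alternating_formD(1)]])
    (simp_all add: alternating_formD(3))

lemma alternating_zero: "alternating_form (\<lambda>_. 0)"
  by (rule alternating_formI[OF multilinear_zero refl])

lemma multilinear_basis_expand:
  fixes \<alpha> :: "'b::euclidean_space list \<Rightarrow> real"
  assumes "multilinear \<alpha>"
  shows "\<alpha> (us @ v # ws) = (\<Sum>b\<in>Basis. (v \<bullet> b) * \<alpha> (us @ b # ws))"
proof -
  have l: "linear (\<lambda>v. \<alpha> (us @ v # ws))" using assms by (simp add: multilinear_def)
  have "\<alpha> (us @ v # ws) = \<alpha> (us @ (\<Sum>b\<in>Basis. (v \<bullet> b) *\<^sub>R b) # ws)" by (simp add: euclidean_representation)
  also have "\<dots> = (\<Sum>b\<in>Basis. (v \<bullet> b) * \<alpha> (us @ b # ws))"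
    using linear_sum[OF l, of "\<lambda>b. (v \<bullet> b) *\<^sub>R b" Basis] linear_cmul[OF l] by simp
  finally show ?thesis .
qed

text \<open>Arguments are replaced by basis vectors one slot at a time, the prefix \<open>us\<close>
  holding those already treated. More than \<open>DIM('b)\<close> basis vectors contain a
  repetition.\<close>

lemma alternating_above_dim:
  fixes \<alpha> :: "'b::euclidean_space list \<Rightarrow> real"
  assumes alt: "alternating_form \<alpha>" and len: "length vs > DIM('b)"
  shows "\<alpha> vs = 0"
proof -
  have basis: "\<alpha> (us @ vs) = 0"
    if "\<And>bs. \<lbrakk>set bs \<subseteq> Basis; length bs = length vs\<rbrakk> \<Longrightarrow> \<alpha> (us @ bs) = 0" for us vs
    using that
  proof (induction vs arbitrary: us)
    case (Cons v vs)
    have "\<alpha> (us @ b # vs) = 0" if "b \<in> Basis" for b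
    proof -
      have "\<alpha> ((us @ [b]) @ vs) = 0"
      proof (rule Cons.IH)
        fix bs :: "'b list" assume "set bs \<subseteq> Basis" "length bs = length vs"
        then show "\<alpha> ((us @ [b]) @ bs) = 0" using Cons.prems[of "b # bs"] that by simp
      qed
      then show ?thesis by simp
    qed
    then show ?case using multilinear_basis_expand[OF alternating_formD(1)[OF alt], of us v vs] by simp
  qed simp
  have "\<alpha> bs = 0" if "set bs \<subseteq> Basis" "length bs = length vs" for bs
  proof -
    have "\<not> distinct bs"
    proof
      assume "distinct bs"
      then have "length bs = card (set bs)" by (simp add: distinct_card)
      also have "\<dots> \<le> DIM('b)" by (rule card_mono) (use that in auto)
      finally show False using that len by simp
    qed
    then obtain xs ys zs y where "bs = xs @ [y] @ ys @ [y] @ zs" using not_distinct_decomp by blast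
    then show ?thesis using alternating_formD(2)[OF alt, of xs y ys zs] by simp
  qed
  then show ?thesis using basis[of vs "[]"] by simp
qed

section \<open>The alternation operator and the Leibniz rule\<close>

definition alternation :: "('b \<Rightarrow> 'b list \<Rightarrow> real) \<Rightarrow> 'b list \<Rightarrow> real" where
  "alternation F vs = (\<Sum>i<length vs. (-1) ^ i * F (vs ! i) (take i vs @ drop (Suc i) vs))"

lemma alternation_Nil [simp]: "alternation F [] = 0"
  by (simp add: alternation_def)

lemma alternation_Cons: "alternation F (v # vs) = F v vs - alternation (\<lambda>u. insertion v (F u)) vs"
  unfolding alternation_def length_Cons
  by (subst sum.lessThan_Suc_shift) (simp add: insertion_def sum_negf)

lemma insertion_alternation:
  "insertion v (alternation F) = (\<lambda>vs. F v vs - alternation (\<lambda>u. insertion v (F u)) vs)"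
  by (simp add: insertion_def[of v "alternation F"] alternation_Cons fun_eq_iff)

lemma alternation_lincomb:
  "alternation (\<lambda>u ws. a * F u ws + b * G u ws) vs = a * alternation F vs + b * alternation G vs"
  by (simp add: alternation_def sum_distrib_left sum.distrib[symmetric] algebra_simps)

lemma alternation_add:
  "alternation (\<lambda>u ws. F u ws + G u ws) vs = alternation F vs + alternation G vs"
  using alternation_lincomb[of 1 F 1 G] by simp

lemma alternation_scale:
  "alternation (\<lambda>u ws. a * F u ws) vs = a * alternation F vs"
  using alternation_lincomb[of a F 0 F] by simp

lemma alternation_diff:
  "alternation (\<lambda>u ws. F u ws - G u ws) vs = alternation F vs - alternation G vs"
  using alternation_lincomb[of 1 F "-1" G] by simp

lemma alternation_minus:
  "alternation (\<lambda>u ws. - F u ws) vs = - alternation F vs"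
  using alternation_lincomb[of "-1" F 0 F] by simp

text \<open>For two equal leading arguments \<open>v\<close> the recursion leaves two copies of
  \<open>F v (v # ws)\<close> with opposite signs and a double contraction, which is zero.\<close>

lemma alternating_alternation:
  assumes lin: "\<And>ws. linear (\<lambda>u. F u ws)" and alt: "\<And>u. alternating_form (F u)"
  shows "alternating_form (alternation F)"
proof (rule alternating_formI)
  have "alternation F (us @ (x + y) # ws) = alternation F (us @ x # ws) + alternation F (us @ y # ws) \<and>
    alternation F (us @ (r *\<^sub>R x) # ws) = r * alternation F (us @ x # ws)" for us x y r ws
    using lin alt
  proof (induction us arbitrary: F)
    case Nil
    have m: "multilinear (F u)" for u using Nil(2) alternating_formD(1) by blast
    show ?case
      using linear_add[OF Nil(1)] linear_cmul[OF Nil(1)]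
      by (simp add: alternation_Cons insertion_add[OF m] insertion_scale[OF m] alternation_add
          alternation_scale algebra_simps)
  next
    case (Cons u us)
    have "linear (\<lambda>w. insertion u (F w) ws)" for ws using Cons.prems(1) by (simp add: insertion_def)
    from Cons.IH[OF this alternating_insertion[OF Cons.prems(2)]]
    show ?case
      using multilinearD[OF alternating_formD(1)[OF Cons.prems(2)]] by (simp add: alternation_Cons algebra_simps)
  qed
  then show "multilinear (alternation F)" by (intro multilinearI) auto
  show "alternation F (us @ v # v # ws) = 0" for us ws v
    using lin alt
  proof (induction us arbitrary: F)
    case Nil
    then show ?case
      by (simp add: alternation_Cons insertion_twice_zero insertion_def[of v "F v"])
        (simp add: alternation_def)
  next
    case (Cons u us)
    have "linear (\<lambda>w. insertion u (F w) ws)" for ws using Cons.prems(1) by (simp add: insertion_def)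
    then have "alternation (\<lambda>w. insertion u (F w)) (us @ v # v # ws) = 0"
      by (rule Cons.IH) (rule alternating_insertion[OF Cons.prems(2)])
    then show ?case using alternating_formD(3)[OF Cons.prems(2), of u us v ws] by (simp add: alternation_Cons)
  qed
qed

text \<open>The algebraic core of \<open>d \<circ> d = 0\<close>. Splitting off the argument
  \<open>v\<close> yields the alternations of \<open>G v\<close> and of
  \<open>\<lambda>u. G u v\<close> with opposite signs; the rest is the same statement for the
  contracted family.\<close>

lemma alternation_symmetric:
  assumes "\<And>u w. G u w = G w u"
  shows "alternation (\<lambda>u. alternation (G u)) vs = 0"
  using assms
proof (induction vs arbitrary: G)
  case (Cons v vs)
  have "alternation (\<lambda>u. insertion v (alternation (G u))) vs =
      alternation (\<lambda>u. G u v) vs - alternation (\<lambda>u. alternation (\<lambda>w. insertion v (G u w))) vs"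
    by (simp add: insertion_alternation alternation_diff)
  also have "alternation (\<lambda>u. alternation (\<lambda>w. insertion v (G u w))) vs = 0"
    by (rule Cons.IH) (simp add: Cons.prems)
  finally show ?case
    using ext[of "\<lambda>u. G u v" "G v", OF Cons.prems] by (simp add: alternation_Cons)
qed simp

text \<open>Each summand hands one argument less to \<open>F\<close>, so its parity is opposite to
  that of the whole list.\<close>

lemma grade_sign_alternation:
  "grade_sign (alternation F) = (\<lambda>vs. - alternation (\<lambda>u. grade_sign (F u)) vs)"
proof
  fix vs show "grade_sign (alternation F) vs = - alternation (\<lambda>u. grade_sign (F u)) vs"
  proof (cases vs)
    case (Cons v us)
    have "(- 1) ^ length (take i vs @ drop (Suc i) vs) = - ((-1 :: real) ^ length vs)" if "i < length vs" for i
    proof -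
      have "Suc (length (take i vs @ drop (Suc i) vs)) = length vs" using that by simp
      then show ?thesis by (metis minus_minus mult_minus1 power_Suc)
    qed
    then show ?thesis
      by (simp add: grade_sign_def alternation_def sum_distrib_left sum_negf[symmetric] mult.assoc mult.left_commute)
  qed (simp add: grade_sign_def)
qed

text \<open>This and the next lemma are the two halves of the Leibniz rule. In the second one the
  differentiating argument has to pass \<open>\<alpha>\<close>, which brings in
  \<open>grade_sign\<close>.\<close>

lemma alternation_wedge_left:
  "alternation (\<lambda>u. wedge_alt (F u) \<beta>) vs = wedge_alt (alternation F) \<beta> vs"
proof (induction vs arbitrary: F \<beta>)
  case (Cons v vs)
  have "wedge_alt (\<lambda>ws. F v ws - alternation (\<lambda>u. insertion v (F u)) ws) \<beta> vs =
      wedge_alt (F v) \<beta> vs - wedge_alt (alternation (\<lambda>u. insertion v (F u))) \<beta> vs"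
    using wedge_alt_lin_left[of 1 "F v" "-1" "alternation (\<lambda>u. insertion v (F u))" \<beta> vs] by simp
  then show ?case
    by (simp add: alternation_Cons insertion_wedge_alt alternation_add Cons wedge_alt_Cons
        insertion_alternation grade_sign_alternation wedge_alt_minus)
qed simp

lemma alternation_wedge_right:
  "alternation (\<lambda>u. wedge_alt \<alpha> (G u)) vs = wedge_alt (grade_sign \<alpha>) (alternation G) vs"
proof (induction vs arbitrary: \<alpha> G)
  case (Cons v vs)
  have "wedge_alt \<alpha> (\<lambda>ws. G v ws - alternation (\<lambda>u. insertion v (G u)) ws) vs =
      wedge_alt \<alpha> (G v) vs - wedge_alt \<alpha> (alternation (\<lambda>u. insertion v (G u))) vs"
    using wedge_alt_lin_right[of \<alpha> 1 "G v" "-1" "alternation (\<lambda>u. insertion v (G u))" vs] by simp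
  then show ?case
    by (simp add: alternation_Cons insertion_wedge_alt alternation_add Cons wedge_alt_Cons
        insertion_alternation insertion_grade_sign wedge_alt_minus)
qed simp

text \<open>The derivative in direction \<open>u\<close> of \<open>y \<mapsto> \<alpha> (map (L y) vs)\<close> for multilinear \<open>\<alpha>\<close>, where \<open>L\<close> stands
  for the value and \<open>B u\<close> for the derivative in direction \<open>u\<close> of the varying linear map.\<close>

primrec slot_deriv ::
  "('b \<Rightarrow> 'b \<Rightarrow> 'c) \<Rightarrow> ('b \<Rightarrow> 'c) \<Rightarrow> ('c list \<Rightarrow> real) \<Rightarrow> 'b \<Rightarrow> 'b list \<Rightarrow> real" where
  "slot_deriv B L \<alpha> u [] = 0"
| "slot_deriv B L \<alpha> u (w # ws) = \<alpha> (B u w # map L ws) + slot_deriv B L (insertion (L w) \<alpha>) u ws"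

text \<open>Moving the differentiated slot to the front costs the sign of the alternation; the
  symmetry of \<open>B\<close> then exchanges the direction \<open>v\<close> with the argument in
  that slot.\<close>

lemma slot_deriv_alternation:
  assumes "alternating_form \<alpha>" and sym: "\<And>u w. B u w = B w u"
  shows "slot_deriv B L \<alpha> v vs = alternation (\<lambda>u ws. \<alpha> (B u v # map L ws)) vs"
  using assms(1)
proof (induction vs arbitrary: \<alpha>)
  case (Cons w ws)
  have "insertion w (\<lambda>ws. \<alpha> (B u v # map L ws)) = (\<lambda>ws. - insertion (L w) \<alpha> (B u v # map L ws))" for u
  proof
    fix ws
    show "insertion w (\<lambda>ws. \<alpha> (B u v # map L ws)) ws = - insertion (L w) \<alpha> (B u v # map L ws)"
      using alternating_formD(4)[OF Cons.prems, of "B u v" "L w" "map L ws"]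
      by (simp add: insertion_def)
  qed
  then show ?case
    using Cons.IH[OF alternating_insertion[OF Cons.prems]] sym[of v w]
    by (simp add: alternation_Cons alternation_minus)
qed simp

text \<open>This removes the second derivatives of a coordinate change. After splitting off the
  argument \<open>v\<close>, the slot derivative in direction \<open>v\<close> cancels against the
  terms with \<open>v\<close> in the differentiated slot, by the previous lemma.\<close>

lemma alternation_slot_deriv:
  assumes "alternating_form \<alpha>" and sym: "\<And>u w. B u w = B w u"
  shows "alternation (slot_deriv B L \<alpha>) vs = 0"
  using assms(1)
proof (induction vs arbitrary: \<alpha>)
  case (Cons v vs)
  have "insertion v (slot_deriv B L \<alpha> u) =
      (\<lambda>ws. \<alpha> (B u v # map L ws) + slot_deriv B L (insertion (L v) \<alpha>) u ws)" for u
    by (simp add: insertion_def fun_eq_iff)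
  then show ?case
    using Cons.IH[OF alternating_insertion[OF Cons.prems]] slot_deriv_alternation[OF Cons.prems sym, where v = v and vs = vs and L = L]
    by (simp add: alternation_Cons alternation_add)
qed simp

text \<open>Lets a contraction with a vector be expanded over the basis when pull-backs are
  differentiated.\<close>

lemma slot_deriv_lincomb:
  "slot_deriv B L (\<lambda>ws. \<Sum>b\<in>S. c b * \<alpha> b ws) u vs = (\<Sum>b\<in>S. c b * slot_deriv B L (\<alpha> b) u vs)"
proof (induction vs arbitrary: \<alpha>)
  case (Cons v vs)
  have "insertion w (\<lambda>ws. \<Sum>b\<in>S. c b * \<alpha> b ws) = (\<lambda>ws. \<Sum>b\<in>S. c b * insertion w (\<alpha> b) ws)" for w
    by (auto simp: insertion_def fun_eq_iff)
  then show ?case by (simp only: slot_deriv.simps Cons distrib_left sum.distrib)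
qed simp

section \<open>Smooth functions\<close>

lemma has_frechet_derivative:
  "f differentiable (at x) \<Longrightarrow> (f has_derivative frechet_derivative f (at x)) (at x)"
  by (simp add: frechet_derivative_works)

lemma frechet_derivative_eqI: "(f has_derivative f') (at x) \<Longrightarrow> frechet_derivative f (at x) = f'"
  by (rule frechet_derivative_at[symmetric])

lemma times_cont_diff_on_Suc_imp: "times_cont_diff_on (Suc k) S f \<Longrightarrow> times_cont_diff_on k S f"
proof (induction k arbitrary: f)
  case 0
  then have "f differentiable_on S"
    by (auto simp: differentiable_on_def intro: differentiable_at_withinI)
  then show ?case by (simp add: differentiable_imp_continuous_on)
qed simp

text \<open>Openness of \<open>S\<close> makes the two functions agree near each point, so their
  derivatives agree there too.\<close>

lemma times_cont_diff_on_cong: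
  assumes "open S" "\<And>x. x \<in> S \<Longrightarrow> f x = g x" "times_cont_diff_on k S f"
  shows "times_cont_diff_on k S g"
  using assms(2,3)
proof (induction k arbitrary: f g)
  case 0
  then show ?case using continuous_on_cong[of S S f g] by simp
next
  case (Suc k)
  have g: "(g has_derivative frechet_derivative f (at x)) (at x)" if "x \<in> S" for x
    using has_derivative_transform_within_open[OF has_frechet_derivative \<open>open S\<close> that] Suc.prems that
    by auto
  have "times_cont_diff_on k S (\<lambda>x. frechet_derivative g (at x) v)" for v
  proof (rule Suc.IH)
    show "frechet_derivative f (at x) v = frechet_derivative g (at x) v" if "x \<in> S" for x
      using frechet_derivative_eqI[OF g[OF that]] by simp
  qed (use Suc.prems(2) in simp)
  then show ?case using g by (auto simp: differentiable_def)
qed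

lemma times_cont_diff_on_const: "times_cont_diff_on k S (\<lambda>_. c)"
proof (induction k arbitrary: c)
  case (Suc k)
  then show ?case by simp
qed simp

lemma times_cont_diff_on_add:
  assumes S: "open S" and "times_cont_diff_on k S f" "times_cont_diff_on k S g"
  shows "times_cont_diff_on k S (\<lambda>x. f x + g x)"
  using assms(2,3)
proof (induction k arbitrary: f g)
  case 0 then show ?case by (simp add: continuous_on_add)
next
  case (Suc k)
  have d: "((\<lambda>x. f x + g x) has_derivative
      (\<lambda>v. frechet_derivative f (at x) v + frechet_derivative g (at x) v)) (at x)" if "x \<in> S" for x
    using Suc.prems that by (intro has_derivative_add has_frechet_derivative) auto
  have "times_cont_diff_on k S (\<lambda>x. frechet_derivative (\<lambda>x. f x + g x) (at x) v)" for v
    by (rule times_cont_diff_on_cong[OF S _ Suc.IH[of "\<lambda>x. frechet_derivative f (at x) v"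
          "\<lambda>x. frechet_derivative g (at x) v"]])
      (use Suc.prems frechet_derivative_eqI[OF d] in auto)
  then show ?case using d by (auto simp: differentiable_def)
qed

lemma times_cont_diff_on_mult:
  fixes f g :: "'b::real_normed_vector \<Rightarrow> real"
  assumes S: "open S" and "times_cont_diff_on k S f" "times_cont_diff_on k S g"
  shows "times_cont_diff_on k S (\<lambda>x. f x * g x)"
  using assms(2,3)
proof (induction k arbitrary: f g)
  case 0 then show ?case by (simp add: continuous_on_mult)
next
  case (Suc k)
  have d: "((\<lambda>x. f x * g x) has_derivative
      (\<lambda>v. f x * frechet_derivative g (at x) v + frechet_derivative f (at x) v * g x)) (at x)"
    if "x \<in> S" for x
    using Suc.prems that by (intro has_derivative_mult has_frechet_derivative) auto
  have k: "times_cont_diff_on k S f" "times_cont_diff_on k S g"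
    using Suc.prems times_cont_diff_on_Suc_imp by blast+
  have "times_cont_diff_on k S (\<lambda>x. f x * frechet_derivative g (at x) v + frechet_derivative f (at x) v * g x)" for v
    by (rule times_cont_diff_on_add[OF S]; rule Suc.IH) (use Suc.prems k in auto)
  then have "times_cont_diff_on k S (\<lambda>x. frechet_derivative (\<lambda>x. f x * g x) (at x) v)" for v
    by (rule times_cont_diff_on_cong[OF S, rotated]) (use frechet_derivative_eqI[OF d] in auto)
  then show ?case using d by (auto simp: differentiable_def)
qed

lemma smooth_on_cong: "\<lbrakk>smooth_on S f; open S; \<And>x. x \<in> S \<Longrightarrow> f x = g x\<rbrakk> \<Longrightarrow> smooth_on S g"
  using times_cont_diff_on_cong unfolding smooth_on_def by metis

lemma smooth_on_const: "smooth_on S (\<lambda>_. c)"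
  by (simp add: smooth_on_def times_cont_diff_on_const)

lemma smooth_on_add: "\<lbrakk>smooth_on S f; smooth_on S g; open S\<rbrakk> \<Longrightarrow> smooth_on S (\<lambda>x. f x + g x)"
  by (simp add: smooth_on_def times_cont_diff_on_add)

lemma smooth_on_mult:
  fixes f g :: "'b::real_normed_vector \<Rightarrow> real"
  shows "\<lbrakk>smooth_on S f; smooth_on S g; open S\<rbrakk> \<Longrightarrow> smooth_on S (\<lambda>x. f x * g x)"
  by (simp add: smooth_on_def times_cont_diff_on_mult)

lemma smooth_on_sum:
  assumes "\<And>i. i \<in> I \<Longrightarrow> smooth_on S (f i)" "open S"
  shows "smooth_on S (\<lambda>x. \<Sum>i\<in>I. f i x)"
  using assms(1)
proof (induction I rule: infinite_finite_induct)
  case (insert i I)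
  then show ?case using smooth_on_add[OF _ _ assms(2), of "f i"] by simp
qed (simp_all add: smooth_on_const)

lemma smooth_on_differentiable: "\<lbrakk>smooth_on S f; x \<in> S\<rbrakk> \<Longrightarrow> f differentiable (at x)"
  unfolding smooth_on_def using times_cont_diff_on.simps(2)[of 0 S f] by blast

lemma smooth_on_frechet_derivative: "smooth_on S f \<Longrightarrow> smooth_on S (\<lambda>x. frechet_derivative f (at x) v)"
  unfolding smooth_on_def using times_cont_diff_on.simps(2)[of _ S f] by blast

section \<open>Symmetry of second derivatives\<close>

text \<open>The mean value theorem in direction \<open>u\<close> turns the second difference into an
  increment of \<open>\<lambda>y. frechet_derivative f (at y) u\<close>. Differentiability of this
  function at \<open>x\<close> alone then compares the increment with \<open>h\<close> times its
  derivative along \<open>w\<close>.\<close>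

lemma second_difference_bound:
  fixes f :: "'b::real_normed_vector \<Rightarrow> real"
  assumes S: "open S" "x \<in> S" and f: "\<And>y. y \<in> S \<Longrightarrow> f differentiable (at y)"
    and g: "(\<lambda>y. frechet_derivative f (at y) u) differentiable (at x)" and e: "e > 0"
  shows "\<exists>d>0. \<forall>h. 0 < h \<and> h < d \<longrightarrow>
    \<bar>f (x + h *\<^sub>R u + h *\<^sub>R w) - f (x + h *\<^sub>R u) - f (x + h *\<^sub>R w) + f x
      - h\<^sup>2 * frechet_derivative (\<lambda>y. frechet_derivative f (at y) u) (at x) w\<bar> \<le> e * h\<^sup>2"
proof -
  define A where "A = frechet_derivative (\<lambda>y. frechet_derivative f (at y) u) (at x)"
  \<comment> \<open>The two error terms involve vectors of norms at most
    \<open>h * (norm u + norm w)\<close> and \<open>h * norm u\<close>; the added 1 makes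
    \<open>N\<close> positive. The same constant keeps all evaluation points within
    \<open>min d1 d2\<close> of \<open>x\<close>.\<close>
  define N where "N = 2 * norm u + norm w + 1"
  have N: "N > 0" by (simp add: N_def add_nonneg_pos)
  have "((\<lambda>y. frechet_derivative f (at y) u) has_derivative A) (at x)"
    unfolding A_def by (rule has_frechet_derivative[OF g])
  then have bl: "bounded_linear A" and "\<exists>d>0. \<forall>y. norm (y - x) < d \<longrightarrow>
      norm (frechet_derivative f (at y) u - frechet_derivative f (at x) u - A (y - x)) \<le> e / N * norm (y - x)"
    unfolding has_derivative_at_alt using divide_pos_pos[OF e N] by blast+
  then obtain d1 where d1: "d1 > 0" "\<And>y. norm (y - x) < d1 \<Longrightarrow>
      \<bar>frechet_derivative f (at y) u - frechet_derivative f (at x) u - A (y - x)\<bar> \<le> e / N * norm (y - x)"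
    by auto
  obtain d2 where d2: "d2 > 0" "ball x d2 \<subseteq> S" using S open_contains_ball by blast
  define d where "d = min d1 d2 / N"
  have "d > 0" using d1(1) d2(1) N by (simp add: d_def)
  moreover have "\<bar>f (x + h *\<^sub>R u + h *\<^sub>R w) - f (x + h *\<^sub>R u) - f (x + h *\<^sub>R w) + f x - h\<^sup>2 * A w\<bar> \<le> e * h\<^sup>2"
    if h: "0 < h" "h < d" for h
  proof -
    have hN: "h * N < min d1 d2" using h N by (simp add: d_def pos_less_divide_eq)
    have small: "norm (t *\<^sub>R u + s *\<^sub>R w) < min d1 d2" "norm (t *\<^sub>R u + s *\<^sub>R w) \<le> h * (norm u + norm w)"
      if "0 \<le> t" "t \<le> h" "0 \<le> s" "s \<le> h" for t s
    proof -
      have "norm (t *\<^sub>R u + s *\<^sub>R w) \<le> t * norm u + s * norm w"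
        using that by (intro norm_triangle_le) simp
      also have "\<dots> \<le> h * norm u + h * norm w" using that by (intro add_mono mult_right_mono) auto
      finally show 1: "norm (t *\<^sub>R u + s *\<^sub>R w) \<le> h * (norm u + norm w)" by (simp add: distrib_left)
      also have "\<dots> \<le> h * N" using h by (simp add: N_def)
      finally show "norm (t *\<^sub>R u + s *\<^sub>R w) < min d1 d2" using hN by simp
    qed
    \<comment> \<open>The summand \<open>0 *\<^sub>R w\<close> is kept so that both terms are
      instances of \<open>der\<close>, for \<open>s = h\<close> and \<open>s = 0\<close>.\<close>
    define \<phi> where "\<phi> t = f (x + (t *\<^sub>R u + h *\<^sub>R w)) - f (x + (t *\<^sub>R u + 0 *\<^sub>R w))" for t
    define g where "g y = frechet_derivative f (at y) u" for y
    have der: "((\<lambda>t. f (x + (t *\<^sub>R u + s *\<^sub>R w))) has_real_derivative g (x + (t *\<^sub>R u + s *\<^sub>R w))) (at t)"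
      if "0 \<le> t" "t \<le> h" "0 \<le> s" "s \<le> h" for t s
    proof -
      let ?y = "x + (t *\<^sub>R u + s *\<^sub>R w)"
      have "dist ?y x < d2" using small(1)[OF that] by (simp add: dist_norm)
      then have "?y \<in> S" using d2(2) by (auto simp: dist_commute)
      then have df: "(f has_derivative frechet_derivative f (at ?y)) (at ?y)"
        using has_frechet_derivative f by blast
      have "((\<lambda>t. x + (t *\<^sub>R u + s *\<^sub>R w)) has_derivative (\<lambda>r. r *\<^sub>R u)) (at t)"
        by (auto intro!: derivative_eq_intros)
      from has_derivative_compose[OF this df]
      have "((\<lambda>t. f (x + (t *\<^sub>R u + s *\<^sub>R w))) has_derivative (\<lambda>r. frechet_derivative f (at ?y) (r *\<^sub>R u))) (at t)" .
      moreover have "frechet_derivative f (at ?y) (r *\<^sub>R u) = g ?y * r" for r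
        using linear_cmul[OF has_derivative_linear[OF df]] by (simp add: g_def mult.commute)
      ultimately show ?thesis by (simp add: has_field_derivative_def)
    qed
    have "(\<phi> has_real_derivative g (x + (t *\<^sub>R u + h *\<^sub>R w)) - g (x + (t *\<^sub>R u + 0 *\<^sub>R w))) (at t)"
      if "0 \<le> t" "t \<le> h" for t
      unfolding \<phi>_def[abs_def] using that h by (intro DERIV_diff der) auto
    then obtain z where z: "0 < z" "z < h"
      "\<phi> h - \<phi> 0 = (h - 0) * (g (x + (z *\<^sub>R u + h *\<^sub>R w)) - g (x + (z *\<^sub>R u + 0 *\<^sub>R w)))"
      using MVT2[of 0 h \<phi> "\<lambda>t. g (x + (t *\<^sub>R u + h *\<^sub>R w)) - g (x + (t *\<^sub>R u + 0 *\<^sub>R w))"] h by auto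
    have bound: "\<bar>g (x + (z *\<^sub>R u + s *\<^sub>R w)) - g x - A (z *\<^sub>R u + s *\<^sub>R w)\<bar> \<le> e / N * norm (z *\<^sub>R u + s *\<^sub>R w)"
      if "0 \<le> s" "s \<le> h" for s
      using d1(2)[of "x + (z *\<^sub>R u + s *\<^sub>R w)"] small(1)[of z s] z that by (simp add: g_def)
    have "A (z *\<^sub>R u + h *\<^sub>R w) - A (z *\<^sub>R u + 0 *\<^sub>R w) = h * A w"
      using bounded_linear.linear[OF bl] by (simp add: linear_add linear_cmul)
    then have "\<bar>g (x + (z *\<^sub>R u + h *\<^sub>R w)) - g (x + (z *\<^sub>R u + 0 *\<^sub>R w)) - h * A w\<bar> \<le>
        e / N * norm (z *\<^sub>R u + h *\<^sub>R w) + e / N * norm (z *\<^sub>R u + 0 *\<^sub>R w)"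
      using bound[of h] bound[of 0] h by linarith
    also have "\<dots> = e / N * (norm (z *\<^sub>R u + h *\<^sub>R w) + norm (z *\<^sub>R u + 0 *\<^sub>R w))"
      by (simp add: distrib_left)
    also have "\<dots> \<le> e / N * (h * N)"
    proof (rule mult_left_mono)
      have "norm (z *\<^sub>R u + 0 *\<^sub>R w) \<le> h * norm u" using z h by (simp add: mult_right_mono)
      moreover have "norm (z *\<^sub>R u + h *\<^sub>R w) \<le> h * (norm u + norm w)" using small(2)[of z h] z h by simp
      ultimately have "norm (z *\<^sub>R u + h *\<^sub>R w) + norm (z *\<^sub>R u + 0 *\<^sub>R w) \<le> h * (2 * norm u + norm w)"
        by (simp add: algebra_simps)
      also have "\<dots> \<le> h * N" using h by (simp add: N_def)
      finally show "norm (z *\<^sub>R u + h *\<^sub>R w) + norm (z *\<^sub>R u + 0 *\<^sub>R w) \<le> h * N" .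
    qed (use e N in simp)
    also have "\<dots> = e * h" using N by simp
    finally have *: "\<bar>g (x + (z *\<^sub>R u + h *\<^sub>R w)) - g (x + (z *\<^sub>R u + 0 *\<^sub>R w)) - h * A w\<bar> \<le> e * h" .
    have "f (x + h *\<^sub>R u + h *\<^sub>R w) - f (x + h *\<^sub>R u) - f (x + h *\<^sub>R w) + f x = \<phi> h - \<phi> 0"
      by (simp add: \<phi>_def add.assoc)
    then have eq: "f (x + h *\<^sub>R u + h *\<^sub>R w) - f (x + h *\<^sub>R u) - f (x + h *\<^sub>R w) + f x - h\<^sup>2 * A w =
        h * (g (x + (z *\<^sub>R u + h *\<^sub>R w)) - g (x + (z *\<^sub>R u + 0 *\<^sub>R w)) - h * A w)"
      using z(3) by (simp add: algebra_simps power2_eq_square)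
    show ?thesis
      unfolding eq using mult_left_mono[OF *, of h] h by (simp add: abs_mult power2_eq_square mult.left_commute)
  qed
  ultimately show ?thesis unfolding A_def by blast
qed

text \<open>The second difference is symmetric in \<open>u\<close> and \<open>w\<close>, yet divided
  by the square of \<open>h\<close> it approximates both mixed derivatives.\<close>

lemma second_derivative_symmetric_real:
  fixes f :: "'b::real_normed_vector \<Rightarrow> real"
  assumes S: "open S" "x \<in> S" and f: "\<And>y. y \<in> S \<Longrightarrow> f differentiable (at y)"
    and g: "\<And>v. (\<lambda>y. frechet_derivative f (at y) v) differentiable (at x)"
  shows "frechet_derivative (\<lambda>y. frechet_derivative f (at y) u) (at x) w =
    frechet_derivative (\<lambda>y. frechet_derivative f (at y) w) (at x) u" (is "?A = ?B")
proof (rule ccontr)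
  assume "?A \<noteq> ?B"
  \<comment> \<open>A third of the gap: two errors of size \<open>e\<close> cannot bridge
    it.\<close>
  define e where "e = \<bar>?A - ?B\<bar> / 3"
  have e: "e > 0" using \<open>?A \<noteq> ?B\<close> by (simp add: e_def)
  define q where "q h = f (x + h *\<^sub>R u + h *\<^sub>R w) - f (x + h *\<^sub>R u) - f (x + h *\<^sub>R w) + f x" for h
  obtain d1 where d1: "d1 > 0" "\<And>h. \<lbrakk>0 < h; h < d1\<rbrakk> \<Longrightarrow> \<bar>q h - h\<^sup>2 * ?A\<bar> \<le> e * h\<^sup>2"
    using second_difference_bound[OF S f g e, of u w] unfolding q_def by blast
  have q: "q h = f (x + h *\<^sub>R w + h *\<^sub>R u) - f (x + h *\<^sub>R w) - f (x + h *\<^sub>R u) + f x" for h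
    by (simp add: q_def algebra_simps)
  obtain d2 where d2: "d2 > 0" "\<And>h. \<lbrakk>0 < h; h < d2\<rbrakk> \<Longrightarrow> \<bar>q h - h\<^sup>2 * ?B\<bar> \<le> e * h\<^sup>2"
    using second_difference_bound[OF S f g e, of w u] unfolding q by blast
  define h where "h = min d1 d2 / 2"
  have h: "0 < h" "h < d1" "h < d2" using d1(1) d2(1) by (auto simp: h_def)
  have "\<bar>h\<^sup>2 * (?A - ?B)\<bar> \<le> 2 * e * h\<^sup>2"
    using d1(2)[of h] d2(2)[of h] h by (simp add: algebra_simps)
  moreover have "\<bar>h\<^sup>2 * (?A - ?B)\<bar> = h\<^sup>2 * \<bar>?A - ?B\<bar>" by (simp add: abs_mult)
  ultimately have "h\<^sup>2 * \<bar>?A - ?B\<bar> \<le> h\<^sup>2 * (2 * e)" by (simp add: mult.commute)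
  then have "\<bar>?A - ?B\<bar> \<le> 2 * e" using h by simp
  then show False using e by (simp add: e_def)
qed

lemma frechet_derivative_inner:
  assumes "f differentiable (at x)"
  shows "frechet_derivative (\<lambda>y. f y \<bullet> b) (at x) u = frechet_derivative f (at x) u \<bullet> b"
    and "(\<lambda>y. f y \<bullet> b) differentiable (at x)"
proof -
  have "((\<lambda>y. f y \<bullet> b) has_derivative (\<lambda>u. frechet_derivative f (at x) u \<bullet> b)) (at x)"
    by (rule has_derivative_inner_left[OF has_frechet_derivative[OF assms]])
  then show "frechet_derivative (\<lambda>y. f y \<bullet> b) (at x) u = frechet_derivative f (at x) u \<bullet> b"
    and "(\<lambda>y. f y \<bullet> b) differentiable (at x)"
    using frechet_derivative_eqI by (fastforce, auto simp: differentiable_def)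
qed

lemma second_derivative_symmetric:
  fixes f :: "'b::real_normed_vector \<Rightarrow> 'c::euclidean_space"
  assumes S: "open S" "x \<in> S" and f: "smooth_on S f"
  shows "frechet_derivative (\<lambda>y. frechet_derivative f (at y) u) (at x) w =
    frechet_derivative (\<lambda>y. frechet_derivative f (at y) w) (at x) u"
proof (rule euclidean_eqI)
  fix b :: 'c assume "b \<in> Basis"
  have fd: "f differentiable (at y)" if "y \<in> S" for y using smooth_on_differentiable[OF f that] .
  have gd: "(\<lambda>y. frechet_derivative f (at y) v) differentiable (at x)" for v
    using smooth_on_differentiable[OF smooth_on_frechet_derivative[OF f] S(2)] .
  have comp: "((\<lambda>y. frechet_derivative (\<lambda>z. f z \<bullet> b) (at y) v) has_derivative
      (\<lambda>w. frechet_derivative (\<lambda>y. frechet_derivative f (at y) v) (at x) w \<bullet> b)) (at x)" for v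
  proof (rule has_derivative_transform_within_open[OF has_derivative_inner_left[OF has_frechet_derivative[OF gd]] S])
    show "frechet_derivative f (at y) v \<bullet> b = frechet_derivative (\<lambda>z. f z \<bullet> b) (at y) v" if "y \<in> S" for y
      using frechet_derivative_inner(1)[OF fd[OF that]] by simp
  qed
  have "frechet_derivative (\<lambda>y. frechet_derivative (\<lambda>z. f z \<bullet> b) (at y) u) (at x) w =
      frechet_derivative (\<lambda>y. frechet_derivative (\<lambda>z. f z \<bullet> b) (at y) w) (at x) u"
    by (rule second_derivative_symmetric_real[OF S])
      (use frechet_derivative_inner(2)[OF fd] comp in \<open>auto simp: differentiable_def\<close>)
  then show "frechet_derivative (\<lambda>y. frechet_derivative f (at y) u) (at x) w \<bullet> b =
      frechet_derivative (\<lambda>y. frechet_derivative f (at y) w) (at x) u \<bullet> b"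
    using frechet_derivative_eqI[OF comp] by simp
qed

section \<open>Exterior derivatives in coordinates\<close>

text \<open>Curried with the direction before the remaining arguments, so that
  \<open>coord_deriv \<omega> x\<close> is an input for \<open>alternation\<close>.\<close>

definition coord_deriv :: "('b::real_normed_vector \<Rightarrow> 'b list \<Rightarrow> real) \<Rightarrow> 'b \<Rightarrow> 'b \<Rightarrow> 'b list \<Rightarrow> real" where
  "coord_deriv \<omega> x u ws = frechet_derivative (\<lambda>y. \<omega> y ws) (at x) u"

lemma coord_deriv_eqI: "((\<lambda>y. \<omega> y ws) has_derivative f') (at x) \<Longrightarrow> coord_deriv \<omega> x u ws = f' u"
  using frechet_derivative_eqI by (fastforce simp: coord_deriv_def)

lemma has_coord_deriv:
  "(\<lambda>y. \<omega> y ws) differentiable (at x) \<Longrightarrow> ((\<lambda>y. \<omega> y ws) has_derivative (\<lambda>u. coord_deriv \<omega> x u ws)) (at x)"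
  using has_frechet_derivative by (auto simp: coord_deriv_def)

lemma linear_coord_deriv: "(\<lambda>y. \<omega> y ws) differentiable (at x) \<Longrightarrow> linear (\<lambda>u. coord_deriv \<omega> x u ws)"
  using has_coord_deriv has_derivative_linear by blast

text \<open>The identities defining an alternating form hold on the whole open set, so they may be
  differentiated.\<close>

lemma alternating_coord_deriv:
  assumes S: "open S" "x \<in> S" and alt: "\<And>y. y \<in> S \<Longrightarrow> alternating_form (\<omega> y)"
    and diff: "\<And>ws. (\<lambda>y. \<omega> y ws) differentiable (at x)"
  shows "alternating_form (coord_deriv \<omega> x u)"
proof (rule alternating_formI[OF multilinearI])
  fix us ws and v w :: 'a and r :: real
  note d = has_coord_deriv[OF diff]
  have "((\<lambda>y. \<omega> y (us @ (v + w) # ws)) has_derivative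
      (\<lambda>u. coord_deriv \<omega> x u (us @ v # ws) + coord_deriv \<omega> x u (us @ w # ws))) (at x)"
    by (rule has_derivative_transform_within_open[OF has_derivative_add[OF d d] S])
      (simp add: multilinearD(1)[OF alternating_formD(1)[OF alt]])
  from coord_deriv_eqI[of \<omega> "us @ (v + w) # ws", OF this]
  show "coord_deriv \<omega> x u (us @ (v + w) # ws) =
      coord_deriv \<omega> x u (us @ v # ws) + coord_deriv \<omega> x u (us @ w # ws)" .
  have "((\<lambda>y. \<omega> y (us @ (r *\<^sub>R v) # ws)) has_derivative (\<lambda>u. r * coord_deriv \<omega> x u (us @ v # ws))) (at x)"
    by (rule has_derivative_transform_within_open[OF has_derivative_mult_right[OF d] S])
      (simp add: multilinearD(2)[OF alternating_formD(1)[OF alt]])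
  from coord_deriv_eqI[of \<omega> "us @ (r *\<^sub>R v) # ws", OF this]
  show "coord_deriv \<omega> x u (us @ (r *\<^sub>R v) # ws) = r * coord_deriv \<omega> x u (us @ v # ws)" .
  have "((\<lambda>y. \<omega> y (us @ v # v # ws)) has_derivative (\<lambda>u. 0)) (at x)"
    by (rule has_derivative_transform_within_open[OF has_derivative_const[of 0] S])
      (simp add: alternating_formD(3)[OF alt])
  from coord_deriv_eqI[of \<omega> "us @ v # v # ws", OF this] show "coord_deriv \<omega> x u (us @ v # v # ws) = 0" .
qed

lemma coord_deriv_wedge:
  assumes "\<And>ws. (\<lambda>y. \<eta> y ws) differentiable (at x)" "\<And>ws. (\<lambda>y. \<omega> y ws) differentiable (at x)"
  shows "((\<lambda>y. wedge_alt (\<eta> y) (\<omega> y) ws) has_derivative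
    (\<lambda>u. wedge_alt (coord_deriv \<eta> x u) (\<omega> x) ws + wedge_alt (\<eta> x) (coord_deriv \<omega> x u) ws)) (at x)"
proof -
  note d = has_coord_deriv[OF assms(1)] has_coord_deriv[OF assms(2)]
  show ?thesis
    unfolding wedge_alt_def sum.distrib[symmetric]
    by (rule has_derivative_sum, rule has_derivative_eq_rhs,
        (rule has_derivative_mult has_derivative_mult_right d)+) (auto simp: algebra_simps)
qed

lemma alternation_map:
  "alternation F (map L vs) = alternation (\<lambda>u ws. F (L u) (map L ws)) vs"
  by (simp add: alternation_def take_map drop_map)

text \<open>The vectors \<open>L y w\<close> vary with \<open>y\<close>, so contracting with them
  does not give a fixed form to induct on. Expanding the first argument over the basis moves this
  variation into scalar coefficients. The product rule applies, and the derivatives of the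
  coefficients form the first slot term.\<close>

lemma pullback_has_derivative:
  fixes g :: "'c::euclidean_space \<Rightarrow> 'c list \<Rightarrow> real" and t :: "'b::real_normed_vector \<Rightarrow> 'c"
  assumes t: "(t has_derivative t') (at x)" and L: "\<And>w. ((\<lambda>y. L y w) has_derivative L' w) (at x)"
    and g: "\<And>z. multilinear (g z)" and dg: "\<And>ws. (\<lambda>z. g z ws) differentiable (at (t x))"
    and dgm: "\<And>u. multilinear (coord_deriv g (t x) u)"
  shows "((\<lambda>y. g (t y) (map (L y) vs)) has_derivative
    (\<lambda>u. coord_deriv g (t x) (t' u) (map (L x) vs) + slot_deriv (\<lambda>u w. L' w u) (L x) (g (t x)) u vs)) (at x)"
  using g dg dgm
proof (induction vs arbitrary: g)
  case Nil
  show ?case using has_derivative_compose[OF t has_coord_deriv[OF Nil(2)]] by simp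
next
  case (Cons w vs)
  have ins: "coord_deriv (\<lambda>z. insertion b (g z)) (t x) u = insertion b (coord_deriv g (t x) u)" for b u
    by (simp add: coord_deriv_def insertion_def fun_eq_iff)
  have IH: "((\<lambda>y. insertion b (g (t y)) (map (L y) vs)) has_derivative
      (\<lambda>u. insertion b (coord_deriv g (t x) (t' u)) (map (L x) vs) +
        slot_deriv (\<lambda>u w. L' w u) (L x) (insertion b (g (t x))) u vs)) (at x)" for b
  proof -
    have "(\<lambda>z. insertion b (g z) ws) differentiable (at (t x))" for ws
      using Cons.prems(2)[of "b # ws"] by (simp add: insertion_def)
    then show ?thesis
      using Cons.IH[of "\<lambda>z. insertion b (g z)"] Cons.prems by (simp add: multilinear_insertion ins)
  qed
  have expand: "g z (v # ws) = (\<Sum>b\<in>Basis. (v \<bullet> b) * insertion b (g z) ws)" for z v ws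
    using multilinear_basis_expand[OF Cons.prems(1), of z "[]" v ws] by (simp add: insertion_def)
  have expand_ins: "insertion v (g z) = (\<lambda>ws. \<Sum>b\<in>Basis. (v \<bullet> b) * insertion b (g z) ws)" for z v
    using expand by (simp add: insertion_def[of v] fun_eq_iff)
  have expand': "coord_deriv g (t x) u (v # ws) =
      (\<Sum>b\<in>Basis. (v \<bullet> b) * insertion b (coord_deriv g (t x) u) ws)" for u v ws
    using multilinear_basis_expand[OF Cons.prems(3), of u "[]" v ws] by (simp add: insertion_def)
  have "((\<lambda>y. \<Sum>b\<in>Basis. (L y w \<bullet> b) * insertion b (g (t y)) (map (L y) vs)) has_derivative
      (\<lambda>u. \<Sum>b\<in>Basis. (L x w \<bullet> b) * (insertion b (coord_deriv g (t x) (t' u)) (map (L x) vs) +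
        slot_deriv (\<lambda>u w. L' w u) (L x) (insertion b (g (t x))) u vs) +
        (L' w u \<bullet> b) * insertion b (g (t x)) (map (L x) vs))) (at x)"
    by (intro has_derivative_sum has_derivative_mult has_derivative_inner_left L IH)
  moreover have "(\<Sum>b\<in>Basis. (L x w \<bullet> b) * (insertion b (coord_deriv g (t x) (t' u)) (map (L x) vs) +
        slot_deriv (\<lambda>u w. L' w u) (L x) (insertion b (g (t x))) u vs) +
        (L' w u \<bullet> b) * insertion b (g (t x)) (map (L x) vs)) =
      coord_deriv g (t x) (t' u) (map (L x) (w # vs)) + slot_deriv (\<lambda>u w. L' w u) (L x) (g (t x)) u (w # vs)" for u
  proof -
    have "slot_deriv (\<lambda>u w. L' w u) (L x) (insertion (L x w) (g (t x))) u vs =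
        (\<Sum>b\<in>Basis. (L x w \<bullet> b) * slot_deriv (\<lambda>u w. L' w u) (L x) (insertion b (g (t x))) u vs)"
      unfolding expand_ins[of "L x w"] by (rule slot_deriv_lincomb)
    moreover have "g (t x) (L' w u # map (L x) vs) = (\<Sum>b\<in>Basis. (L' w u \<bullet> b) * insertion b (g (t x)) (map (L x) vs))"
      by (rule expand)
    moreover have "coord_deriv g (t x) (t' u) (map (L x) (w # vs)) =
        (\<Sum>b\<in>Basis. (L x w \<bullet> b) * insertion b (coord_deriv g (t x) (t' u)) (map (L x) vs))"
      unfolding list.map by (rule expand')
    ultimately show ?thesis by (simp only: slot_deriv.simps distrib_left sum.distrib)
  qed
  ultimately show ?case unfolding list.map expand by simp
qed

section \<open>Differential forms on a smooth manifold\<close>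

locale atlas =
  fixes T :: "'a topology" and A :: "('a, 'b::euclidean_space) chart set"
  assumes manifold: "smooth_manifold T A"
begin

lemma chart_open: "c \<in> A \<Longrightarrow> open (chart_img c)"
  using manifold by (auto simp: smooth_manifold_def)

lemma overlap_open:
  assumes c: "c \<in> A" and c': "c' \<in> A"
  shows "open (chart_map c ` (chart_dom c \<inter> chart_dom c'))"
proof -
  have hom: "homeomorphic_map (subtopology T (chart_dom c)) (top_of_set (chart_img c)) (chart_map c)"
    and o: "openin T (chart_dom c)" "openin T (chart_dom c')"
    using manifold c c' by (auto simp: smooth_manifold_def)
  have "openin (subtopology T (chart_dom c)) (chart_dom c \<inter> chart_dom c')"
    using o by (auto simp: openin_subtopology)
  then have "openin (top_of_set (chart_img c)) (chart_map c ` (chart_dom c \<inter> chart_dom c'))"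
    using homeomorphic_imp_open_map[OF hom] by (auto simp: open_map_def)
  then show ?thesis using chart_open[OF c] by (rule openin_open_trans)
qed

lemma transition_eq:
  assumes c: "c \<in> A" and m: "m \<in> chart_dom c"
  shows "transition c c' (chart_map c m) = chart_map c' m"
proof -
  have hom: "homeomorphic_map (subtopology T (chart_dom c)) (top_of_set (chart_img c)) (chart_map c)"
    and o: "openin T (chart_dom c)"
    using manifold c by (auto simp: smooth_manifold_def)
  have "topspace (subtopology T (chart_dom c)) = chart_dom c"
    using openin_subset[OF o] by (simp add: inf.absorb2)
  then have "inj_on (chart_map c) (chart_dom c)"
    using homeomorphic_imp_injective_map[OF hom] by simp
  then show ?thesis using m by (simp add: transition_def)
qed

lemma transition_smooth:
  "\<lbrakk>c \<in> A; c' \<in> A\<rbrakk> \<Longrightarrow> smooth_on (chart_map c ` (chart_dom c \<inter> chart_dom c')) (transition c c')"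
  using manifold by (auto simp: smooth_manifold_def)

lemma formsD:
  assumes "\<omega> \<in> forms A I"
  shows "\<not> (c \<in> A \<and> x \<in> chart_img c) \<Longrightarrow> \<omega> c x = (\<lambda>_. 0)"
    and "alternating_form (\<omega> c x)"
    and "c \<in> A \<Longrightarrow> smooth_on (chart_img c) (\<lambda>x. \<omega> c x vs)"
    and "\<lbrakk>c \<in> A; c' \<in> A; m \<in> chart_dom c; m \<in> chart_dom c'\<rbrakk> \<Longrightarrow> \<omega> c (chart_map c m) vs =
        \<omega> c' (chart_map c' m) (map (frechet_derivative (transition c c') (at (chart_map c m))) vs)"
    and "length vs \<notin> I \<Longrightarrow> \<omega> c x vs = 0"
proof -
  show 0: "\<not> (c \<in> A \<and> x \<in> chart_img c) \<Longrightarrow> \<omega> c x = (\<lambda>_. 0)"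
    and "c \<in> A \<Longrightarrow> smooth_on (chart_img c) (\<lambda>x. \<omega> c x vs)"
    and "length vs \<notin> I \<Longrightarrow> \<omega> c x vs = 0"
    using assms unfolding forms_def by blast+
  show "alternating_form (\<omega> c x)"
    using assms 0 alternating_zero by (cases "c \<in> A \<and> x \<in> chart_img c") (auto simp: forms_def)
  show "\<lbrakk>c \<in> A; c' \<in> A; m \<in> chart_dom c; m \<in> chart_dom c'\<rbrakk> \<Longrightarrow> \<omega> c (chart_map c m) vs =
        \<omega> c' (chart_map c' m) (map (frechet_derivative (transition c c') (at (chart_map c m))) vs)"
    using assms unfolding forms_def by blast
qed

lemma formsI:
  assumes "\<And>c x. \<not> (c \<in> A \<and> x \<in> chart_img c) \<Longrightarrow> \<omega> c x = (\<lambda>_. 0)"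
    and "\<And>c x. \<lbrakk>c \<in> A; x \<in> chart_img c\<rbrakk> \<Longrightarrow> alternating_form (\<omega> c x)"
    and "\<And>c vs. c \<in> A \<Longrightarrow> smooth_on (chart_img c) (\<lambda>x. \<omega> c x vs)"
    and "\<And>c c' m vs. \<lbrakk>c \<in> A; c' \<in> A; m \<in> chart_dom c; m \<in> chart_dom c'\<rbrakk> \<Longrightarrow> \<omega> c (chart_map c m) vs =
        \<omega> c' (chart_map c' m) (map (frechet_derivative (transition c c') (at (chart_map c m))) vs)"
    and "\<And>c x vs. length vs \<notin> I \<Longrightarrow> \<omega> c x vs = 0"
  shows "\<omega> \<in> forms A I"
  unfolding forms_def mem_Collect_eq
  by (intro conjI allI ballI impI) (erule assms(1), erule (1) assms(2), erule assms(3), erule IntE, erule (3) assms(4), erule assms(5))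

lemma forms_differentiable:
  "\<lbrakk>\<omega> \<in> forms A I; c \<in> A; x \<in> chart_img c\<rbrakk> \<Longrightarrow> (\<lambda>y. \<omega> c y ws) differentiable (at x)"
  using smooth_on_differentiable[OF formsD(3)] by blast

lemma forms_mono:
  assumes "I \<subseteq> J"
  shows "forms A I \<subseteq> forms A J"
proof
  fix \<omega> assume "\<omega> \<in> forms A I"
  note d = formsD[OF this]
  show "\<omega> \<in> forms A J"
    by (rule formsI) (erule d(1), rule d(2), erule d(3), erule (3) d(4), rule d(5), use assms in blast)
qed

lemma forms_lincomb:
  assumes \<omega>: "\<omega> \<in> forms A I" and \<eta>: "\<eta> \<in> forms A I"
  shows "(\<lambda>c x vs. a * \<omega> c x vs + b * \<eta> c x vs) \<in> forms A I"
proof (rule formsI)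
  fix c c' m vs assume c: "c \<in> A" "c' \<in> A" "m \<in> chart_dom c" "m \<in> chart_dom c'"
  show "a * \<omega> c (chart_map c m) vs + b * \<eta> c (chart_map c m) vs =
      a * \<omega> c' (chart_map c' m) (map (frechet_derivative (transition c c') (at (chart_map c m))) vs) +
      b * \<eta> c' (chart_map c' m) (map (frechet_derivative (transition c c') (at (chart_map c m))) vs)"
    by (simp only: formsD(4)[OF \<omega> c, of vs] formsD(4)[OF \<eta> c, of vs])
next
  fix c vs assume "c \<in> A"
  then show "smooth_on (chart_img c) (\<lambda>x. a * \<omega> c x vs + b * \<eta> c x vs)"
    by (intro smooth_on_add smooth_on_mult smooth_on_const formsD(3)[OF \<omega>] formsD(3)[OF \<eta>] chart_open)
next
  fix c x show "alternating_form (\<lambda>vs. a * \<omega> c x vs + b * \<eta> c x vs)"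
    by (rule alternating_lincomb[OF formsD(2)[OF \<omega>] formsD(2)[OF \<eta>]])
next
  fix c x assume "\<not> (c \<in> A \<and> x \<in> chart_img c)"
  from formsD(1)[OF \<omega> this] formsD(1)[OF \<eta> this]
  show "(\<lambda>vs. a * \<omega> c x vs + b * \<eta> c x vs) = (\<lambda>_. 0)" by simp
next
  fix c x and vs :: "'b list" assume "length vs \<notin> I"
  from formsD(5)[OF \<omega> this] formsD(5)[OF \<eta> this]
  show "a * \<omega> c x vs + b * \<eta> c x vs = 0" by simp
qed

lemma forms_zero: "(\<lambda>_ _ _. 0) \<in> forms A I"
  by (rule formsI) (auto simp: alternating_zero smooth_on_const)

lemma forms_above_dim:
  assumes "\<omega> \<in> forms A I" "\<And>k. k \<in> I \<Longrightarrow> k > DIM('b)"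
  shows "\<omega> = (\<lambda>_ _ _. 0)"
proof (intro ext)
  fix c x vs show "\<omega> c x vs = 0"
    using alternating_above_dim[OF formsD(2)[OF assms(1)]] formsD(5)[OF assms(1)] assms(2) by blast
qed

section \<open>The exterior derivative and the wedge product on the manifold\<close>

lemma ext_deriv_eq:
  "\<lbrakk>c \<in> A; x \<in> chart_img c\<rbrakk> \<Longrightarrow> ext_deriv A \<omega> c x = alternation (coord_deriv (\<omega> c) x)"
  by (auto simp: ext_deriv_def alternation_def coord_deriv_def fun_eq_iff)

lemma ext_deriv_outside: "\<not> (c \<in> A \<and> x \<in> chart_img c) \<Longrightarrow> ext_deriv A \<omega> c x = (\<lambda>_. 0)"
  by (auto simp: ext_deriv_def)

lemma form_coord_deriv_alternating:
  assumes "\<omega> \<in> forms A I" "c \<in> A" "x \<in> chart_img c"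
  shows "alternating_form (coord_deriv (\<omega> c) x u)"
  by (rule alternating_coord_deriv[OF chart_open[OF assms(2)] assms(3)])
    (use formsD(2)[OF assms(1)] forms_differentiable[OF assms] in auto)

lemma ext_deriv_natural:
  assumes \<omega>: "\<omega> \<in> forms A I" and c: "c \<in> A" and c': "c' \<in> A" and m: "m \<in> chart_dom c" "m \<in> chart_dom c'"
  shows "ext_deriv A \<omega> c (chart_map c m) vs = ext_deriv A \<omega> c' (chart_map c' m)
      (map (frechet_derivative (transition c c') (at (chart_map c m))) vs)"
proof -
  define U where "U = chart_map c ` (chart_dom c \<inter> chart_dom c')"
  define t where "t = transition c c'"
  define L where "L y = frechet_derivative t (at y)" for y
  let ?x = "chart_map c m" and ?z = "chart_map c' m"
  define B where "B u w = frechet_derivative (\<lambda>y. L y w) (at ?x) u" for u w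
  have U: "open U" "?x \<in> U" using overlap_open[OF c c'] m by (auto simp: U_def)
  have tx: "t ?x = ?z" using transition_eq[OF c m(1)] by (simp add: t_def)
  have img: "?x \<in> chart_img c" "?z \<in> chart_img c'" using m by (auto simp: chart_img_def)
  have ts: "smooth_on U t" using transition_smooth[OF c c'] by (simp add: U_def t_def)
  have td: "(t has_derivative L ?x) (at ?x)"
    unfolding L_def by (rule has_frechet_derivative[OF smooth_on_differentiable[OF ts U(2)]])
  have Ld: "((\<lambda>y. L y w) has_derivative (\<lambda>u. B u w)) (at ?x)" for w
    unfolding B_def L_def
    by (rule has_frechet_derivative[OF smooth_on_differentiable[OF smooth_on_frechet_derivative[OF ts] U(2)]])
  have sym: "B u w = B w u" for u w
    unfolding B_def L_def by (rule second_derivative_symmetric[OF U ts, symmetric])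
  have pull: "((\<lambda>y. \<omega> c' (t y) (map (L y) ws)) has_derivative
      (\<lambda>u. coord_deriv (\<omega> c') ?z (L ?x u) (map (L ?x) ws) + slot_deriv B (L ?x) (\<omega> c' ?z) u ws)) (at ?x)" for ws
    using pullback_has_derivative[OF td Ld, of "\<omega> c'"] alternating_formD(1)[OF formsD(2)[OF \<omega>]]
      forms_differentiable[OF \<omega> c' img(2)] alternating_formD(1)[OF form_coord_deriv_alternating[OF \<omega> c' img(2)]]
    by (simp add: tx)
  \<comment> \<open>The transformation law holds on the open overlap \<open>U\<close>, not just at
    the point, so both sides have the same derivative there.\<close>
  have eq: "\<omega> c' (t y) (map (L y) ws) = \<omega> c y ws" if "y \<in> U" for y ws
  proof -
    obtain m' where "m' \<in> chart_dom c" "m' \<in> chart_dom c'" "y = chart_map c m'"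
      using \<open>y \<in> U\<close> by (auto simp: U_def)
    then show ?thesis
      using formsD(4)[OF \<omega> c c', of m' ws] transition_eq[OF c, of m' c'] by (simp add: t_def L_def)
  qed
  have "coord_deriv (\<omega> c) ?x u ws =
      coord_deriv (\<omega> c') ?z (L ?x u) (map (L ?x) ws) + slot_deriv B (L ?x) (\<omega> c' ?z) u ws" for u ws
    by (rule coord_deriv_eqI, rule has_derivative_transform_within_open[OF pull U]) (rule eq)
  then have "coord_deriv (\<omega> c) ?x = (\<lambda>u ws. coord_deriv (\<omega> c') ?z (L ?x u) (map (L ?x) ws) +
      slot_deriv B (L ?x) (\<omega> c' ?z) u ws)" by (intro ext)
  then have "ext_deriv A \<omega> c ?x vs = alternation (coord_deriv (\<omega> c') ?z) (map (L ?x) vs)"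
    using ext_deriv_eq[OF c img(1), of \<omega>] alternation_slot_deriv[OF formsD(2)[OF \<omega>] sym]
    by (simp add: alternation_add alternation_map)
  then show ?thesis using ext_deriv_eq[OF c' img(2), of \<omega>] by (simp add: L_def t_def)
qed

lemma ext_deriv_forms:
  assumes \<omega>: "\<omega> \<in> forms A I" and IJ: "\<And>k. k \<in> I \<Longrightarrow> Suc k \<in> J"
  shows "ext_deriv A \<omega> \<in> forms A J"
proof (rule formsI)
  fix c x assume c: "c \<in> A" "x \<in> chart_img c"
  show "alternating_form (ext_deriv A \<omega> c x)"
    unfolding ext_deriv_eq[OF c]
    by (rule alternating_alternation)
      (use linear_coord_deriv forms_differentiable[OF \<omega> c] form_coord_deriv_alternating[OF \<omega> c] in auto)
next
  fix c vs assume c: "c \<in> A"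
  have "smooth_on (chart_img c) (\<lambda>x. \<Sum>i<length vs. (-1) ^ i *
      frechet_derivative (\<lambda>y. \<omega> c y (take i vs @ drop (Suc i) vs)) (at x) (vs ! i))"
    by (intro smooth_on_sum smooth_on_mult smooth_on_const smooth_on_frechet_derivative
        formsD(3)[OF \<omega>] chart_open c)
  then show "smooth_on (chart_img c) (\<lambda>x. ext_deriv A \<omega> c x vs)"
    by (rule smooth_on_cong) (use c chart_open in \<open>auto simp: ext_deriv_def\<close>)
next
  fix c x and vs :: "'b list" assume len: "length vs \<notin> J"
  have "frechet_derivative (\<lambda>y. \<omega> c y (take i vs @ drop (Suc i) vs)) (at x) (vs ! i) = 0" if "i < length vs" for i
  proof -
    have "Suc (length (take i vs @ drop (Suc i) vs)) = length vs" using that by simp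
    then have "length (take i vs @ drop (Suc i) vs) \<notin> I" using IJ len by metis
    then have "(\<lambda>y. \<omega> c y (take i vs @ drop (Suc i) vs)) = (\<lambda>_. 0)" using formsD(5)[OF \<omega>] by blast
    then show ?thesis by simp
  qed
  then show "ext_deriv A \<omega> c x vs = 0" by (simp add: ext_deriv_def)
qed (erule ext_deriv_outside, erule (3) ext_deriv_natural[OF \<omega>])

lemma ext_deriv_ext_deriv:
  assumes \<omega>: "\<omega> \<in> forms A I"
  shows "ext_deriv A (ext_deriv A \<omega>) c x vs = 0"
proof (cases "c \<in> A \<and> x \<in> chart_img c")
  case True
  then have c: "c \<in> A" "x \<in> chart_img c" by auto
  note o = chart_open[OF c(1)]
  define G where "G u w ws = frechet_derivative (\<lambda>y. coord_deriv (\<omega> c) y w ws) (at x) u" for u w ws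
  have d: "((\<lambda>y. coord_deriv (\<omega> c) y w ws) has_derivative (\<lambda>u. G u w ws)) (at x)" for w ws
    unfolding G_def coord_deriv_def
    by (rule has_frechet_derivative[OF smooth_on_differentiable[OF smooth_on_frechet_derivative[OF formsD(3)[OF \<omega> c(1)]] c(2)]])
  have "((\<lambda>y. alternation (coord_deriv (\<omega> c) y) ws) has_derivative (\<lambda>u. alternation (G u) ws)) (at x)" for ws
    unfolding alternation_def by (intro has_derivative_sum has_derivative_mult_right d)
  then have "((\<lambda>y. ext_deriv A \<omega> c y ws) has_derivative (\<lambda>u. alternation (G u) ws)) (at x)" for ws
    by (rule has_derivative_transform_within_open[OF _ o c(2)]) (simp add: ext_deriv_eq[OF c(1)])
  then have "coord_deriv (ext_deriv A \<omega> c) x = (\<lambda>u. alternation (G u))"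
    using coord_deriv_eqI by (intro ext) blast
  moreover have "G u w = G w u" for u w
    unfolding G_def coord_deriv_def
    by (intro ext second_derivative_symmetric[OF o c(2)] formsD(3)[OF \<omega> c(1)])
  ultimately show ?thesis using alternation_symmetric[of G] ext_deriv_eq[OF c] by simp
qed (use ext_deriv_outside in auto)

lemma ext_deriv_lincomb:
  assumes \<omega>: "\<omega> \<in> forms A I" and \<eta>: "\<eta> \<in> forms A J"
  shows "ext_deriv A (\<lambda>c x vs. a * \<omega> c x vs + b * \<eta> c x vs) c x vs =
    a * ext_deriv A \<omega> c x vs + b * ext_deriv A \<eta> c x vs"
proof (cases "c \<in> A \<and> x \<in> chart_img c")
  case True
  then have c: "c \<in> A" "x \<in> chart_img c" by auto
  have "((\<lambda>y. a * \<omega> c y ws + b * \<eta> c y ws) has_derivative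
      (\<lambda>u. a * coord_deriv (\<omega> c) x u ws + b * coord_deriv (\<eta> c) x u ws)) (at x)" for ws
    by (intro has_derivative_add has_derivative_mult_right has_coord_deriv forms_differentiable[OF \<omega> c]
        forms_differentiable[OF \<eta> c])
  then have "coord_deriv (\<lambda>y ws. a * \<omega> c y ws + b * \<eta> c y ws) x =
      (\<lambda>u ws. a * coord_deriv (\<omega> c) x u ws + b * coord_deriv (\<eta> c) x u ws)"
    using coord_deriv_eqI[of "\<lambda>y ws. a * \<omega> c y ws + b * \<eta> c y ws"] by (intro ext) blast
  then show ?thesis by (simp add: ext_deriv_eq[OF c] alternation_lincomb)
qed (use ext_deriv_outside in auto)

lemma wedge_forms:
  assumes \<eta>: "\<eta> \<in> forms A I" and \<omega>: "\<omega> \<in> forms A I'" and J: "\<And>k l. \<lbrakk>k \<in> I; l \<in> I'\<rbrakk> \<Longrightarrow> k + l \<in> J"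
  shows "wedge \<eta> \<omega> \<in> forms A J"
proof (rule formsI)
  fix c x assume "\<not> (c \<in> A \<and> x \<in> chart_img c)"
  then show "wedge \<eta> \<omega> c x = (\<lambda>_. 0)" using formsD(1)[OF \<eta>] by (auto simp: wedge_def)
next
  fix c vs assume c: "c \<in> A"
  show "smooth_on (chart_img c) (\<lambda>x. wedge \<eta> \<omega> c x vs)"
    unfolding wedge_def wedge_alt_def
    by (intro smooth_on_sum smooth_on_mult smooth_on_const formsD(3)[OF \<omega>] formsD(3)[OF \<eta>] chart_open c)
next
  fix c c' m and vs :: "'b list" assume a: "c \<in> A" "c' \<in> A" "m \<in> chart_dom c" "m \<in> chart_dom c'"
  show "wedge \<eta> \<omega> c (chart_map c m) vs = wedge \<eta> \<omega> c' (chart_map c' m)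
      (map (frechet_derivative (transition c c') (at (chart_map c m))) vs)"
    unfolding wedge_def wedge_alt_map using formsD(4)[OF \<omega> a] formsD(4)[OF \<eta> a] by (simp add: wedge_alt_def)
next
  fix c x and vs :: "'b list" assume "length vs \<notin> J"
  then show "wedge \<eta> \<omega> c x vs = 0"
    unfolding wedge_def using wedge_alt_length formsD(5)[OF \<omega>] formsD(5)[OF \<eta>] J by metis
qed (simp add: wedge_def alternating_wedge_alt formsD(2)[OF \<omega>] formsD(2)[OF \<eta>])

lemma ext_deriv_wedge:
  assumes \<eta>: "\<eta> \<in> forms A I" and \<omega>: "\<omega> \<in> forms A I'" and c: "c \<in> A" "x \<in> chart_img c"
  shows "ext_deriv A (wedge \<eta> \<omega>) c x vs =
    wedge_alt (ext_deriv A \<eta> c x) (\<omega> c x) vs + wedge_alt (grade_sign (\<eta> c x)) (ext_deriv A \<omega> c x) vs"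
proof -
  have "coord_deriv (wedge \<eta> \<omega> c) x u ws =
      wedge_alt (coord_deriv (\<eta> c) x u) (\<omega> c x) ws + wedge_alt (\<eta> c x) (coord_deriv (\<omega> c) x u) ws" for u ws
    by (rule coord_deriv_eqI, unfold wedge_def, rule coord_deriv_wedge)
      (use forms_differentiable[OF \<omega> c] forms_differentiable[OF \<eta> c] in auto)
  then have "coord_deriv (wedge \<eta> \<omega> c) x = (\<lambda>u ws. wedge_alt (coord_deriv (\<eta> c) x u) (\<omega> c x) ws +
      wedge_alt (\<eta> c x) (coord_deriv (\<omega> c) x u) ws)" by (intro ext)
  then show ?thesis
    using alternation_wedge_left[of "coord_deriv (\<eta> c) x"] alternation_wedge_right[of "\<eta> c x" "coord_deriv (\<omega> c) x"]
    by (simp add: ext_deriv_eq[OF c] alternation_add)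
qed

end

section \<open>The twisted differential\<close>

locale twisted = atlas T A for T :: "'a topology" and A :: "('a, 'b::euclidean_space) chart set" +
  fixes H :: "('a, 'b) dform"
  assumes H_forms: "H \<in> forms A {k. odd k}" and H_closed: "ext_deriv A H = (\<lambda>_ _ _. 0)"
begin

lemma H_grade_sign: "grade_sign (H c x) = (\<lambda>ws. - H c x ws)"
proof
  show "grade_sign (H c x) ws = - H c x ws" for ws
    using formsD(5)[OF H_forms, of ws] by (cases "even (length ws)") (auto simp: grade_sign_def)
qed

lemma twisted_deriv_forms:
  assumes \<omega>: "\<omega> \<in> forms A I" and J: "\<And>k l. \<lbrakk>k \<in> I; odd l\<rbrakk> \<Longrightarrow> k + l \<in> J"
  shows "twisted_deriv A H \<omega> \<in> forms A J"
proof -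
  have "wedge H \<omega> \<in> forms A J"
    by (rule wedge_forms[OF H_forms \<omega>]) (use J in \<open>metis add.commute mem_Collect_eq\<close>)
  moreover have "ext_deriv A \<omega> \<in> forms A J"
    by (rule ext_deriv_forms[OF \<omega>]) (use J[of _ 1] in auto)
  ultimately show ?thesis
    using forms_lincomb[of "ext_deriv A \<omega>" J "wedge H \<omega>" 1 1] by (simp add: twisted_deriv_def[abs_def])
qed

lemma twisted_deriv_lincomb:
  assumes "\<omega> \<in> forms A I" "\<eta> \<in> forms A J"
  shows "twisted_deriv A H (\<lambda>c x vs. a * \<omega> c x vs + b * \<eta> c x vs) =
    (\<lambda>c x vs. a * twisted_deriv A H \<omega> c x vs + b * twisted_deriv A H \<eta> c x vs)"
  by (intro ext) (simp add: twisted_deriv_def ext_deriv_lincomb[OF assms] wedge_def wedge_alt_lin_right algebra_simps)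

text \<open>As \<open>H\<close> is closed and odd, the derivative of its product with
  \<open>\<omega>\<close> is minus the product of \<open>H\<close> with the derivative of
  \<open>\<omega>\<close>. This cancels the other mixed term of the square; the remaining terms are
  the square of the exterior derivative and the double product with \<open>H\<close>.\<close>

lemma twisted_deriv_square:
  assumes \<omega>: "\<omega> \<in> forms A I"
  shows "twisted_deriv A H (twisted_deriv A H \<omega>) = (\<lambda>_ _ _. 0)"
proof (intro ext)
  fix c x vs
  show "twisted_deriv A H (twisted_deriv A H \<omega>) c x vs = 0"
  proof (cases "c \<in> A \<and> x \<in> chart_img c")
    case True
    then have c: "c \<in> A" "x \<in> chart_img c" by auto
    have d\<omega>: "ext_deriv A \<omega> \<in> forms A UNIV" by (rule ext_deriv_forms[OF \<omega>]) auto
    have H\<omega>: "wedge H \<omega> \<in> forms A UNIV" by (rule wedge_forms[OF H_forms \<omega>]) auto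
    have "twisted_deriv A H \<omega> = (\<lambda>c x vs. 1 * ext_deriv A \<omega> c x vs + 1 * wedge H \<omega> c x vs)"
      by (simp add: twisted_deriv_def[abs_def])
    then have "ext_deriv A (twisted_deriv A H \<omega>) c x vs = ext_deriv A (wedge H \<omega>) c x vs"
      using ext_deriv_lincomb[OF d\<omega> H\<omega>, of 1 1 c x vs] ext_deriv_ext_deriv[OF \<omega>] by simp
    also have "\<dots> = - wedge_alt (H c x) (ext_deriv A \<omega> c x) vs"
      using ext_deriv_wedge[OF H_forms \<omega> c] by (simp add: H_closed H_grade_sign wedge_alt_minus)
    finally have 1: "ext_deriv A (twisted_deriv A H \<omega>) c x vs = - wedge_alt (H c x) (ext_deriv A \<omega> c x) vs" .
    have "wedge H (twisted_deriv A H \<omega>) c x vs =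
        wedge_alt (H c x) (ext_deriv A \<omega> c x) vs + wedge_alt (H c x) (wedge_alt (H c x) (\<omega> c x)) vs"
      by (simp add: wedge_def twisted_deriv_def wedge_alt_add)
    also have "wedge_alt (H c x) (wedge_alt (H c x) (\<omega> c x)) vs = 0"
      by (rule wedge_alt_odd_square[OF H_grade_sign])
    finally show ?thesis using 1 by (simp add: twisted_deriv_def[of A H "twisted_deriv A H \<omega>"])
  next
    case False
    then show ?thesis using formsD(1)[OF H_forms False] ext_deriv_outside
      by (simp add: twisted_deriv_def[of A H "twisted_deriv A H \<omega>"] wedge_def)
  qed
qed

end

section \<open>The exact couple of the degree filtration\<close>

lemma form_space_ops [simp]:
  "carrier (form_space A I) = forms A I" "\<zero>\<^bsub>form_space A I\<^esub> = (\<lambda>_ _ _. 0)"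
  "\<omega> \<oplus>\<^bsub>form_space A I\<^esub> \<eta> = (\<lambda>c x vs. \<omega> c x vs + \<eta> c x vs)"
  "a \<odot>\<^bsub>form_space A I\<^esub> \<omega> = (\<lambda>c x vs. a * \<omega> c x vs)"
  by (simp_all add: form_space_def)

lemma K_ops [simp]:
  "\<zero>\<^bsub>K A p i\<^esub> = (\<lambda>_ _ _. 0)" "\<omega> \<oplus>\<^bsub>K A p i\<^esub> \<eta> = (\<lambda>c x vs. \<omega> c x vs + \<eta> c x vs)"
  "a \<odot>\<^bsub>K A p i\<^esub> \<omega> = (\<lambda>c x vs. a * \<omega> c x vs)"
  by (simp_all add: K_def)

context atlas
begin

lemma forms_add: "\<lbrakk>\<omega> \<in> forms A I; \<eta> \<in> forms A I\<rbrakk> \<Longrightarrow> (\<lambda>c x vs. \<omega> c x vs + \<eta> c x vs) \<in> forms A I"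
  using forms_lincomb[of \<omega> I \<eta> 1 1] by simp

lemma forms_scale: "\<omega> \<in> forms A I \<Longrightarrow> (\<lambda>c x vs. a * \<omega> c x vs) \<in> forms A I"
  using forms_lincomb[of \<omega> I \<omega> a 0] by simp

lemma form_space_module: "module real_ring (form_space A I)"
  by (rule real_moduleI) (auto simp: forms_add forms_scale forms_zero algebra_simps)

lemma K_module: "module real_ring (K A p i)"
  unfolding K_def by (rule form_space_module)

lemma K_mono: "p \<le> p' \<Longrightarrow> carrier (K A p' i) \<subseteq> carrier (K A p i)"
  unfolding K_def form_space_ops by (rule forms_mono) auto

lemma K_submodule: "p \<le> p' \<Longrightarrow> submodule (carrier (K A p' i)) real_ring (K A p i)"
  using module_closed[OF K_module[of p' i]] K_mono
  by (intro submodule_realI[OF K_module]) auto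

lemma K_nonpos: "p \<le> 0 \<Longrightarrow> K A p = Omega_par A"
  by (intro ext) (auto simp: K_def Omega_par_def intro!: arg_cong[where f = "form_space A"])

text \<open>Below zero the filtration is constant, so \<open>K A 0\<close> is the whole complex;
  this inclusion induces the augmentation.\<close>

lemma K_subset_Omega: "carrier (K A p i) \<subseteq> carrier (K A 0 i)"
  using K_mono[of 0 p i] K_nonpos[of p] K_nonpos[of 0] by (cases "p \<ge> 0") auto

lemma K_vanish: "p > int DIM('b) \<Longrightarrow> carrier (K A p i) = {\<lambda>_ _ _. 0}"
  unfolding K_def form_space_ops using forms_above_dim forms_zero by fastforce

end

context twisted
begin

abbreviation d where "d \<equiv> twisted_deriv A H"

text \<open>An odd degree is at least 1, so multiplication by \<open>H\<close> moves at least one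
  step down the filtration, as the exterior derivative does.\<close>

lemma d_K: "x \<in> carrier (K A p i) \<Longrightarrow> d x \<in> carrier (K A (p + 1) (i + 1))"
  unfolding K_def form_space_ops by (erule twisted_deriv_forms) (auto elim!: oddE)

lemma d_lin: "p' \<le> p + 1 \<Longrightarrow> i' = i + 1 \<Longrightarrow> d \<in> lin_maps (K A p i) (K A p' i')"
proof (rule lin_mapsI)
  assume "p' \<le> p + 1" "i' = i + 1"
  then show "d x \<in> carrier (K A p' i')" if "x \<in> carrier (K A p i)" for x
    using d_K[OF that] K_mono[of p' "p + 1" i'] by auto
  show "d (x \<oplus>\<^bsub>K A p i\<^esub> y) = d x \<oplus>\<^bsub>K A p' i'\<^esub> d y"
    if "x \<in> carrier (K A p i)" "y \<in> carrier (K A p i)" for x y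
    using that twisted_deriv_lincomb[of x _ y _ 1 1] by (simp add: K_def)
  show "d (a \<odot>\<^bsub>K A p i\<^esub> x) = a \<odot>\<^bsub>K A p' i'\<^esub> d x" if "x \<in> carrier (K A p i)" for x a
    using that twisted_deriv_lincomb[of x _ x _ a 0] by (simp add: K_def)
qed

lemma d_d: "x \<in> carrier (K A p i) \<Longrightarrow> d (d x) = (\<lambda>_ _ _. 0)"
  unfolding K_def form_space_ops by (rule twisted_deriv_square)

section \<open>Cohomology of the filtration steps and of the graded quotients\<close>

abbreviation Zk where "Zk p i \<equiv> cocycles (K A p) (\<lambda>_. d) i"
abbreviation Bk where "Bk p i \<equiv> coboundaries (K A p) (\<lambda>_. d) i"
abbreviation Hk where "Hk p i \<equiv> K_cohomology A H p i"
abbreviation cls where "cls p i \<equiv> coh_class (K A p) (\<lambda>_. d) i"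

lemma cls_quotient: "quotient_proj (cls p i) (Zk p i) (Bk p i) (Hk p i)"
  unfolding K_cohomology_def
  by (rule quotient_proj_cohomology) (use K_module d_lin d_d in auto)

lemma Zk_carrier: "carrier (Zk p i) = {x \<in> carrier (K A p i). d x = (\<lambda>_ _ _. 0)}"
  by (simp add: cocycles_def)

lemma Zk_ops [simp]: "\<omega> \<oplus>\<^bsub>Zk p i\<^esub> \<eta> = (\<lambda>c x vs. \<omega> c x vs + \<eta> c x vs)"
  "\<zero>\<^bsub>Zk p i\<^esub> = (\<lambda>_ _ _. 0)" "a \<odot>\<^bsub>Zk p i\<^esub> \<omega> = (\<lambda>c x vs. a * \<omega> c x vs)"
  by (simp_all add: cocycles_def)

lemma Bk_submodule: "submodule (Bk p i) real_ring (K A p i)"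
  unfolding coboundaries_def by (rule submodule_image[OF K_module K_module d_lin]) auto

lemma Bk_iff: "i' = i - 1 \<Longrightarrow> x \<in> Bk p i \<longleftrightarrow> (\<exists>y\<in>carrier (K A p i'). x = d y)"
  by (auto simp: coboundaries_def)

lemma d_cocycle: "x \<in> carrier (K A p i) \<Longrightarrow> i' = i + 1 \<Longrightarrow> p' \<le> p + 1 \<Longrightarrow> d x \<in> carrier (Zk p' i')"
  using lin_mapsD(1)[OF d_lin] d_d by (auto simp: Zk_carrier)

lemma gr_quotient: "quotient_proj (gr_proj A p i) (K A p i) (carrier (K A (p + 1) i)) (gr A p i)"
  unfolding gr_def gr_proj_def[abs_def] by (rule quotient_proj_quot_mod[OF K_module K_submodule]) simp

lemma gr_deriv_zero:
  assumes "S \<in> carrier (gr A p i)"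
  shows "gr_deriv A H p i S = \<zero>\<^bsub>gr A p (i + 1)\<^esub>"
proof -
  obtain x where x: "x \<in> carrier (K A p i)" "S = carrier (K A (p + 1) i) +>\<^bsub>K A p i\<^esub> x"
    using assms quotient_projD(4)[OF gr_quotient, of p i] by (auto simp: gr_proj_def)
  have "d ` carrier (K A (p + 1) i) \<subseteq> carrier (K A (p + 1) (i + 1))"
    using d_K K_mono[of p "p + 1" i] by auto
  then have "gr_deriv A H p i S = gr_proj A p (i + 1) (d x)"
    unfolding gr_deriv_def gr_proj_def x(2)
    by (intro quot_map_coset[OF K_module K_submodule x(1) K_module K_submodule d_lin]) auto
  moreover have "d x \<in> carrier (K A p (i + 1))" using lin_mapsD(1)[OF d_lin x(1)] by simp
  ultimately show ?thesis using quotient_projD(5)[OF gr_quotient] d_K[OF x(1)] by auto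
qed

abbreviation Hg where "Hg p i \<equiv> gr_cohomology A H p i"

definition gcls :: "int \<Rightarrow> int \<Rightarrow> ('a, 'b) dform \<Rightarrow> ('a, 'b) dform set set" where
  "gcls p i x = coh_class (gr A p) (gr_deriv A H p) i (gr_proj A p i x)"

lemma gr_coboundaries: "coboundaries (gr A p) (gr_deriv A H p) i = {\<zero>\<^bsub>gr A p i\<^esub>}"
  using gr_deriv_zero[of _ p "i - 1"] module_closed(1)[OF quotient_projD(2)[OF gr_quotient]]
  by (force simp: coboundaries_def)

text \<open>The differential induced on the graded quotient is zero, so every form in filtration
  degree \<open>p\<close> represents a class, and the first page is the graded quotient
  itself.\<close>

lemma gcls_quotient: "quotient_proj (gcls p i) (K A p i) (carrier (K A (p + 1) i)) (Hg p i)"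
proof -
  note gm = quotient_projD(2)[OF gr_quotient]
  have lin: "gr_deriv A H p i \<in> lin_maps (gr A p i) (gr A p (i + 1))" for i
    using gr_deriv_zero module_closed[OF gm] by (intro lin_mapsI) auto
  have "quotient_proj (coh_class (gr A p) (gr_deriv A H p) i) (cocycles (gr A p) (gr_deriv A H p) i)
      {\<zero>\<^bsub>gr A p i\<^esub>} (Hg p i)"
    unfolding gr_cohomology_def gr_coboundaries[symmetric]
    by (rule quotient_proj_cohomology[where M = "gr A p" and d = "gr_deriv A H p", OF gm lin]) (use gr_deriv_zero module_closed(1)[OF gm] in simp)
  moreover have "cocycles (gr A p) (gr_deriv A H p) i = gr A p i"
  proof -
    have "{x \<in> carrier (gr A p i). gr_deriv A H p i x = \<zero>\<^bsub>gr A p (i + 1)\<^esub>} = carrier (gr A p i)"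
      using gr_deriv_zero by blast
    then show ?thesis by (simp add: cocycles_def)
  qed
  ultimately have "quotient_proj (coh_class (gr A p) (gr_deriv A H p) i) (gr A p i) {\<zero>\<^bsub>gr A p i\<^esub>} (Hg p i)"
    by simp
  from quotient_proj_comp[OF gr_quotient this]
  have "quotient_proj (gcls p i) (K A p i) {x \<in> carrier (K A p i). gr_proj A p i x \<in> {\<zero>\<^bsub>gr A p i\<^esub>}} (Hg p i)"
    by (simp add: gcls_def[abs_def])
  moreover have "{x \<in> carrier (K A p i). gr_proj A p i x \<in> {\<zero>\<^bsub>gr A p i\<^esub>}} = carrier (K A (p + 1) i)"
    using quotient_projD(5)[OF gr_quotient[of p i]] quotient_projD(6)[OF gr_quotient[of p i]] by blast
  ultimately show ?thesis by simp
qed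

text \<open>The target degree \<open>p'\<close> is free: \<open>p - 1\<close> gives the map
  \<open>i\<close> of the couple and 0 gives the augmentation.\<close>

definition imk :: "int \<Rightarrow> int \<Rightarrow> int \<Rightarrow> ('a, 'b) dform set \<Rightarrow> ('a, 'b) dform set" where
  "imk p' p i = quot_map (K A p' i) (Bk p' i) (\<lambda>x. x)"

text \<open>The inclusion is assumed in both parities because coboundaries in one parity come from
  forms of the other.\<close>

lemma imk_cls:
  assumes sub: "\<And>i. carrier (K A p i) \<subseteq> carrier (K A p' i)" and x: "x \<in> carrier (K A p i)"
  shows "imk p' p i (cls p i x) = cls p' i x"
  unfolding imk_def coh_class_def
proof (rule quot_map_coset[OF K_module Bk_submodule x K_module Bk_submodule])
  show "(\<lambda>x. x) \<in> lin_maps (K A p i) (K A p' i)" using sub by (intro lin_mapsI) auto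
  show "(\<lambda>x. x) ` Bk p i \<subseteq> Bk p' i" using sub by (auto simp: coboundaries_def)
qed

lemma imk_lin:
  assumes sub: "\<And>i. carrier (K A p i) \<subseteq> carrier (K A p' i)"
  shows "imk p' p i \<in> lin_maps (Hk p i) (Hk p' i)"
proof (rule lin_maps_descend[OF cls_quotient])
  have "(\<lambda>x. x) \<in> lin_maps (Zk p i) (Zk p' i)"
    using sub by (intro lin_mapsI) (auto simp: Zk_carrier)
  from lin_map_comp[OF this quotient_projD(3)[OF cls_quotient]]
  show "cls p' i \<in> lin_maps (Zk p i) (Hk p' i)" .
  show "imk p' p i (cls p i x) = cls p' i x" if "x \<in> carrier (Zk p i)" for x
    using imk_cls[OF sub] that by (simp add: Zk_carrier)
qed

definition jmk :: "int \<Rightarrow> int \<Rightarrow> ('a, 'b) dform set \<Rightarrow> ('a, 'b) dform set set" where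
  "jmk p i = quot_map (gr A p i) (coboundaries (gr A p) (gr_deriv A H p) i) (gr_proj A p i)"

text \<open>A coboundary of a filtration step already lies in the next one, so it dies in the graded
  quotient.\<close>

lemma jmk_cls:
  assumes x: "x \<in> carrier (K A p i)"
  shows "jmk p i (cls p i x) = gcls p i x"
  unfolding jmk_def gcls_def coh_class_def gr_coboundaries
proof (rule quot_map_coset[OF K_module Bk_submodule x quotient_projD(2)[OF gr_quotient]
      submodule_zero[OF quotient_projD(2)[OF gr_quotient]] quotient_projD(3)[OF gr_quotient]])
  have "y \<in> carrier (K A p i) \<and> y \<in> carrier (K A (p + 1) i)" if "y \<in> Bk p i" for y
    using that submodule_real(1)[OF Bk_submodule] d_K[of _ p "i - 1"] by (auto simp: coboundaries_def)
  then show "gr_proj A p i ` Bk p i \<subseteq> {\<zero>\<^bsub>gr A p i\<^esub>}"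
    using quotient_projD(5)[OF gr_quotient, of _ p i] by auto
qed

lemma jmk_lin: "jmk p i \<in> lin_maps (Hk p i) (Hg p i)"
proof (rule lin_maps_descend[OF cls_quotient])
  show "gcls p i \<in> lin_maps (Zk p i) (Hg p i)"
    unfolding cocycles_def by (rule lin_maps_restrict_dom[OF quotient_projD(3)[OF gcls_quotient]]) auto
  show "jmk p i (cls p i x) = gcls p i x" if "x \<in> carrier (Zk p i)" for x
    using jmk_cls that by (simp add: Zk_carrier)
qed

text \<open>Well-definedness of the connecting map: two representatives differ by some
  \<open>n\<close> in the next filtration step, and their images under \<open>d\<close> differ by
  \<open>d n\<close>, a coboundary there.\<close>

lemma kmk_cls:
  assumes x: "x \<in> carrier (K A p i)"
  shows "connecting A H p i (gcls p i x) = cls (p + 1) (i + 1) (d x)"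
  unfolding connecting_def gcls_def[symmetric]
proof (rule the_equality)
  show "\<exists>y\<in>carrier (K A p i). d y \<in> carrier (K A (p + 1) (i + 1)) \<and> gcls p i x = gcls p i y \<and>
      cls (p + 1) (i + 1) (d x) = cls (p + 1) (i + 1) (d y)"
    using x d_K by blast
next
  fix \<eta> assume "\<exists>y\<in>carrier (K A p i). d y \<in> carrier (K A (p + 1) (i + 1)) \<and> gcls p i x = gcls p i y \<and>
      \<eta> = cls (p + 1) (i + 1) (d y)"
  then obtain y where y: "y \<in> carrier (K A p i)" "gcls p i y = gcls p i x" "\<eta> = cls (p + 1) (i + 1) (d y)"
    by auto
  obtain n where n: "n \<in> carrier (K A (p + 1) i)" "y = n \<oplus>\<^bsub>K A p i\<^esub> x"
    using quotient_proj_eq_iff[OF gcls_quotient y(1) x] y(2) by auto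
  have "d y = d n \<oplus>\<^bsub>Zk (p + 1) (i + 1)\<^esub> d x"
    using lin_mapsD(2)[OF d_lin[of p p "i + 1" i], of n x] n K_mono[of p "p + 1" i] x by auto
  moreover have "d n \<in> Bk (p + 1) (i + 1)" using n(1) Bk_iff[of i "i + 1"] by auto
  ultimately show "\<eta> = cls (p + 1) (i + 1) (d x)"
    unfolding y(3)
    using quotient_proj_eq_iff[OF cls_quotient d_cocycle[OF y(1)] d_cocycle[OF x], of "i + 1" "p + 1"] by auto
qed

lemma kmk_lin: "i' = i + 1 \<Longrightarrow> connecting A H p i \<in> lin_maps (Hg p i) (Hk (p + 1) i')"
proof (rule lin_maps_descend[OF gcls_quotient])
  assume i': "i' = i + 1"
  have "d \<in> lin_maps (K A p i) (Zk (p + 1) i')"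
    using d_cocycle[OF _ i', of _ p "p + 1"] lin_mapsD(2,3)[OF d_lin[of p p i' i]] i'
    by (intro lin_mapsI) auto
  from lin_map_comp[OF this quotient_projD(3)[OF cls_quotient]]
  show "(\<lambda>x. cls (p + 1) i' (d x)) \<in> lin_maps (K A p i) (Hk (p + 1) i')" .
  show "connecting A H p i (gcls p i x) = cls (p + 1) i' (d x)" if "x \<in> carrier (K A p i)" for x
    using kmk_cls[OF that] i' by simp
qed

section \<open>Exactness of the long sequence, on representatives\<close>

lemma Hk_obtain:
  assumes "\<xi> \<in> carrier (Hk p i)"
  obtains x where "x \<in> carrier (K A p i)" "d x = (\<lambda>_ _ _. 0)" "\<xi> = cls p i x"
  using assms quotient_projD(4)[OF cls_quotient, of p i] by (auto simp: Zk_carrier)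

lemma Hg_obtain:
  assumes "\<xi> \<in> carrier (Hg p i)"
  obtains x where "x \<in> carrier (K A p i)" "\<xi> = gcls p i x"
  using assms quotient_projD(4)[OF gcls_quotient, of p i] by auto

lemma cls_in: "\<lbrakk>x \<in> carrier (K A p i); d x = (\<lambda>_ _ _. 0)\<rbrakk> \<Longrightarrow> cls p i x \<in> carrier (Hk p i)"
  using lin_mapsD(1)[OF quotient_projD(3)[OF cls_quotient], of x p i] by (simp add: Zk_carrier)

lemma cls_zero_iff:
  "\<lbrakk>x \<in> carrier (K A p i); d x = (\<lambda>_ _ _. 0); i' = i - 1\<rbrakk> \<Longrightarrow>
    cls p i x = \<zero>\<^bsub>Hk p i\<^esub> \<longleftrightarrow> (\<exists>y\<in>carrier (K A p i'). x = d y)"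
  using quotient_projD(5)[OF cls_quotient, of x p i] Bk_iff by (simp add: Zk_carrier)

lemma gcls_zero_iff: "x \<in> carrier (K A p i) \<Longrightarrow> gcls p i x = \<zero>\<^bsub>Hg p i\<^esub> \<longleftrightarrow> x \<in> carrier (K A (p + 1) i)"
  by (rule quotient_projD(5)[OF gcls_quotient])

lemma K_step: "carrier (K A (p + 1) i) \<subseteq> carrier (K A p i)" "carrier (K A p i) \<subseteq> carrier (K A (p - 1) i)"
  by (rule K_mono; simp)+

text \<open>The graded cohomology has no further coboundaries, so a class killed by \<open>j\<close>
  has its representative in the next filtration step already; no correction is necessary.\<close>

lemma exact_im_jm:
  "imk p (p + 1) i ` carrier (Hk (p + 1) i) = {x \<in> carrier (Hk p i). jmk p i x = \<zero>\<^bsub>Hg p i\<^esub>}"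
proof (intro equalityI subsetI)
  fix \<xi> assume "\<xi> \<in> imk p (p + 1) i ` carrier (Hk (p + 1) i)"
  then obtain x where x: "x \<in> carrier (K A (p + 1) i)" "d x = (\<lambda>_ _ _. 0)" "\<xi> = cls p i x"
    using imk_cls[OF K_step(1)] by (auto elim!: Hk_obtain)
  then show "\<xi> \<in> {x \<in> carrier (Hk p i). jmk p i x = \<zero>\<^bsub>Hg p i\<^esub>}"
    using subsetD[OF K_step(1) x(1)] jmk_cls[of x p i] gcls_zero_iff[of x p i] cls_in[of x p i] by simp
next
  fix \<xi> assume "\<xi> \<in> {x \<in> carrier (Hk p i). jmk p i x = \<zero>\<^bsub>Hg p i\<^esub>}"
  then obtain x where x: "x \<in> carrier (K A p i)" "d x = (\<lambda>_ _ _. 0)" "\<xi> = cls p i x"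
    "jmk p i \<xi> = \<zero>\<^bsub>Hg p i\<^esub>" by (auto elim!: Hk_obtain)
  then have "x \<in> carrier (K A (p + 1) i)" using jmk_cls[of x p i] gcls_zero_iff[of x p i] by simp
  then show "\<xi> \<in> imk p (p + 1) i ` carrier (Hk (p + 1) i)"
    using x imk_cls[OF K_step(1), of x p i] cls_in[of x "p + 1" i] by force
qed

lemma exact_jm_km:
  assumes i': "i' = i + 1"
  shows "jmk p i ` carrier (Hk p i) = {x \<in> carrier (Hg p i). connecting A H p i x = \<zero>\<^bsub>Hk (p + 1) i'\<^esub>}"
proof (intro equalityI subsetI)
  fix \<xi> assume "\<xi> \<in> jmk p i ` carrier (Hk p i)"
  then obtain \<zeta> where "\<zeta> \<in> carrier (Hk p i)" and \<xi>: "\<xi> = jmk p i \<zeta>" by auto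
  then obtain x where x: "x \<in> carrier (K A p i)" "d x = (\<lambda>_ _ _. 0)" "\<zeta> = cls p i x" by (auto elim: Hk_obtain)
  have "cls (p + 1) i' (d x) = \<zero>\<^bsub>Hk (p + 1) i'\<^esub>"
    using x(2) lin_map_zero[OF quotient_projD(1-3)[OF cls_quotient], of "p + 1" i'] by simp
  then show "\<xi> \<in> {x \<in> carrier (Hg p i). connecting A H p i x = \<zero>\<^bsub>Hk (p + 1) i'\<^esub>}"
    using \<xi> x(3) jmk_cls[OF x(1)] kmk_cls[OF x(1)] i'
      lin_mapsD(1)[OF quotient_projD(3)[OF gcls_quotient] x(1)] by simp
next
  fix \<xi> assume "\<xi> \<in> {x \<in> carrier (Hg p i). connecting A H p i x = \<zero>\<^bsub>Hk (p + 1) i'\<^esub>}"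
  then obtain x where x: "x \<in> carrier (K A p i)" "\<xi> = gcls p i x"
    and k: "connecting A H p i \<xi> = \<zero>\<^bsub>Hk (p + 1) i'\<^esub>" by (auto elim: Hg_obtain)
  have "cls (p + 1) i' (d x) = \<zero>\<^bsub>Hk (p + 1) i'\<^esub>" using k x(2) kmk_cls[OF x(1)] i' by simp
  moreover have "d x \<in> carrier (K A (p + 1) i')" using d_K[OF x(1)] i' by simp
  ultimately obtain z where z: "z \<in> carrier (K A (p + 1) i)" "d x = d z"
    using cls_zero_iff[of "d x" "p + 1" i' i] d_d[OF x(1)] i' by fastforce
  have zp: "z \<in> carrier (K A p i)" using z(1) K_step(1) by blast
  \<comment> \<open>Subtracting \<open>z\<close>, which lies in the next filtration step, makes the
    representative closed without changing its graded class.\<close>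
  obtain y where y: "y \<in> carrier (K A p i)" "d y = (\<lambda>_ _ _. 0)" "x = y \<oplus>\<^bsub>K A p i\<^esub> z"
    using lin_map_eq_iff[OF K_module K_module d_lin[of p p "i + 1" i] x(1) zp] z(2) by auto
  have "gcls p i x = gcls p i y"
    using quotient_proj_eq_iff[OF gcls_quotient x(1) y(1)] z(1) y(3) by (auto simp: add.commute)
  then show "\<xi> \<in> jmk p i ` carrier (Hk p i)"
    using x(2) jmk_cls[OF y(1)] cls_in[OF y(1,2)] by force
qed

lemma exact_km_im:
  assumes i': "i' = i - 1"
  shows "connecting A H (p - 1) i' ` carrier (Hg (p - 1) i') = {x \<in> carrier (Hk p i). imk (p - 1) p i x = \<zero>\<^bsub>Hk (p - 1) i\<^esub>}"
proof (intro equalityI subsetI)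
  fix \<xi> assume "\<xi> \<in> connecting A H (p - 1) i' ` carrier (Hg (p - 1) i')"
  then obtain \<zeta> where "\<zeta> \<in> carrier (Hg (p - 1) i')" and \<xi>: "\<xi> = connecting A H (p - 1) i' \<zeta>" by auto
  then obtain x where x: "x \<in> carrier (K A (p - 1) i')" "\<zeta> = gcls (p - 1) i' x" by (auto elim: Hg_obtain)
  have dx: "d x \<in> carrier (K A p i)" using d_K[OF x(1)] i' by simp
  have \<xi>': "\<xi> = cls p i (d x)" using \<xi> x(2) kmk_cls[OF x(1)] i' by simp
  have "cls (p - 1) i (d x) = \<zero>\<^bsub>Hk (p - 1) i\<^esub>"
    using cls_zero_iff[of "d x" "p - 1" i i'] subsetD[OF K_step(2) dx] d_d[OF x(1)] i' x(1) by auto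
  then show "\<xi> \<in> {x \<in> carrier (Hk p i). imk (p - 1) p i x = \<zero>\<^bsub>Hk (p - 1) i\<^esub>}"
    using imk_cls[OF K_step(2) dx] \<xi>' cls_in[OF dx d_d[OF x(1)]] by simp
next
  fix \<xi> assume "\<xi> \<in> {x \<in> carrier (Hk p i). imk (p - 1) p i x = \<zero>\<^bsub>Hk (p - 1) i\<^esub>}"
  then obtain x where x: "x \<in> carrier (K A p i)" "d x = (\<lambda>_ _ _. 0)" "\<xi> = cls p i x"
    and im: "imk (p - 1) p i \<xi> = \<zero>\<^bsub>Hk (p - 1) i\<^esub>" by (auto elim!: Hk_obtain)
  then have "cls (p - 1) i x = \<zero>\<^bsub>Hk (p - 1) i\<^esub>" using imk_cls[OF K_step(2) x(1)] by simp
  then obtain y where y: "y \<in> carrier (K A (p - 1) i')" "x = d y"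
    using cls_zero_iff[OF subsetD[OF K_step(2) x(1)] x(2) i'] by blast
  then have "\<xi> = connecting A H (p - 1) i' (gcls (p - 1) i' y)"
    using kmk_cls[OF y(1)] x(3) i' by simp
  then show "\<xi> \<in> connecting A H (p - 1) i' ` carrier (Hg (p - 1) i')"
    using lin_mapsD(1)[OF quotient_projD(3)[OF gcls_quotient] y(1)] by blast
qed

section \<open>The filtration couple as a bounded exact couple\<close>

lemma filtration_couple_sel:
  "dobj (filtration_couple A H) p q = Hk p (p + q)" "eobj (filtration_couple A H) p q = Hg p (p + q)"
  "imap (filtration_couple A H) p q = imk (p - 1) p (p + q)" "jmap (filtration_couple A H) p q = jmk p (p + q)"
  "kmap (filtration_couple A H) p q = connecting A H p (p + q)"
  by (simp_all add: filtration_couple_def imk_def jmk_def)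

lemma exact_filtration_couple: "exact_couple 1 (filtration_couple A H)"
  unfolding exact_couple_def filtration_couple_sel
proof (intro allI conjI)
  fix p q :: int
  let ?i = "p + q"
  have e1: "p + int 1 - 1 = p" "q - int 1 + 1 = q" "p - int 1 + 1 = p" "q + int 1 - 1 = q"
    "p - 1 + (q + 1) = ?i" "p + 1 + (q - 1) = ?i" "p + 1 - 1 = p" by simp_all
  show "module real_ring (Hk p ?i)" by (rule quotient_projD(2)[OF cls_quotient])
  show "module real_ring (Hg p ?i)" by (rule quotient_projD(2)[OF gcls_quotient])
  show "imk (p - 1) p ?i \<in> lin_maps (Hk p ?i) (Hk (p - 1) (p - 1 + (q + 1)))"
    unfolding e1 by (rule imk_lin[OF K_step(2)])
  show "jmk p ?i \<in> lin_maps (Hk p ?i) (Hg (p + int 1 - 1) (p + int 1 - 1 + (q - int 1 + 1)))"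
    unfolding e1 by (rule jmk_lin)
  show "connecting A H p ?i \<in> lin_maps (Hg p ?i) (Hk (p + 1) (p + 1 + q))"
    by (rule kmk_lin) simp
  show "imk (p + 1 - 1) (p + 1) (p + 1 + (q - 1)) ` carrier (Hk (p + 1) (p + 1 + (q - 1))) =
      {x \<in> carrier (Hk p ?i). jmk p ?i x = \<zero>\<^bsub>Hg (p + int 1 - 1) (p + int 1 - 1 + (q - int 1 + 1))\<^esub>}"
    unfolding e1 by (rule exact_im_jm)
  show "jmk (p - int 1 + 1) (p - int 1 + 1 + (q + int 1 - 1)) `
        carrier (Hk (p - int 1 + 1) (p - int 1 + 1 + (q + int 1 - 1))) =
      {x \<in> carrier (Hg p ?i). connecting A H p ?i x = \<zero>\<^bsub>Hk (p + 1) (p + 1 + q)\<^esub>}"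
    unfolding e1 by (rule exact_jm_km) simp
  show "connecting A H (p - 1) (p - 1 + q) ` carrier (Hg (p - 1) (p - 1 + q)) =
      {x \<in> carrier (Hk p ?i). imk (p - 1) p ?i x = \<zero>\<^bsub>Hk (p - 1) (p - 1 + (q + 1))\<^esub>}"
    unfolding e1 by (rule exact_km_im) simp
qed

lemma Hk_nonpos: "p \<le> 0 \<Longrightarrow> Hk p i = twisted_cohomology A H i"
  by (simp add: K_cohomology_def twisted_cohomology_def K_nonpos)

text \<open>Above the dimension there are no forms. For \<open>p \<le> 0\<close> the filtration step
  is equal to the whole complex, not merely isomorphic to it, so the classes are the same sets and
  the maps induced by inclusions are identities.\<close>

lemma bounded_filtration_couple:
  assumes "derived_couples (filtration_couple A H) C"
  shows "bounded_couple (filtration_couple A H) C DIM('b) (twisted_cohomology A H) (\<lambda>p q. imk 0 p (p + q))"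
proof
  show "derived_couples (filtration_couple A H) C" by fact
next
  fix p q :: int assume p: "int DIM('b) < p"
  have "\<xi> = \<zero>\<^bsub>Hk p (p + q)\<^esub>" if \<xi>: "\<xi> \<in> carrier (Hk p (p + q))" for \<xi>
  proof -
    obtain x where x: "x \<in> carrier (K A p (p + q))" "\<xi> = cls p (p + q) x"
      using \<xi> by (auto elim: Hk_obtain)
    then have "x = \<zero>\<^bsub>Zk p (p + q)\<^esub>" using K_vanish[OF p] by simp
    then show ?thesis
      using lin_map_zero[OF quotient_projD(1-3)[OF cls_quotient]] x(2) by blast
  qed
  then show "carrier (dobj (filtration_couple A H) p q) = {\<zero>\<^bsub>dobj (filtration_couple A H) p q\<^esub>}"
    unfolding filtration_couple_sel
    using module_closed(1)[OF quotient_projD(2)[OF cls_quotient], of p "p + q"] by blast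
next
  fix p q :: int assume "p \<le> 0"
  then show "dobj (filtration_couple A H) p q = twisted_cohomology A H (p + q)"
    unfolding filtration_couple_sel by (rule Hk_nonpos)
next
  fix p q x assume p: "p \<le> (0::int)" and "x \<in> carrier (dobj (filtration_couple A H) p q)"
  then obtain z where z: "z \<in> carrier (K A p (p + q))" "x = cls p (p + q) z"
    unfolding filtration_couple_sel by (auto elim: Hk_obtain)
  have "imk (p - 1) p (p + q) x = cls (p - 1) (p + q) z" using imk_cls[OF K_step(2) z(1)] z(2) by simp
  then show "imap (filtration_couple A H) p q x = x"
    unfolding filtration_couple_sel z(2) using K_nonpos[of p] K_nonpos[of "p - 1"] p by simp
  have "imk 0 p (p + q) x = cls 0 (p + q) z" using imk_cls[OF K_subset_Omega z(1)] z(2) by simp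
  then show "imk 0 p (p + q) x = x"
    unfolding z(2) using K_nonpos[of p] K_nonpos[of 0] p by simp
next
  fix p q x assume "x \<in> carrier (dobj (filtration_couple A H) p q)"
  then obtain z where z: "z \<in> carrier (K A p (p + q))" "x = cls p (p + q) z"
    unfolding filtration_couple_sel by (auto elim: Hk_obtain)
  have "p - 1 + (q + 1) = p + q" by simp
  then show "imk 0 (p - 1) (p - 1 + (q + 1)) (imap (filtration_couple A H) p q x) = imk 0 p (p + q) x"
    unfolding filtration_couple_sel z(2)
    using imk_cls[OF K_step(2) z(1)] imk_cls[OF K_subset_Omega z(1)]
      imk_cls[OF K_subset_Omega subsetD[OF K_step(2) z(1)]] by simp
qed

lemma filtration_convergence:
  assumes "derived_couples (filtration_couple A H) C"
  shows "converges_to_twisted_cohomology A H (\<lambda>r. eobj (C r)) (\<lambda>r. couple_diff (C r))"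
    and "lin_isomorphic (direct_sum {(p, q). p + q = i}
      (\<lambda>(p, q). E_infinity (\<lambda>r. eobj (C r)) (\<lambda>r. couple_diff (C r)) p q)) (twisted_cohomology A H i)"
proof -
  interpret bounded_couple "filtration_couple A H" C "DIM('b)" "twisted_cohomology A H" "\<lambda>p q. imk 0 p (p + q)"
    by (rule bounded_filtration_couple[OF assms])
  have filt: "cohomology_filtration A H p i = (twisted_cohomology A H i)\<lparr>carrier := filt p i\<rparr>" for p i
  proof -
    have "imk 0 p i = quot_map (Omega_par A i) (coboundaries (Omega_par A) (\<lambda>_. d) i) (\<lambda>x. x)"
      by (simp add: imk_def K_nonpos)
    then show ?thesis by (simp add: cohomology_filtration_def filt_def filtration_couple_sel)
  qed
  show "converges_to_twisted_cohomology A H (\<lambda>r. eobj (C r)) (\<lambda>r. couple_diff (C r))"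
    unfolding converges_to_twisted_cohomology_def
    using exists_stable E_infinity_iso by (simp add: filt)
  show "lin_isomorphic (direct_sum {(p, q). p + q = i}
      (\<lambda>(p, q). E_infinity (\<lambda>r. eobj (C r)) (\<lambda>r. couple_diff (C r)) p q)) (twisted_cohomology A H i)"
    by (rule E_infinity_direct_sum)
qed

end

lemma (in atlas) closed_forms_sum:
  assumes "\<And>i. i \<in> S \<Longrightarrow> \<eta> i \<in> forms A I \<and> ext_deriv A (\<eta> i) = (\<lambda>_ _ _. 0)"
  shows "(\<lambda>c x vs. \<Sum>i\<in>S. \<eta> i c x vs) \<in> forms A I \<and> ext_deriv A (\<lambda>c x vs. \<Sum>i\<in>S. \<eta> i c x vs) = (\<lambda>_ _ _. 0)"
proof -
  have zero: "ext_deriv A (\<lambda>_ _ _. 0) = (\<lambda>_ _ _. 0)"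
    using ext_deriv_lincomb[OF forms_zero forms_zero, of 0 0] by (intro ext) simp
  show ?thesis
    using assms
  proof (induction S rule: infinite_finite_induct)
    case (insert i S)
    let ?s = "\<lambda>c x vs. \<Sum>i\<in>S. \<eta> i c x vs"
    have \<eta>: "\<eta> i \<in> forms A I" "ext_deriv A (\<eta> i) = (\<lambda>_ _ _. 0)"
      and s: "?s \<in> forms A I" "ext_deriv A ?s = (\<lambda>_ _ _. 0)"
      using insert by auto
    have "ext_deriv A (\<lambda>c x vs. \<eta> i c x vs + ?s c x vs) = (\<lambda>_ _ _. 0)"
      using ext_deriv_lincomb[OF \<eta>(1) s(1), of 1 1] \<eta>(2) s(2) by (intro ext) simp
    then show ?case using insert.hyps forms_add[OF \<eta>(1) s(1)] by simp
  qed (simp_all add: forms_zero zero)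
qed

theorem proposition3p2:
  fixes T :: "'a topology" and A :: "('a, 'b::euclidean_space) chart set"
    and n :: nat and Hc :: "nat \<Rightarrow> ('a, 'b) dform" and H :: "('a, 'b) dform"
  assumes "smooth_manifold T A" and "compact_space T" and "n = DIM('b)"
    and "\<And>i. i \<in> {1..(n - 1) div 2} \<Longrightarrow>
      Hc (2 * i + 1) \<in> forms A {2 * i + 1} \<and> ext_deriv A (Hc (2 * i + 1)) = (\<lambda>_ _ _. 0)"
    and "H = (\<lambda>c x vs. \<Sum>i = 1..(n - 1) div 2. Hc (2 * i + 1) c x vs)"
  shows
    "(\<exists>C. derived_couples (filtration_couple A H) C \<and>
        (\<forall>p q. eobj (C 1) p q = gr_cohomology A H p (p + q)) \<and>
        spectral_sequence (\<lambda>r. eobj (C r)) (\<lambda>r. couple_diff (C r))) \<and>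
     (\<forall>C. derived_couples (filtration_couple A H) C \<longrightarrow>
        converges_to_twisted_cohomology A H (\<lambda>r. eobj (C r)) (\<lambda>r. couple_diff (C r)) \<and>
        lin_isomorphic
          (direct_sum {(p, q). p + q = 1}
            (\<lambda>(p, q). E_infinity (\<lambda>r. eobj (C r)) (\<lambda>r. couple_diff (C r)) p q))
          (twisted_cohomology A H 1) \<and>
        lin_isomorphic
          (direct_sum {(p, q). p + q = 0}
            (\<lambda>(p, q). E_infinity (\<lambda>r. eobj (C r)) (\<lambda>r. couple_diff (C r)) p q))
          (twisted_cohomology A H 0))"
proof -
  interpret atlas T A by unfold_locales fact
  \<comment> \<open>The components have different degrees; a common space for them to be summed in
    is that of all odd forms.\<close>
  have "Hc (2 * i + 1) \<in> forms A {k. odd k} \<and> ext_deriv A (Hc (2 * i + 1)) = (\<lambda>_ _ _. 0)"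
    if "i \<in> {1..(n - 1) div 2}" for i
    using assms(4)[OF that] forms_mono[of "{2 * i + 1}" "{k. odd k}"] by auto
  then have "H \<in> forms A {k. odd k} \<and> ext_deriv A H = (\<lambda>_ _ _. 0)"
    unfolding assms(5) by (rule closed_forms_sum)
  then interpret twisted T A H by unfold_locales auto
  have "\<exists>C. derived_couples (filtration_couple A H) C \<and>
      (\<forall>p q. eobj (C 1) p q = gr_cohomology A H p (p + q)) \<and>
      spectral_sequence (\<lambda>r. eobj (C r)) (\<lambda>r. couple_diff (C r))"
  proof -
    obtain C where C: "derived_couples (filtration_couple A H) C"
      using derived_couples_exist[OF exact_filtration_couple] by blast
    then have "eobj (C 1) p q = gr_cohomology A H p (p + q)" for p q
      by (simp only: derived_couples_def filtration_couple_sel)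
    then show ?thesis using C derived_couples_spectral_sequence[OF C] by blast
  qed
  then show ?thesis using filtration_convergence by blast
qed

end
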